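(* Let $A$ be a $C^*$-algebra. Then the following are equivalent: (i) $A$ has the ideal property; (ii) for all $a_1,a_2,b_1,b_2\in A^+$ such that $\langle a_i\rangle\le\langle b_j\rangle$ for all $1\le i,j\le 2$, and for every $\varepsilon>0$, there exist a projection $p\in\mathcal P(M_\infty(A))$ and $m\in\mathbb N$ such that $\langle(a_i-\varepsilon)_+\rangle\le\langle p\rangle\le m\langle b_j\rangle$ for all $1\le i,j\le 2$, and $p$ is a finite direct sum of projections of $A$; (iii) for every $a\in A^+$ and every $\varepsilon>0$, there are a projection $p\in\mathcal P(M_\infty(A))$ and $m\in\mathbb N$ such that $\langle(a-\varepsilon)_+\rangle\le\langle p\rangle\le m\langle a\rangle$, and $p$ is a finite direct sum of projections of $A$. (All inequalities are in the Cuntz semigroup $W(A)$.)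
   Context: "Ideal" means closed two-sided ideal. A $C^*$-algebra $A$ has the ideal property if each of its ideals is generated (as an ideal) by the projections it contains. $M_\infty(A)$ is the algebraic inductive limit of the $M_n(A)$ under $x\mapsto x\oplus 0$, and $M_\infty(A)^+$ is its set of positive elements. For $a,b\in M_\infty(A)^+$ write $a\precsim b$ if for some $n$ with $a,b\in M_n(A)$ there is a sequence $\{x_k\}$ in $M_n(A)$ with $a=\lim_k x_k b x_k^*$; write $a\sim b$ if $a\precsim b$ and $b\precsim a$. The Cuntz semigroup is $W(A)=M_\infty(A)^+/\!\sim$, with classes $\langle a\rangle$, addition $\langle a\rangle+\langle b\rangle=\langle a\oplus b\rangle$, and order $\langle a\rangle\le\langle b\rangle\iff a\precsim b$. $\mathcal P(M_\infty(A))$ is the set of projections in $M_\infty(A)$. For positive $a$ and $\varepsilon>0$, $(a-\varepsilon)_+=h_\varepsilon(a)$ where $h_\varepsilon(t)=\max\{t-\varepsilon,0\}$. $p$ is a finite direct sum of projections of $A$ if $p=p_1\oplus\cdots\oplus p_k=\mathrm{diag}(p_1,\dots,p_k)$ with each $p_i$ a projection in $A$. $\mathbb N$ denotes the positive integers. *)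

theory Defs
  imports "HOL-Analysis.Analysis"
begin

section \<open>C*-algebras\<close>

class scaleC =
  fixes scaleC :: "complex \<Rightarrow> 'a \<Rightarrow> 'a"  (infixr "*\<^sub>C" 75)

class adj =
  fixes adj :: "'a \<Rightarrow> 'a"

class star_algebra = ring + scaleC + adj +
  assumes scaleC_add_right: "c *\<^sub>C (x + y) = c *\<^sub>C x + c *\<^sub>C y"
    and scaleC_add_left: "(c + d) *\<^sub>C x = c *\<^sub>C x + d *\<^sub>C x"
    and scaleC_scaleC: "c *\<^sub>C d *\<^sub>C x = (c * d) *\<^sub>C x"
    and scaleC_one: "1 *\<^sub>C x = x"
    and mult_scaleC_left: "(c *\<^sub>C x) * y = c *\<^sub>C (x * y)"
    and mult_scaleC_right: "x * (c *\<^sub>C y) = c *\<^sub>C (x * y)"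
    and adj_adj: "adj (adj x) = x"
    and adj_add: "adj (x + y) = adj x + adj y"
    and adj_mult: "adj (x * y) = adj y * adj x"
    and adj_scaleC: "adj (c *\<^sub>C x) = cnj c *\<^sub>C adj x"

class cstar_algebra = star_algebra + real_normed_algebra + banach +
  assumes scaleR_scaleC: "r *\<^sub>R x = complex_of_real r *\<^sub>C x"
    and norm_scaleC: "norm (c *\<^sub>C x) = cmod c * norm x"
    and cstar_identity: "norm (adj x * x) = (norm x)\<^sup>2"

definition projection :: "'a::star_algebra \<Rightarrow> bool" where
  "projection p \<longleftrightarrow> adj p = p \<and> p * p = p"

definition closed_ideal :: "'a::cstar_algebra set \<Rightarrow> bool" where
  "closed_ideal I \<longleftrightarrow> closed I \<and> 0 \<in> I \<and>
     (\<forall>x\<in>I. \<forall>y\<in>I. x + y \<in> I) \<and> (\<forall>c. \<forall>x\<in>I. c *\<^sub>C x \<in> I) \<and>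
     (\<forall>a. \<forall>x\<in>I. a * x \<in> I \<and> x * a \<in> I)"

definition ideal_property :: "'a::cstar_algebra itself \<Rightarrow> bool" where
  "ideal_property A \<longleftrightarrow>
     (\<forall>I::'a set. closed_ideal I \<longrightarrow> closed_ideal hull {p \<in> I. projection p} = I)"

section \<open>Spectrum, positivity and functional calculus\<close>

text \<open>
  Elements of the unitization \<open>\<complex> \<oplus> A\<close> are pairs, the unit being \<open>(1, 0)\<close>.  The unitization is
  formed even if \<open>A\<close> has a unit, so the spectrum below always contains \<open>0\<close>; for unital \<open>A\<close> it is
  the usual spectrum together with \<open>0\<close>.  Neither positivity nor \<open>f(a)\<close> with \<open>f(0) = 0\<close> is
  affected by this.
\<close>

definition unitization_mult ::
  "complex \<times> 'a::star_algebra \<Rightarrow> complex \<times> 'a \<Rightarrow> complex \<times> 'a" where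
  "unitization_mult u v =
     (fst u * fst v, fst u *\<^sub>C snd v + fst v *\<^sub>C snd u + snd u * snd v)"

definition spectrum :: "'a::star_algebra \<Rightarrow> complex set" where
  "spectrum a = {z. \<not> (\<exists>u. unitization_mult (z, - a) u = (1, 0) \<and>
                          unitization_mult u (z, - a) = (1, 0))}"

definition positive_element :: "'a::star_algebra \<Rightarrow> bool" where
  "positive_element a \<longleftrightarrow> adj a = a \<and> (\<forall>z\<in>spectrum a. z \<in> \<real> \<and> 0 \<le> Re z)"

definition C0_spectrum :: "'a::star_algebra \<Rightarrow> (complex \<Rightarrow> complex) set" where
  "C0_spectrum a = {f. continuous_on (spectrum a) f \<and> f 0 = 0}"

text \<open>
  \<open>\<Phi>\<close> is the isometric *-homomorphism from the continuous functions on the spectrum vanishing at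
  \<open>0\<close> into \<open>A\<close> that sends the identity function to \<open>a\<close>; for normal \<open>a\<close> it exists and is unique (on
  \<open>C0_spectrum a\<close>).  The isometry condition makes \<open>\<Phi> f\<close> depend only on \<open>f\<close> restricted to the
  spectrum.
\<close>

definition functional_calculus ::
  "'a::cstar_algebra \<Rightarrow> ((complex \<Rightarrow> complex) \<Rightarrow> 'a) \<Rightarrow> bool" where
  "functional_calculus a \<Phi> \<longleftrightarrow>
     \<Phi> (\<lambda>z. z) = a \<and>
     (\<forall>f\<in>C0_spectrum a.
        norm (\<Phi> f) = (SUP z\<in>spectrum a. cmod (f z)) \<and>
        \<Phi> (\<lambda>z. cnj (f z)) = adj (\<Phi> f) \<and>
        (\<forall>c. \<Phi> (\<lambda>z. c * f z) = c *\<^sub>C \<Phi> f) \<and>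
        (\<forall>g\<in>C0_spectrum a. \<Phi> (\<lambda>z. f z + g z) = \<Phi> f + \<Phi> g \<and>
                            \<Phi> (\<lambda>z. f z * g z) = \<Phi> f * \<Phi> g))"

definition cfc :: "(complex \<Rightarrow> complex) \<Rightarrow> 'a::cstar_algebra \<Rightarrow> 'a" where
  "cfc f a = (THE b. \<exists>\<Phi>. functional_calculus a \<Phi> \<and> \<Phi> f = b)"

text \<open>The element \<open>(a - \<epsilon>)\<^sub>+\<close>.\<close>

definition cut_down :: "'a::cstar_algebra \<Rightarrow> real \<Rightarrow> 'a" where
  "cut_down a \<epsilon> = cfc (\<lambda>z. complex_of_real (max (Re z - \<epsilon>) 0)) a"

section \<open>Matrices over a C*-algebra\<close>

text \<open>
  The union of the \<open>M\<^sub>n(A)\<close> along \<open>x \<mapsto> x \<oplus> 0\<close>, as \<open>\<nat> \<times> \<nat>\<close> matrices with entries \<open>0\<close> outside a finite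
  upper left corner.
\<close>

typedef (overloaded) 'a minf =
  "{x :: nat \<Rightarrow> nat \<Rightarrow> 'a::zero. \<exists>n. \<forall>i j. n \<le> i \<or> n \<le> j \<longrightarrow> x i j = 0}"
  morphisms entry Abs_minf
  by (intro exI[of _ "\<lambda>_ _. 0"]) simp

setup_lifting type_definition_minf

lemma minf_eqI: "(\<And>i j. entry x i j = entry y i j) \<Longrightarrow> x = y"
  by (simp add: entry_inject[symmetric] fun_eq_iff)

definition mats :: "nat \<Rightarrow> 'a::zero minf set" where
  "mats n = {x. \<forall>i j. n \<le> i \<or> n \<le> j \<longrightarrow> entry x i j = 0}"

lemma M_mono: "m \<le> n \<Longrightarrow> mats m \<subseteq> mats n"
  unfolding mats_def using order_trans by blast

lemma ex_M: "\<exists>n. x \<in> mats n"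
  unfolding mats_def using entry[of x] by auto

lemma obtain_M2:
  obtains n where "x \<in> mats n" "y \<in> mats n"
  by (metis M_mono ex_M nle_le subsetD)

lemma sum_row_eq:
  fixes x :: "'a::ring minf"
  assumes "x \<in> mats n"
  shows "(\<Sum>k | entry x i k \<noteq> 0. entry x i k * v k) = (\<Sum>k<n. entry x i k * v k)"
proof (rule sum.mono_neutral_left)
  show "{k. entry x i k \<noteq> 0} \<subseteq> {..<n}"
    using assms unfolding mats_def by (auto simp: not_le[symmetric])
qed auto

instantiation minf :: (star_algebra) star_algebra
begin

lift_definition zero_minf :: "'a minf" is "\<lambda>_ _. 0" by simp

lift_definition plus_minf :: "'a minf \<Rightarrow> 'a minf \<Rightarrow> 'a minf" is "\<lambda>x y i j. x i j + y i j"
proof -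
  fix x y :: "nat \<Rightarrow> nat \<Rightarrow> 'a"
  assume "\<exists>n. \<forall>i j. n \<le> i \<or> n \<le> j \<longrightarrow> x i j = 0" "\<exists>n. \<forall>i j. n \<le> i \<or> n \<le> j \<longrightarrow> y i j = 0"
  then obtain m n where "\<forall>i j. m \<le> i \<or> m \<le> j \<longrightarrow> x i j = 0" "\<forall>i j. n \<le> i \<or> n \<le> j \<longrightarrow> y i j = 0"
    by blast
  then show "\<exists>n. \<forall>i j. n \<le> i \<or> n \<le> j \<longrightarrow> x i j + y i j = 0"
    by (intro exI[of _ "max m n"]) auto
qed

lift_definition uminus_minf :: "'a minf \<Rightarrow> 'a minf" is "\<lambda>x i j. - x i j" by simp

definition minus_minf :: "'a minf \<Rightarrow> 'a minf \<Rightarrow> 'a minf" where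
  "minus_minf x y = x + - y"

lift_definition times_minf :: "'a minf \<Rightarrow> 'a minf \<Rightarrow> 'a minf"
  is "\<lambda>x y i j. \<Sum>k | x i k \<noteq> 0. x i k * y k j"
proof -
  fix x y :: "nat \<Rightarrow> nat \<Rightarrow> 'a"
  assume "\<exists>n. \<forall>i j. n \<le> i \<or> n \<le> j \<longrightarrow> x i j = 0" "\<exists>n. \<forall>i j. n \<le> i \<or> n \<le> j \<longrightarrow> y i j = 0"
  then obtain m n where "\<forall>i j. m \<le> i \<or> m \<le> j \<longrightarrow> x i j = 0" "\<forall>i j. n \<le> i \<or> n \<le> j \<longrightarrow> y i j = 0"
    by blast
  then show "\<exists>n. \<forall>i j. n \<le> i \<or> n \<le> j \<longrightarrow> (\<Sum>k | x i k \<noteq> 0. x i k * y k j) = 0"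
    by (intro exI[of _ "max m n"]) auto
qed

lift_definition scaleC_minf :: "complex \<Rightarrow> 'a minf \<Rightarrow> 'a minf" is "\<lambda>c x i j. c *\<^sub>C x i j"
proof -
  fix c and x :: "nat \<Rightarrow> nat \<Rightarrow> 'a"
  have "c *\<^sub>C (0::'a) = 0"
    using scaleC_add_right[of c "0::'a" 0] by simp
  then show "\<exists>n. \<forall>i j. n \<le> i \<or> n \<le> j \<longrightarrow> x i j = 0 \<Longrightarrow>
      \<exists>n. \<forall>i j. n \<le> i \<or> n \<le> j \<longrightarrow> c *\<^sub>C x i j = 0"
    by metis
qed

lift_definition adj_minf :: "'a minf \<Rightarrow> 'a minf" is "\<lambda>x i j. adj (x j i)"
proof -
  fix x :: "nat \<Rightarrow> nat \<Rightarrow> 'a"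
  have "adj (0::'a) = 0"
    using adj_add[of "0::'a" 0] by simp
  then show "\<exists>n. \<forall>i j. n \<le> i \<or> n \<le> j \<longrightarrow> x i j = 0 \<Longrightarrow>
      \<exists>n. \<forall>i j. n \<le> i \<or> n \<le> j \<longrightarrow> adj (x j i) = 0"
    by metis
qed

lemma entry_times:
  fixes x y :: "'a minf"
  assumes "x \<in> mats n"
  shows "entry (x * y) i j = (\<Sum>k<n. entry x i k * entry y k j)"
  by (simp add: times_minf.rep_eq sum_row_eq[OF assms])

lemma times_in_M:
  fixes x y :: "'a minf"
  assumes "x \<in> mats n" "y \<in> mats n"
  shows "x * y \<in> mats n"
  using assms by (auto simp: mats_def times_minf.rep_eq intro!: sum.neutral)

instance
proof
  have adj_sum: "adj (sum f S) = (\<Sum>k\<in>S. adj (f k))" for f :: "nat \<Rightarrow> 'a" and S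
  proof (induction S rule: infinite_finite_induct)
    case (insert k S)
    then show ?case by (simp add: adj_add)
  qed (use adj_add[of "0::'a" 0] in simp_all)
  have scale_sum: "c *\<^sub>C (sum f S) = (\<Sum>k\<in>S. c *\<^sub>C f k)" for c and f :: "nat \<Rightarrow> 'a" and S
  proof (induction S rule: infinite_finite_induct)
    case (insert k S)
    then show ?case by (simp add: scaleC_add_right)
  qed (use scaleC_add_right[of c "0::'a" 0] in simp_all)
  have zero[simp]: "c *\<^sub>C (0::'a) = 0" for c
    using scaleC_add_right[of c "0::'a" 0] by simp
  have M_scale: "c *\<^sub>C x \<in> mats n" if "x \<in> mats n" for c and x :: "'a minf" and n
    using that by (auto simp: mats_def scaleC_minf.rep_eq)
  have M_plus: "x + y \<in> mats n" if "x \<in> mats n" "y \<in> mats n" for x y :: "'a minf" and n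
    using that by (auto simp: mats_def plus_minf.rep_eq)
  have M_adj: "adj x \<in> mats n" if "x \<in> mats n" for x :: "'a minf" and n
    using that adj_add[of "0::'a" 0] by (auto simp: mats_def adj_minf.rep_eq)
  fix x y z :: "'a minf" and c d :: complex
  show "x + y + z = x + (y + z)" by (rule minf_eqI) (simp add: plus_minf.rep_eq add.assoc)
  show "x + y = y + x" by (rule minf_eqI) (simp add: plus_minf.rep_eq add.commute)
  show "0 + x = x" by (rule minf_eqI) (simp add: plus_minf.rep_eq zero_minf.rep_eq)
  show "- x + x = 0"
    by (rule minf_eqI) (simp add: plus_minf.rep_eq zero_minf.rep_eq uminus_minf.rep_eq)
  show "x - y = x + - y" by (rule minus_minf_def)
  show "c *\<^sub>C (x + y) = c *\<^sub>C x + c *\<^sub>C y"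
    by (rule minf_eqI) (simp add: plus_minf.rep_eq scaleC_minf.rep_eq scaleC_add_right)
  show "(c + d) *\<^sub>C x = c *\<^sub>C x + d *\<^sub>C x"
    by (rule minf_eqI) (simp add: plus_minf.rep_eq scaleC_minf.rep_eq scaleC_add_left)
  show "c *\<^sub>C d *\<^sub>C x = (c * d) *\<^sub>C x"
    by (rule minf_eqI) (simp add: scaleC_minf.rep_eq scaleC_scaleC)
  show "1 *\<^sub>C x = x"
    by (rule minf_eqI) (simp add: scaleC_minf.rep_eq scaleC_one)
  show "adj (adj x) = x"
    by (rule minf_eqI) (simp add: adj_minf.rep_eq adj_adj)
  show "adj (x + y) = adj x + adj y"
    by (rule minf_eqI) (simp add: adj_minf.rep_eq plus_minf.rep_eq adj_add)
  show "adj (c *\<^sub>C x) = cnj c *\<^sub>C adj x"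
    by (rule minf_eqI) (simp add: adj_minf.rep_eq scaleC_minf.rep_eq adj_scaleC)
  obtain n where x: "x \<in> mats n" and y: "y \<in> mats n"
    by (rule obtain_M2)
  show "c *\<^sub>C x * y = c *\<^sub>C (x * y)"
    by (rule minf_eqI)
      (simp add: entry_times[OF x] entry_times[OF M_scale[OF x]] scaleC_minf.rep_eq scale_sum
        mult_scaleC_left)
  show "x * (c *\<^sub>C y) = c *\<^sub>C (x * y)"
    by (rule minf_eqI)
      (simp add: entry_times[OF x] scaleC_minf.rep_eq scale_sum mult_scaleC_right)
  show "adj (x * y) = adj y * adj x"
    by (rule minf_eqI)
      (simp add: entry_times[OF x] entry_times[OF M_adj[OF y]] adj_minf.rep_eq adj_sum adj_mult)
  show "(x + y) * z = x * z + y * z"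
    by (rule minf_eqI)
      (simp add: entry_times[OF x] entry_times[OF y] entry_times[OF M_plus[OF x y]]
        plus_minf.rep_eq distrib_right sum.distrib)
  show "x * (y + z) = x * y + x * z"
    by (rule minf_eqI)
      (simp add: entry_times[OF x] plus_minf.rep_eq distrib_left sum.distrib)
  show "x * y * z = x * (y * z)"
  proof (rule minf_eqI)
    fix i j
    have "entry (x * y * z) i j
        = (\<Sum>l<n. \<Sum>k<n. entry x i k * entry y k l * entry z l j)"
      by (simp add: entry_times[OF times_in_M[OF x y]] entry_times[OF x] sum_distrib_right)
    also have "\<dots> = (\<Sum>k<n. \<Sum>l<n. entry x i k * entry y k l * entry z l j)"
      by (rule sum.swap)
    also have "\<dots> = entry (x * (y * z)) i j"
      by (simp add: entry_times[OF x] entry_times[OF y] sum_distrib_left mult.assoc)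
    finally show "entry (x * y * z) i j = entry (x * (y * z)) i j" .
  qed
qed

end

text \<open>
  The C*-norm of \<open>M\<^sub>n(A)\<close>, realised as the operator norm for the action on the Hilbert module of
  columns \<open>\<xi>\<close> over \<open>A\<close>, with \<open>\<parallel>\<xi>\<parallel>\<^sup>2 = \<parallel>\<Sum>\<^sub>i \<xi>\<^sub>i\<^sup>* \<xi>\<^sub>i\<parallel>\<close>.  Columns of any finite length may be used for
  every \<open>n\<close>, as truncating a column does not increase its norm.
\<close>

definition column_norm :: "(nat \<Rightarrow> 'a::cstar_algebra) \<Rightarrow> real" where
  "column_norm \<xi> = sqrt (norm (\<Sum>i | \<xi> i \<noteq> 0. adj (\<xi> i) * \<xi> i))"

definition apply_column :: "'a::cstar_algebra minf \<Rightarrow> (nat \<Rightarrow> 'a) \<Rightarrow> (nat \<Rightarrow> 'a)" where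
  "apply_column x \<xi> = (\<lambda>i. \<Sum>k | entry x i k \<noteq> 0. entry x i k * \<xi> k)"

definition matrix_norm :: "'a::cstar_algebra minf \<Rightarrow> real" where
  "matrix_norm x =
     (SUP \<xi>\<in>{\<xi>. finite {i. \<xi> i \<noteq> 0} \<and> column_norm \<xi> \<le> 1}. column_norm (apply_column x \<xi>))"

lift_definition diag :: "'a::zero list \<Rightarrow> 'a minf"
  is "\<lambda>ps i j. if i = j \<and> i < length ps then ps ! i else 0"
  by (metis leD)

text \<open>The inclusion of \<open>A = M\<^sub>1(A)\<close>.\<close>

abbreviation corner :: "'a::zero \<Rightarrow> 'a minf" where
  "corner a \<equiv> diag [a]"

text \<open>\<open>a \<oplus> b\<close> for \<open>a \<in> M\<^sub>n(A)\<close>.\<close>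

lift_definition direct_sum :: "nat \<Rightarrow> 'a::zero minf \<Rightarrow> 'a minf \<Rightarrow> 'a minf"
  is "\<lambda>n a b i j. if i < n \<and> j < n then a i j
                  else if n \<le> i \<and> n \<le> j then b (i - n) (j - n) else 0"
proof -
  fix n and a b :: "nat \<Rightarrow> nat \<Rightarrow> 'a"
  assume "\<exists>m. \<forall>i j. m \<le> i \<or> m \<le> j \<longrightarrow> b i j = 0"
  then obtain m where "\<forall>i j. m \<le> i \<or> m \<le> j \<longrightarrow> b i j = 0" by blast
  then show "\<exists>m. \<forall>i j. m \<le> i \<or> m \<le> j \<longrightarrow>
      (if i < n \<and> j < n then a i j
       else if n \<le> i \<and> n \<le> j then b (i - n) (j - n) else 0) = 0"
    by (intro exI[of _ "n + m"]) auto
qed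

section \<open>The Cuntz semigroup\<close>

definition cuntz_below :: "'a::cstar_algebra minf \<Rightarrow> 'a minf \<Rightarrow> bool"  (infix "\<precsim>" 50) where
  "a \<precsim> b \<longleftrightarrow>
     (\<exists>n. a \<in> mats n \<and> b \<in> mats n \<and>
        (\<exists>x. (\<forall>k. x k \<in> mats n) \<and> (\<lambda>k::nat. matrix_norm (x k * b * adj (x k) - a)) \<longlonglongrightarrow> 0))"

definition cuntz_equiv :: "('a::cstar_algebra minf \<times> 'a minf) set" where
  "cuntz_equiv = {(a, b). positive_element a \<and> positive_element b \<and> a \<precsim> b \<and> b \<precsim> a}"

text \<open>
  Addition and order on the Cuntz semigroup are given on equivalence classes through
  representatives.  The class of \<open>a \<oplus> b\<close> depends neither on the representatives nor on the
  block size \<open>n\<close> with \<open>a \<in> mats n\<close>.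
\<close>

definition cuntz_class :: "'a::cstar_algebra minf \<Rightarrow> 'a minf set"  ("\<langle>_\<rangle>") where
  "\<langle>a\<rangle> = cuntz_equiv `` {a}"

definition cuntz_semigroup :: "'a::cstar_algebra minf set set" where
  "cuntz_semigroup = {a. positive_element a} // cuntz_equiv"

definition cuntz_le :: "'a::cstar_algebra minf set \<Rightarrow> 'a minf set \<Rightarrow> bool"
    (infix "\<le>\<^sub>W" 50) where
  "X \<le>\<^sub>W Y \<longleftrightarrow> (\<exists>a\<in>X. \<exists>b\<in>Y. a \<precsim> b)"

definition cuntz_plus :: "'a::cstar_algebra minf set \<Rightarrow> 'a minf set \<Rightarrow> 'a minf set"
    (infixl "+\<^sub>W" 65) where
  "X +\<^sub>W Y = (\<Union>a\<in>X. \<Union>b\<in>Y. \<Union>n\<in>{n. a \<in> mats n}. \<langle>direct_sum n a b\<rangle>)"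

primrec cuntz_multiple :: "nat \<Rightarrow> 'a::cstar_algebra minf set \<Rightarrow> 'a minf set"
    (infixr "\<cdot>\<^sub>W" 70) where
  "0 \<cdot>\<^sub>W X = \<langle>0\<rangle>"
| "Suc m \<cdot>\<^sub>W X = X +\<^sub>W m \<cdot>\<^sub>W X"

definition sum_of_projections :: "'a::star_algebra minf \<Rightarrow> bool" where
  "sum_of_projections p \<longleftrightarrow> (\<exists>ps. ps \<noteq> [] \<and> (\<forall>q\<in>set ps. projection q) \<and> p = diag ps)"

end

(* An approximation a ~ sum x b y in the closed ideal generated by positive elements b is symmetrized to
   a - epsilon/2 <= c = 1/2 sum (x b x* + y* b y), and cutting down by a function e of a gives
   (a - epsilon)_+ <= e c e, a sum of conjugates of the elements b.  So if the ideal of the a_i is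
   generated by projections, (a_i - epsilon)_+ is below a finite direct sum of them, and each summand,
   lying in the ideal generated by b_j, is below a multiple of b_j.  Conversely, if a is Cuntz below b,
   the entries of a lie in any closed ideal containing those of b; so for x in a closed ideal I, (iii)
   places x*x, and hence x, in the ideal generated by the projections of I.  Spectral theory and the
   continuous functional calculus are carried out in the unitization, normed by its action on C + A. *)

theory Submission
  imports Defs "HOL-Computational_Algebra.Fundamental_Theorem_Algebra"
begin

section \<open>The unitization as a C*-algebra\<close>

text \<open>A is not assumed unital, so even reflexivity of Cuntz comparison needs an approximation
  in place of conjugation by 1. Square roots, inverses and the coefficients in ideal sums live in
  the unitization, and each construction must return to A. The scalar part is multiplicative, so one
  factor with zero scalar part is enough for that. Since \<open>cut_down\<close> is a definite
  description, a functional calculus must be shown both to exist and to be unique. The spectral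
  radius is found for self-adjoint elements only, by averaging resolvents over the unit circle, so
  that no analytic functions with values in a Banach algebra enter.

  Cutting down loses \<epsilon> on the a_i but nothing on a projection: (p - 1/2)_+ is p/2. Hence
  the lemma that bounds the (a_i - \<epsilon>)_+ by projections also bounds the projections
  themselves by copies of b_j. The converse relies on p being a diagonal of projections of A: its
  entries are then projections in the given ideal, whereas the entries of a general projection in
  M_n(A) are not projections.\<close>

class cstar_algebra_1 = cstar_algebra + real_normed_algebra_1

lemma scaleC_zero_right [simp]: "c *\<^sub>C (0::'a::star_algebra) = 0"
  using scaleC_add_right[of c "0::'a" 0] by simp

lemma scaleC_zero_left [simp]: "0 *\<^sub>C (x::'a::star_algebra) = 0"
  using scaleC_add_left[of 0 0 x] by simp

lemma scaleC_minus_right [simp]: "c *\<^sub>C (- x) = - (c *\<^sub>C (x::'a::star_algebra))"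
  using scaleC_add_right[of c x "- x"] by (simp add: eq_neg_iff_add_eq_0 add.commute)

lemma scaleC_minus_left [simp]: "(- c) *\<^sub>C x = - (c *\<^sub>C (x::'a::star_algebra))"
  using scaleC_add_left[of c "- c" x] by (simp add: eq_neg_iff_add_eq_0 add.commute)

lemma scaleC_diff_right: "c *\<^sub>C (x - y) = c *\<^sub>C x - c *\<^sub>C (y::'a::star_algebra)"
  using scaleC_add_right[of c x "- y"] by simp

lemma scaleC_diff_left: "(c - d) *\<^sub>C x = c *\<^sub>C x - d *\<^sub>C (x::'a::star_algebra)"
  using scaleC_add_left[of c "- d" x] by simp

lemma adj_zero [simp]: "adj (0::'a::star_algebra) = 0"
  using adj_add[of "0::'a" 0] by simp

lemma adj_minus [simp]: "adj (- x) = - adj (x::'a::star_algebra)"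
  using adj_add[of x "- x"] by (simp add: eq_neg_iff_add_eq_0 add.commute)

lemma adj_diff: "adj (x - y) = adj x - adj (y::'a::star_algebra)"
  using adj_add[of x "- y"] by simp

lemma adj_scaleR: "adj (r *\<^sub>R x) = r *\<^sub>R adj (x::'a::cstar_algebra)"
  by (simp add: scaleR_scaleC adj_scaleC)

declare adj_adj [simp] scaleC_one [simp]

lemma adj_one [simp]: "adj (1::'a::cstar_algebra_1) = 1"
  by (metis adj_adj adj_mult mult.right_neutral)

lemma norm_adj [simp]: "norm (adj x) = norm (x::'a::cstar_algebra)"
proof -
  have le: "norm y \<le> norm (adj y)" for y :: 'a
  proof (cases "y = 0")
    case False
    have "norm y * norm y \<le> norm (adj y) * norm y"
      using cstar_identity[of y] norm_mult_ineq[of "adj y" y] by (simp add: power2_eq_square)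
    then show ?thesis using False by simp
  qed simp
  show ?thesis using le[of x] le[of "adj x"] by simp
qed

lemma norm_mult_adj: "norm (x * adj x) = (norm (x::'a::cstar_algebra))\<^sup>2"
  using cstar_identity[of "adj x"] by simp

text \<open>A new type, because pairs already carry the Euclidean norm, which is not the
  C*-norm.\<close>

datatype 'a unitz = Unitz (scal: complex) (vec: 'a)

lemma unitz_eqI: "scal u = scal v \<Longrightarrow> vec u = vec v \<Longrightarrow> u = v"
  by (cases u; cases v) simp

definition lmul :: "'a::cstar_algebra unitz \<Rightarrow> 'a \<Rightarrow> 'a" where
  "lmul u x = scal u *\<^sub>C x + vec u * x"

lemma bounded_linear_lmul: "bounded_linear (lmul u)"
proof (rule bounded_linear_intro[where K = "cmod (scal u) + norm (vec u)"])
  fix x y :: 'a and r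
  show "lmul u (x + y) = lmul u x + lmul u y"
    by (simp add: lmul_def scaleC_add_right distrib_left)
  show "lmul u (r *\<^sub>R x) = r *\<^sub>R lmul u x"
    by (simp add: lmul_def scaleR_scaleC scaleC_add_right scaleC_scaleC mult_scaleC_right mult.commute)
  have "norm (lmul u x) \<le> cmod (scal u) * norm x + norm (vec u) * norm x"
    unfolding lmul_def
    by (intro norm_triangle_le add_mono norm_mult_ineq) (simp add: norm_scaleC)
  then show "norm (lmul u x) \<le> norm x * (cmod (scal u) + norm (vec u))"
    by (simp add: algebra_simps)
qed

lemmas onorm_lmul = onorm[OF bounded_linear_lmul]

instantiation unitz :: (cstar_algebra) star_algebra
begin

definition "0 = Unitz 0 0"
definition "u + v = Unitz (scal u + scal v) (vec u + vec v)"
definition "- u = Unitz (- scal u) (- vec u)"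
definition "u - v = Unitz (scal u - scal v) (vec u - vec v)"
definition "u * v =
  Unitz (scal u * scal v) (scal u *\<^sub>C vec v + scal v *\<^sub>C vec u + vec u * vec v)"
definition "c *\<^sub>C u = Unitz (c * scal u) (c *\<^sub>C vec u)"
definition "adj u = Unitz (cnj (scal u)) (adj (vec u))"

lemma unitz_sel [simp]:
  "scal (0::'a unitz) = 0" "vec (0::'a unitz) = 0"
  "scal (u + v) = scal u + scal v" "vec (u + v) = vec u + vec v"
  "scal (- u) = - scal u" "vec (- u) = - vec u"
  "scal (u - v) = scal u - scal v" "vec (u - v) = vec u - vec v"
  "scal (u * v) = scal u * scal v"
  "vec (u * v) = scal u *\<^sub>C vec v + scal v *\<^sub>C vec u + vec u * vec v"
  "scal (c *\<^sub>C u) = c * scal u" "vec (c *\<^sub>C u) = c *\<^sub>C vec u"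
  "scal (adj u) = cnj (scal u)" "vec (adj u) = adj (vec u)"
  for u v :: "'a unitz"
  by (simp_all add: zero_unitz_def plus_unitz_def uminus_unitz_def minus_unitz_def
      times_unitz_def scaleC_unitz_def adj_unitz_def)

instance
  by standard
    (auto intro!: unitz_eqI simp: algebra_simps scaleC_add_left scaleC_add_right scaleC_scaleC
      mult_scaleC_left mult_scaleC_right adj_add adj_mult adj_scaleC)

end

lemma lmul_mult: "lmul (u * v) = lmul u \<circ> lmul v"
  by (simp add: lmul_def fun_eq_iff algebra_simps scaleC_add_left scaleC_add_right scaleC_scaleC
      mult_scaleC_left mult_scaleC_right)

lemma lmul_add: "lmul (u + v) = (\<lambda>x. lmul u x + lmul v x)"
  by (simp add: lmul_def fun_eq_iff algebra_simps scaleC_add_left)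

text \<open>Testing the action on \<open>adj a\<close> gives \<open>norm (a * adj a)\<close>, which
  the C*-identity turns into the square of \<open>norm a\<close>. This makes the norm below definite
  and \<open>emb\<close> isometric.\<close>

lemma norm_le_onorm_lmul: "norm a \<le> onorm (lmul (Unitz 0 a))"
proof (cases "a = 0")
  case True
  then show ?thesis using onorm_pos_le[OF bounded_linear_lmul, of "Unitz 0 a"] by simp
next
  case False
  have "norm a * norm a \<le> onorm (lmul (Unitz 0 a)) * norm a"
    using onorm_lmul[of "Unitz 0 a" "adj a"] norm_mult_adj[of a]
    by (simp add: lmul_def power2_eq_square)
  then show ?thesis using False by simp
qed

instantiation unitz :: (cstar_algebra) real_normed_algebra_1
begin

definition "1 = Unitz 1 0"
definition "scaleR r u = complex_of_real r *\<^sub>C (u::'a unitz)"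
(* If A has a unit, the operator norm alone is only a seminorm: (1, -1) acts as 0. *)
definition "norm u = max (cmod (scal u)) (onorm (lmul u))"
definition "dist u v = norm (u - v)" for u v :: "'a unitz"
definition "sgn u = inverse (norm u) *\<^sub>R u" for u :: "'a unitz"
definition "uniformity = (INF e\<in>{0 <..}. principal {(x::'a unitz, y). dist x y < e})"
definition "open U \<longleftrightarrow> (\<forall>x\<in>U. \<forall>\<^sub>F (x', y) in uniformity. x' = x \<longrightarrow> y \<in> U)"
  for U :: "'a unitz set"

lemma unitz_one_sel [simp]: "scal (1::'a unitz) = 1" "vec (1::'a unitz) = 0"
  by (simp_all add: one_unitz_def)

instance
proof
  fix u v w :: "'a unitz" and r s :: real
  show "dist u v = norm (u - v)" by (rule dist_unitz_def)
  show "sgn u = inverse (norm u) *\<^sub>R u" by (rule sgn_unitz_def)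
  show "(uniformity :: ('a unitz \<times> 'a unitz) filter) = (INF e\<in>{0 <..}. principal {(x, y). dist x y < e})"
    by (rule uniformity_unitz_def)
  show "open U = (\<forall>x\<in>U. \<forall>\<^sub>F (x', y) in uniformity. x' = x \<longrightarrow> y \<in> U)" for U :: "'a unitz set"
    by (rule open_unitz_def)
  show "1 * u = u" "u * 1 = u" by (auto intro!: unitz_eqI)
  show "(0::'a unitz) \<noteq> 1" by (metis unitz_one_sel(1) unitz_sel(1) zero_neq_one)
  show "r *\<^sub>R (u + v) = r *\<^sub>R u + r *\<^sub>R v" "(r + s) *\<^sub>R u = r *\<^sub>R u + s *\<^sub>R u"
    "r *\<^sub>R s *\<^sub>R u = (r * s) *\<^sub>R u" "1 *\<^sub>R u = u" "r *\<^sub>R u * v = r *\<^sub>R (u * v)"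
    "u * r *\<^sub>R v = r *\<^sub>R (u * v)"
    by (simp_all add: scaleR_unitz_def scaleC_add_right scaleC_add_left scaleC_scaleC
        mult_scaleC_left mult_scaleC_right)
  show "norm u = 0 \<longleftrightarrow> u = 0"
  proof
    assume n: "norm u = 0"
    then have "cmod (scal u) \<le> 0" "onorm (lmul u) \<le> 0"
      unfolding norm_unitz_def by (metis max.cobounded1 max.cobounded2)+
    then have s: "scal u = 0" by simp
    then have "u = Unitz 0 (vec u)" by (simp add: unitz_eqI)
    then have "norm (vec u) \<le> 0"
      using norm_le_onorm_lmul[of "vec u"] \<open>onorm (lmul u) \<le> 0\<close> by (metis order_trans)
    then show "u = 0" using s by (simp add: unitz_eqI)
  next
    assume "u = 0"
    then have "lmul u = (\<lambda>x. 0)" by (simp add: lmul_def fun_eq_iff)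
    then show "norm u = 0" using \<open>u = 0\<close> by (simp add: norm_unitz_def onorm_zero)
  qed
  show "norm (u + v) \<le> norm u + norm v"
  proof -
    have "onorm (lmul (u + v)) \<le> onorm (lmul u) + onorm (lmul v)"
      unfolding lmul_add by (rule onorm_triangle[OF bounded_linear_lmul bounded_linear_lmul])
    then show ?thesis
      using norm_triangle_ineq[of "scal u" "scal v"] unfolding norm_unitz_def unitz_sel by linarith
  qed
  show "norm (r *\<^sub>R u) = \<bar>r\<bar> * norm u"
  proof -
    have "lmul (r *\<^sub>R u) = (\<lambda>x. r *\<^sub>R lmul u x)"
      by (simp add: scaleR_unitz_def lmul_def fun_eq_iff Defs.scaleR_scaleC scaleC_add_right
          scaleC_scaleC mult_scaleC_left)
    then have "onorm (lmul (r *\<^sub>R u)) = \<bar>r\<bar> * onorm (lmul u)"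
      using onorm_scaleR[OF bounded_linear_lmul] by simp
    moreover have "cmod (scal (r *\<^sub>R u)) = \<bar>r\<bar> * cmod (scal u)"
      by (simp add: scaleR_unitz_def norm_mult)
    ultimately show ?thesis by (simp add: norm_unitz_def max_mult_distrib_left)
  qed
  show "norm (u * v) \<le> norm u * norm v"
  proof -
    have "onorm (lmul (u * v)) \<le> onorm (lmul u) * onorm (lmul v)"
      unfolding lmul_mult by (rule onorm_compose[OF bounded_linear_lmul bounded_linear_lmul])
    also have "\<dots> \<le> norm u * norm v"
      by (intro mult_mono) (auto simp: norm_unitz_def le_max_iff_disj onorm_pos_le bounded_linear_lmul)
    finally have 1: "onorm (lmul (u * v)) \<le> norm u * norm v" .
    have "cmod (scal u) * cmod (scal v) \<le> norm u * norm v"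
      by (intro mult_mono) (auto simp: norm_unitz_def le_max_iff_disj)
    then show ?thesis using 1 by (simp add: norm_unitz_def[of "u * v"] norm_mult)
  qed
  show "norm (1 :: 'a unitz) = 1"
  proof -
    have "lmul (1 :: 'a unitz) = (\<lambda>x. x)" by (simp add: lmul_def fun_eq_iff)
    moreover have "onorm (\<lambda>x::'a. x) \<le> 1" by (rule onorm_bound) simp_all
    ultimately show ?thesis by (simp add: norm_unitz_def max_absorb1)
  qed
qed

end

lemma norm_scal_le: "cmod (scal u) \<le> norm u"
  by (simp add: norm_unitz_def)

lemma onorm_lmul_le: "onorm (lmul u) \<le> norm u"
  by (simp add: norm_unitz_def)

lemma norm_unitz_le: "norm u \<le> cmod (scal u) + norm (vec u)"
proof -
  have "onorm (lmul u) \<le> cmod (scal u) + norm (vec u)"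
  proof (rule onorm_bound)
    fix x
    have "norm (lmul u x) \<le> cmod (scal u) * norm x + norm (vec u) * norm x"
      unfolding lmul_def
      by (intro norm_triangle_le add_mono norm_mult_ineq) (simp add: norm_scaleC)
    then show "norm (lmul u x) \<le> (cmod (scal u) + norm (vec u)) * norm x"
      by (simp add: algebra_simps)
  qed simp
  then show ?thesis by (simp add: norm_unitz_def)
qed

abbreviation emb :: "'a::cstar_algebra \<Rightarrow> 'a unitz" where "emb \<equiv> Unitz 0"

lemma norm_emb [simp]: "norm (emb a) = norm a"
proof (rule antisym)
  show "norm (emb a) \<le> norm a" using norm_unitz_le[of "emb a"] by simp
  show "norm a \<le> norm (emb a)" using norm_le_onorm_lmul[of a] onorm_lmul_le[of "emb a"] by simp
qed

text \<open>With \<open>norm_unitz_le\<close> and \<open>norm_scal_le\<close> this makes convergence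
  in the unitization coordinatewise, which gives completeness. The 2 arises because
  \<open>vec u\<close> is \<open>u\<close> minus its scalar part, and both have norm at most
  \<open>norm u\<close>.\<close>

lemma norm_vec_le: "norm (vec u) \<le> 2 * norm u"
proof -
  have "norm (vec u) = norm (u - Unitz (scal u) 0)"
    using norm_emb[of "vec u"] by (simp add: minus_unitz_def)
  also have "\<dots> \<le> norm u + norm (Unitz (scal u) (0::'a))" by (rule norm_triangle_ineq4)
  also have "\<dots> \<le> norm u + norm u"
    using norm_unitz_le[of "Unitz (scal u) (0::'a)"] norm_scal_le[of u] by simp
  finally show ?thesis by simp
qed

text \<open>For x in A, \<open>adj (lmul u x) * lmul u x = adj x * lmul (adj u * u) x\<close>, so
  the C*-identity of A bounds the square of the operator norm of \<open>u\<close> by that of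
  \<open>adj u * u\<close>. The scalar part satisfies the identity by itself, and the maximum of the
  two inherits it.\<close>

lemma cstar_identity_unitz: "norm (adj u * u) = (norm (u::'a::cstar_algebra unitz))\<^sup>2"
proof (rule antisym)
  let ?L = "\<lambda>u::'a unitz. onorm (lmul u)"
  have sq: "(?L u)\<^sup>2 \<le> ?L (adj u * u)" for u
  proof -
    have "?L u \<le> sqrt (?L (adj u * u))"
    proof (rule onorm_bound)
      fix x :: 'a
      have "(norm (lmul u x))\<^sup>2 = norm (adj (lmul u x) * lmul u x)"
        by (simp add: cstar_identity)
      also have "adj (lmul u x) * lmul u x = adj x * lmul (adj u * u) x"
        by (simp add: lmul_def algebra_simps adj_add adj_mult adj_scaleC scaleC_add_left
            scaleC_add_right scaleC_scaleC mult_scaleC_left mult_scaleC_right)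
      also have "norm \<dots> \<le> norm x * norm (lmul (adj u * u) x)"
        using norm_mult_ineq[of "adj x"] by (metis norm_adj)
      also have "\<dots> \<le> norm x * (?L (adj u * u) * norm x)"
        by (intro mult_left_mono onorm_lmul) simp
      finally have "(norm (lmul u x))\<^sup>2 \<le> (sqrt (?L (adj u * u)) * norm x)\<^sup>2"
        by (simp add: power_mult_distrib power2_eq_square mult_ac onorm_pos_le bounded_linear_lmul)
      then show "norm (lmul u x) \<le> sqrt (?L (adj u * u)) * norm x"
        by (rule power2_le_imp_le) (simp add: onorm_pos_le bounded_linear_lmul)
    qed (simp add: onorm_pos_le bounded_linear_lmul)
    then show ?thesis
      by (metis bounded_linear_lmul onorm_pos_le real_sqrt_le_iff real_sqrt_unique sqrt_le_D)
  qed
  have comp: "?L (u * v) \<le> ?L u * ?L v" for u v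
    unfolding lmul_mult by (rule onorm_compose[OF bounded_linear_lmul bounded_linear_lmul])
  have le: "?L u \<le> ?L (adj u)" for u
  proof (cases "?L u = 0")
    case False
    then have "0 < ?L u" using onorm_pos_le[OF bounded_linear_lmul, of u] by simp
    moreover have "?L u * ?L u \<le> ?L (adj u) * ?L u"
      using sq[of u] comp[of "adj u" u] by (simp add: power2_eq_square)
    ultimately show ?thesis by simp
  qed (simp add: onorm_pos_le bounded_linear_lmul)
  have n: "norm (adj u) \<le> norm u"
    using le[of "adj u"] by (simp add: norm_unitz_def)
  show "norm (adj u * u) \<le> (norm u)\<^sup>2"
    using norm_mult_ineq[of "adj u" u] mult_right_mono[OF n norm_ge_zero[of u]]
    by (simp add: power2_eq_square)
  have "(cmod (scal u))\<^sup>2 \<le> norm (adj u * u)"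
    using norm_scal_le[of "adj u * u"] by (simp add: norm_mult power2_eq_square)
  moreover have "(?L u)\<^sup>2 \<le> norm (adj u * u)"
    using sq[of u] onorm_lmul_le[of "adj u * u"] by simp
  ultimately show "(norm u)\<^sup>2 \<le> norm (adj u * u)"
    by (simp add: norm_unitz_def[of u] max_def)
qed

lemma norm_scaleC_unitz: "norm (c *\<^sub>C u) = cmod c * norm (u::'a::cstar_algebra unitz)"
proof -
  have le: "norm (c *\<^sub>C u) \<le> cmod c * norm u" for c and u :: "'a unitz"
  proof -
    have "onorm (lmul (c *\<^sub>C u)) \<le> cmod c * onorm (lmul u)"
    proof (rule onorm_bound)
      fix x
      have "norm (lmul (c *\<^sub>C u) x) = cmod c * norm (lmul u x)"
        by (simp add: lmul_def mult_scaleC_left scaleC_add_right[symmetric] norm_scaleC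
            scaleC_scaleC[symmetric])
      also have "\<dots> \<le> cmod c * (onorm (lmul u) * norm x)"
        by (intro mult_left_mono onorm_lmul) simp
      finally show "norm (lmul (c *\<^sub>C u) x) \<le> cmod c * onorm (lmul u) * norm x"
        by (simp add: mult.assoc)
    qed (simp add: onorm_pos_le bounded_linear_lmul)
    then show ?thesis by (simp add: norm_unitz_def norm_mult max_mult_distrib_left)
  qed
  show ?thesis
  proof (cases "c = 0")
    case False
    have "norm u = norm (inverse c *\<^sub>C c *\<^sub>C u)" using False by (simp add: scaleC_scaleC)
    also have "\<dots> \<le> cmod (inverse c) * norm (c *\<^sub>C u)" by (rule le)
    finally have "cmod c * norm u \<le> norm (c *\<^sub>C u)"
      using False by (simp add: norm_divide field_simps)
    then show ?thesis using le[of c u] by simp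
  qed simp
qed

instance unitz :: (cstar_algebra) cstar_algebra_1
proof
  fix u :: "'a unitz" and c r
  show "r *\<^sub>R u = complex_of_real r *\<^sub>C u" by (rule scaleR_unitz_def)
  show "norm (c *\<^sub>C u) = cmod c * norm u" by (rule norm_scaleC_unitz)
  show "norm (adj u * u) = (norm u)\<^sup>2" by (rule cstar_identity_unitz)
next
  fix X :: "nat \<Rightarrow> 'a unitz"
  assume X: "Cauchy X"
  have "Cauchy (\<lambda>n. scal (X n))"
  proof (rule metric_CauchyI)
    fix e :: real assume "0 < e"
    then obtain M where "\<forall>m\<ge>M. \<forall>n\<ge>M. dist (X m) (X n) < e" using X by (metis metric_CauchyD)
    then show "\<exists>M. \<forall>m\<ge>M. \<forall>n\<ge>M. dist (scal (X m)) (scal (X n)) < e"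
      using norm_scal_le[of "X m - X n" for m n]
      by (simp add: dist_norm) (metis le_less_trans)
  qed
  moreover have "Cauchy (\<lambda>n. vec (X n))"
  proof (rule metric_CauchyI)
    fix e :: real assume "0 < e"
    then have "0 < e / 2" by simp
    then obtain M where M: "\<forall>m\<ge>M. \<forall>n\<ge>M. dist (X m) (X n) < e / 2" using X by (metis metric_CauchyD)
    have "dist (vec (X m)) (vec (X n)) < e" if "m \<ge> M" "n \<ge> M" for m n
    proof -
      have "dist (X m) (X n) < e / 2" using M that by blast
      then show ?thesis using norm_vec_le[of "X m - X n"] by (simp add: dist_norm)
    qed
    then show "\<exists>M. \<forall>m\<ge>M. \<forall>n\<ge>M. dist (vec (X m)) (vec (X n)) < e" by blast
  qed
  ultimately obtain z a where z: "(\<lambda>n. scal (X n)) \<longlonglongrightarrow> z" and a: "(\<lambda>n. vec (X n)) \<longlonglongrightarrow> a"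
    by (metis Cauchy_convergent_iff convergent_def)
  have "(\<lambda>n. cmod (scal (X n) - z) + norm (vec (X n) - a)) \<longlonglongrightarrow> 0"
    using tendsto_add[OF tendsto_norm_zero[OF LIM_zero[OF z]] tendsto_norm_zero[OF LIM_zero[OF a]]]
    by simp
  then have "(\<lambda>n. X n - Unitz z a) \<longlonglongrightarrow> 0"
    by (rule Lim_null_comparison[rotated])
      (use norm_unitz_le[of "X n - Unitz z a" for n] in \<open>auto intro!: always_eventually\<close>)
  then show "convergent X" by (metis LIM_zero_iff convergent_def)
qed

section \<open>Spectral theory of self-adjoint elements\<close>

definition inverse_of :: "'a::ring_1 \<Rightarrow> 'a \<Rightarrow> bool" where
  "inverse_of x y \<longleftrightarrow> x * y = 1 \<and> y * x = 1"

definition unit :: "'a::ring_1 \<Rightarrow> bool" where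
  "unit x \<longleftrightarrow> (\<exists>y. inverse_of x y)"

lemma unitI: "x * y = 1 \<Longrightarrow> y * x = 1 \<Longrightarrow> unit x"
  unfolding unit_def inverse_of_def by blast

lemma unit_of_left_right: "x * y = 1 \<Longrightarrow> z * x = 1 \<Longrightarrow> unit x"
  by (metis mult.assoc mult.left_neutral mult.right_neutral unitI)

lemma unit_mult: "unit x \<Longrightarrow> unit y \<Longrightarrow> unit (x * y)"
proof -
  assume "unit x" "unit y"
  then obtain x' y' where "x * x' = 1" "x' * x = 1" "y * y' = 1" "y' * y = 1"
    unfolding unit_def inverse_of_def by blast
  then have "(x * y) * (y' * x') = 1" "(y' * x') * (x * y) = 1"
    by (metis mult.assoc mult.right_neutral)+
  then show ?thesis by (rule unitI)
qed

lemma unit_factor: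
  assumes "unit (x * y)" "x * y = y * x"
  shows "unit x"
proof -
  obtain w where "x * y * w = 1" "w * (x * y) = 1"
    using assms(1) unfolding unit_def inverse_of_def by blast
  then have "x * (y * w) = 1" "(w * y) * x = 1" using assms(2) by (metis mult.assoc)+
  then show ?thesis by (rule unit_of_left_right)
qed

text \<open>Neumann series; the bound comes from absorbing \<open>x * S\<close> in the equation S =
  1 + x S.\<close>

lemma inverse_of_one_minus:
  fixes x :: "'a::{real_normed_algebra_1, banach}"
  assumes "norm x < 1"
  obtains y where "inverse_of (1 - x) y" "norm y \<le> 1 / (1 - norm x)"
proof -
  have sm: "summable (\<lambda>n. x ^ n)"
  proof (rule summable_norm_cancel, rule summable_comparison_test')
    show "summable (\<lambda>n. norm x ^ n)" using assms by (simp add: summable_geometric)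
    show "norm (norm (x ^ n)) \<le> norm x ^ n" for n by (simp add: norm_power_ineq)
  qed
  define S where "S = (\<Sum>n. x ^ n)"
  have tail: "(\<Sum>n. x ^ Suc n) = S - 1"
    using suminf_split_head[OF sm] by (simp add: S_def)
  have l: "x * S = S - 1" using suminf_mult[OF sm, of x] tail by (simp add: S_def)
  have r: "S * x = S - 1" using suminf_mult2[OF sm, of x] tail by (simp only: S_def power_Suc2)
  have "inverse_of (1 - x) S" using l r by (simp add: inverse_of_def algebra_simps)
  moreover have "norm S \<le> 1 / (1 - norm x)"
  proof -
    have "norm S = norm (1 + x * S)" using l by simp
    also have "\<dots> \<le> 1 + norm x * norm S"
      using norm_triangle_ineq[of 1 "x * S"] norm_mult_ineq[of x S] by simp
    finally show ?thesis using assms by (simp add: field_simps)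
  qed
  ultimately show ?thesis by (rule that)
qed

text \<open>Factor a + d = a (1 + b d) and use the Neumann series, where \<open>norm (b * d)\<close>
  at most 1/2 yields the factor 2. The last bound is the resolvent identity c - b = - c d b.\<close>

lemma inverse_of_perturb:
  fixes a b d :: "'a::{real_normed_algebra_1, banach}"
  assumes ab: "inverse_of a b" and d: "norm b * norm d \<le> 1 / 2"
  obtains c where "inverse_of (a + d) c" "norm c \<le> 2 * norm b"
    "norm (c - b) \<le> 2 * (norm b)\<^sup>2 * norm d"
proof -
  have bd: "norm (- (b * d)) \<le> 1 / 2" using norm_mult_ineq[of b d] d by simp
  then obtain y where y: "inverse_of (1 - - (b * d)) y" and ny: "norm y \<le> 1 / (1 - norm (- (b * d)))"
    using inverse_of_one_minus[of "- (b * d)"] by force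
  have "1 / (1 - norm (- (b * d))) \<le> 2" using bd by (simp add: field_simps)
  then have ny: "norm y \<le> 2" using ny by linarith
  define c where "c = y * b"
  have fac: "a + d = a * (1 + b * d)"
    using ab by (simp add: inverse_of_def algebra_simps mult.assoc[symmetric])
  have y': "(1 + b * d) * y = 1" "y * (1 + b * d) = 1" using y by (simp_all add: inverse_of_def)
  have c1: "(a + d) * c = 1"
    unfolding fac c_def using y' ab by (metis inverse_of_def mult.assoc mult.right_neutral)
  have c2: "c * (a + d) = 1"
    unfolding fac c_def using y' ab by (metis inverse_of_def mult.assoc mult.left_neutral)
  have nc: "norm c \<le> 2 * norm b"
    unfolding c_def using norm_mult_ineq[of y b] mult_right_mono[OF ny norm_ge_zero[of b]] by linarith
  have "c * (a + d) * b = b" using c2 by simp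
  then have "c * (a * b) + c * d * b = b" by (simp add: algebra_simps)
  then have "c - b = - (c * d * b)" using ab by (simp add: inverse_of_def algebra_simps)
  then have "norm (c - b) \<le> norm c * norm d * norm b"
    by (metis norm_minus_cancel norm_mult_ineq mult_right_mono norm_ge_zero order_trans)
  also have "\<dots> \<le> 2 * norm b * norm d * norm b"
    by (intro mult_right_mono nc) auto
  finally have "norm (c - b) \<le> 2 * (norm b)\<^sup>2 * norm d"
    by (simp add: power2_eq_square mult_ac)
  with c1 c2 nc show ?thesis using that by (simp add: inverse_of_def)
qed

text \<open>Partial fractions: 1 / (1 - d^2) is the mean of 1 / (1 - d) and 1 / (1 + d). This is one
  squaring step of the averaging argument below.\<close>

lemma inverse_of_one_minus_square:
  fixes d :: "'a::real_normed_algebra_1"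
  assumes "inverse_of (1 - d) x" "inverse_of (1 + d) y"
  shows "inverse_of (1 - d * d) ((1 / 2) *\<^sub>R (x + y))"
proof -
  have f: "1 - d * d = (1 + d) * (1 - d)" "1 - d * d = (1 - d) * (1 + d)"
    by (simp_all add: algebra_simps)
  have "(1 - d * d) * (x + y) = (1 + d) * ((1 - d) * x) + (1 - d) * ((1 + d) * y)"
    unfolding distrib_left by (metis f mult.assoc)
  moreover have "(x + y) * (1 - d * d) = (x * (1 - d)) * (1 + d) + (y * (1 + d)) * (1 - d)"
    unfolding distrib_right by (metis f mult.assoc)
  moreover have "(1 / 2) *\<^sub>R ((1 + d) + (1 - d)) = 1" by (simp flip: scaleR_2)
  ultimately show ?thesis using assms by (simp add: inverse_of_def)
qed

text \<open>
  The \<open>2\<^sup>k\<close>-th roots of unity \<open>w\<close> give \<open>(1 - b ^ 2 ^ k)\<inverse>\<close> as the average of the resolvents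
  \<open>(1 - w b)\<inverse>\<close>.  If these were all defined on the unit circle, uniform continuity would force
  \<open>b ^ 2 ^ k\<close> to tend to \<open>0\<close>.  The average is formed by repeated squaring.
\<close>

lemma ex_circle_not_unit:
  fixes b :: "'a::cstar_algebra_1"
  assumes nb: "\<And>k. norm (b ^ 2 ^ k) = 1"
  shows "\<exists>u. cmod u = 1 \<and> \<not> unit (1 - u *\<^sub>C b)"
proof (rule ccontr)
  assume "\<not> ?thesis"
  then have "\<forall>u. \<exists>y. cmod u = 1 \<longrightarrow> inverse_of (1 - u *\<^sub>C b) y" by (auto simp: unit_def)
  then obtain Y where Y: "\<And>u. cmod u = 1 \<Longrightarrow> inverse_of (1 - u *\<^sub>C b) (Y u)" by metis
  have b1: "norm b = 1" using nb[of 0] by simp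
  \<comment> \<open>Within distance \<open>r u\<close> of u the hypothesis of
    \<open>inverse_of_perturb\<close> holds; adding 1 keeps the denominator positive.\<close>
  define r where "r u = 1 / (2 * (norm (Y u) + 1))" for u
  have r: "0 < r u" "norm (Y u) * r u \<le> 1 / 2" for u
  proof -
    have "0 < norm (Y u) + 1" by (rule add_nonneg_pos) auto
    then show "0 < r u" "norm (Y u) * r u \<le> 1 / 2" by (simp_all add: r_def field_simps)
  qed
  obtain C where C: "C \<subseteq> sphere 0 1" "finite C" "sphere 0 1 \<subseteq> (\<Union>u\<in>C. ball u (r u))"
  proof (rule compactE_image[of "sphere (0::complex) 1" "sphere 0 1" "\<lambda>u. ball u (r u)"])
    show "sphere 0 1 \<subseteq> (\<Union>u\<in>sphere 0 1. ball u (r u))" using r by auto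
  qed auto
  \<comment> \<open>By compactness of the circle, a common bound for all the resolvents.\<close>
  define M where "M = (\<Sum>u\<in>C. 2 * norm (Y u)) + 1"
  have M0: "M \<ge> 1" by (simp add: M_def sum_nonneg)
  have M: "norm (Y v) \<le> M" if v: "cmod v = 1" for v
  proof -
    obtain u where u: "u \<in> C" "dist u v < r u" using C(3) v by force
    have nd: "norm ((u - v) *\<^sub>C b) \<le> r u"
      using u b1 by (simp add: norm_scaleC dist_norm)
    have "inverse_of (1 - u *\<^sub>C b) (Y u)" using Y C(1) u by auto
    moreover have "norm (Y u) * norm ((u - v) *\<^sub>C b) \<le> 1 / 2"
      using mult_left_mono[OF nd norm_ge_zero[of "Y u"]] r(2)[of u] by linarith
    ultimately obtain c where c: "inverse_of (1 - u *\<^sub>C b + (u - v) *\<^sub>C b) c" "norm c \<le> 2 * norm (Y u)"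
      by (rule inverse_of_perturb)
    have "inverse_of (1 - v *\<^sub>C b) c" using c(1) by (simp add: scaleC_diff_left)
    then have "Y v = c" using Y[OF v] by (metis inverse_of_def mult.assoc mult.left_neutral mult.right_neutral)
    moreover have "2 * norm (Y u) \<le> (\<Sum>u\<in>C. 2 * norm (Y u))"
      using u C(2) by (intro member_le_sum) auto
    ultimately show ?thesis using c by (simp add: M_def)
  qed
  \<comment> \<open>Chosen so that moving from radius 1 to radius 1 - \<delta> changes each
    resolvent by at most 2 M^2 \<delta> = 1/8.\<close>
  define \<delta> where "\<delta> = 1 / (16 * M\<^sup>2)"
  have M2: "1 \<le> M\<^sup>2" "M \<le> M\<^sup>2" using M0 by (auto simp: power2_eq_square mult_ge1_I)
  then have \<delta>: "0 < \<delta>" "\<delta> < 1" "M * \<delta> \<le> 1 / 2" "2 * M\<^sup>2 * \<delta> = 1 / 8"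
    using M0 by (auto simp: \<delta>_def field_simps)
  \<comment> \<open>Uniformly in the phase u, the resolvents at radius 1 and at radius s differ by
    at most 1/8. Means of close pairs are close, so \<open>Q\<close> survives squaring of c and
    s.\<close>
  define Q where "Q c s \<longleftrightarrow> (\<forall>u. cmod u = 1 \<longrightarrow> (\<exists>x y. inverse_of (1 - u *\<^sub>C c) x \<and>
      inverse_of (1 - (complex_of_real s * u) *\<^sub>C c) y \<and> norm (x - y) \<le> 1 / 8))" for c :: 'a and s
  have Q0: "Q b (1 - \<delta>)"
    unfolding Q_def
  proof (intro allI impI)
    fix u assume u: "cmod u = 1"
    let ?d = "(complex_of_real \<delta> * u) *\<^sub>C b"
    have nd: "norm ?d = \<delta>" using u b1 \<delta> by (simp add: norm_scaleC norm_mult)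
    have le: "norm (Y u) * \<delta> \<le> M * \<delta>" using M[OF u] \<delta> by (intro mult_right_mono) auto
    then have "norm (Y u) * norm ?d \<le> 1 / 2" unfolding nd using \<delta>(3) by linarith
    then obtain y where y: "inverse_of (1 - u *\<^sub>C b + ?d) y" "norm (y - Y u) \<le> 2 * (norm (Y u))\<^sup>2 * norm ?d"
      using Y[OF u] inverse_of_perturb by metis
    have "2 * (norm (Y u))\<^sup>2 * norm ?d \<le> 2 * M\<^sup>2 * \<delta>"
      unfolding nd using M[OF u] \<delta> by (intro mult_right_mono mult_left_mono power_mono) auto
    then have "norm (Y u - y) \<le> 1 / 8" using y(2) \<delta>(4) by (simp add: norm_minus_commute)
    moreover have "1 - u *\<^sub>C b + ?d = 1 - (complex_of_real (1 - \<delta>) * u) *\<^sub>C b"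
      by (simp add: left_diff_distrib scaleC_diff_left)
    ultimately show "\<exists>x y. inverse_of (1 - u *\<^sub>C b) x \<and>
        inverse_of (1 - (complex_of_real (1 - \<delta>) * u) *\<^sub>C b) y \<and> norm (x - y) \<le> 1 / 8"
      using Y[OF u] y(1) by metis
  qed
  have Q_square: "Q (c * c) (s\<^sup>2)" if Q: "Q c s" for c s
    unfolding Q_def
  proof (intro allI impI)
    fix u assume u: "cmod u = 1"
    \<comment> \<open>The two phases v and -v have the common square u, so averaging their
      resolvents for c gives the resolvent for \<open>c * c\<close> at u.\<close>
    define v where "v = csqrt u"
    have vv: "v * v = u" by (simp add: v_def power2_eq_square[symmetric])
    then have "cmod v * cmod v = 1" using u by (metis norm_mult)
    then have "(cmod v)\<^sup>2 = 1\<^sup>2" by (simp add: power2_eq_square)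
    then have v: "cmod v = 1" "cmod (- v) = 1" using power2_eq_imp_eq[of "cmod v" 1] by auto
    obtain x y where x: "inverse_of (1 - v *\<^sub>C c) x"
        and y: "inverse_of (1 - (complex_of_real s * v) *\<^sub>C c) y" and xy: "norm (x - y) \<le> 1 / 8"
      using Q v(1) unfolding Q_def by blast
    obtain x' y' where x': "inverse_of (1 - (- v) *\<^sub>C c) x'"
        and y': "inverse_of (1 - (complex_of_real s * - v) *\<^sub>C c) y'" and xy': "norm (x' - y') \<le> 1 / 8"
      using Q v(2) unfolding Q_def by blast
    have sq: "(v *\<^sub>C c) * (v *\<^sub>C c) = u *\<^sub>C (c * c)"
      "((complex_of_real s * v) *\<^sub>C c) * ((complex_of_real s * v) *\<^sub>C c)
        = (complex_of_real (s\<^sup>2) * u) *\<^sub>C (c * c)"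
      by (simp_all add: mult_scaleC_left mult_scaleC_right scaleC_scaleC vv[symmetric]
          power2_eq_square mult_ac)
    have "inverse_of (1 - u *\<^sub>C (c * c)) ((1 / 2) *\<^sub>R (x + x'))"
      using inverse_of_one_minus_square[OF x, of x'] x' unfolding sq by simp
    moreover have "inverse_of (1 - (complex_of_real (s\<^sup>2) * u) *\<^sub>C (c * c)) ((1 / 2) *\<^sub>R (y + y'))"
      using inverse_of_one_minus_square[OF y, of y'] y' unfolding sq by simp
    moreover have "norm ((1 / 2) *\<^sub>R (x + x') - (1 / 2) *\<^sub>R (y + y')) \<le> 1 / 8"
    proof -
      have "(1 / 2) *\<^sub>R (x + x') - (1 / 2) *\<^sub>R (y + y') = (1 / 2) *\<^sub>R ((x - y) + (x' - y'))"
        by (simp add: algebra_simps)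
      then have "norm ((1 / 2) *\<^sub>R (x + x') - (1 / 2) *\<^sub>R (y + y')) = 1 / 2 * norm ((x - y) + (x' - y'))"
        by (simp only: norm_scaleR)
      then show ?thesis using norm_triangle_ineq[of "x - y" "x' - y'"] xy xy' by linarith
    qed
    ultimately show "\<exists>x y. inverse_of (1 - u *\<^sub>C (c * c)) x \<and>
        inverse_of (1 - (complex_of_real (s\<^sup>2) * u) *\<^sub>C (c * c)) y \<and> norm (x - y) \<le> 1 / 8"
      by blast
  qed
  have Qk: "Q (b ^ 2 ^ k) ((1 - \<delta>) ^ 2 ^ k)" for k
  proof (induction k)
    case (Suc k)
    have "b ^ 2 ^ Suc k = b ^ 2 ^ k * b ^ 2 ^ k" "(1 - \<delta>) ^ 2 ^ Suc k = ((1 - \<delta>) ^ 2 ^ k)\<^sup>2"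
      by (simp_all add: power_add[symmetric] mult_2 power2_eq_square)
    then show ?case using Q_square[OF Suc] by simp
  qed (use Q0 in simp)
  obtain n where n: "(1 - \<delta>) ^ n < 1 / 8" using real_arch_pow_inv[of "1/8" "1 - \<delta>"] \<delta> by auto
  define t where "t = (1 - \<delta>) ^ 2 ^ n"
  have "n \<le> 2 ^ n" by (simp add: less_imp_le)
  then have "t \<le> (1 - \<delta>) ^ n" unfolding t_def using \<delta> by (intro power_decreasing) auto
  then have t: "t < 1 / 8" using n by linarith
  have "0 \<le> t" unfolding t_def using \<delta> by (intro zero_le_power) simp
  define c where "c = b ^ 2 ^ n"
  have c1: "norm c = 1" by (simp add: c_def nb)
  \<comment> \<open>As t is below 1/8, y is within 1/7 of 1, and x within 1/7 + 1/8 < 1/2. But c =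
    (x - 1) - (x - 1) c has norm 1, which forces \<open>norm (x - 1)\<close> to be at least
    1/2.\<close>
  obtain x y where x: "inverse_of (1 - c) x" and y: "inverse_of (1 - complex_of_real t *\<^sub>C c) y"
      and xy: "norm (x - y) \<le> 1 / 8"
    using Qk[of n] unfolding Q_def t_def[symmetric] c_def[symmetric] by (metis mult.right_neutral norm_one scaleC_one)
  have "y - 1 = t *\<^sub>R (c * y)"
    using y by (simp add: inverse_of_def algebra_simps mult_scaleC_left scaleR_scaleC)
  then have ny: "norm (y - 1) \<le> t * norm y"
    using norm_mult_ineq[of c y] c1 \<open>0 \<le> t\<close> by (simp add: mult_left_mono)
  have "norm y \<le> norm (y - 1) + 1" using norm_triangle_ineq[of "y - 1" 1] by simp
  moreover have "t * norm y \<le> 1 / 8 * norm y" using t by (intro mult_right_mono) auto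
  ultimately have "norm (y - 1) \<le> 1 / 7" using ny by linarith
  then have x1: "norm (x - 1) < 1 / 2"
    using norm_triangle_ineq[of "x - y" "y - 1"] xy by simp
  have "c = (x - 1) - (x - 1) * c" using x by (simp add: inverse_of_def algebra_simps)
  then have "1 \<le> norm (x - 1) + norm ((x - 1) * c)"
    using norm_triangle_ineq4[of "x - 1" "(x - 1) * c"] c1 by simp
  also have "\<dots> \<le> norm (x - 1) + norm (x - 1)"
    using norm_mult_ineq[of "x - 1" c] c1 by simp
  finally show False using x1 by simp
qed

section \<open>Spectrum, self-adjointness and norm\<close>

definition spec :: "'a::cstar_algebra_1 \<Rightarrow> complex set" where
  "spec a = {z. \<not> unit (z *\<^sub>C 1 - a)}"

lemma unit_scaleC: "z \<noteq> 0 \<Longrightarrow> unit (z *\<^sub>C (x::'a::cstar_algebra_1)) \<longleftrightarrow> unit x"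
proof -
  have "unit (w *\<^sub>C x)" if "unit x" "w \<noteq> 0" for w and x :: 'a
  proof -
    obtain y where "x * y = 1" "y * x = 1" using \<open>unit x\<close> unfolding unit_def inverse_of_def by blast
    then show ?thesis using \<open>w \<noteq> 0\<close>
      by (intro unitI[of _ "inverse w *\<^sub>C y"])
        (simp_all add: mult_scaleC_left mult_scaleC_right scaleC_scaleC)
  qed
  from this[of x z] this[of "z *\<^sub>C x" "inverse z"] show "z \<noteq> 0 \<Longrightarrow> ?thesis"
    by (auto simp: scaleC_scaleC)
qed

lemma spec_norm_le:
  fixes a :: "'a::cstar_algebra_1"
  assumes "z \<in> spec a"
  shows "cmod z \<le> norm a"
proof (rule ccontr)
  assume *: "\<not> ?thesis"
  then have z: "z \<noteq> 0" by auto
  have "norm (inverse z *\<^sub>C a) < 1"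
    using * z by (simp add: norm_scaleC norm_divide field_simps)
  then have "unit (1 - inverse z *\<^sub>C a)" by (metis inverse_of_one_minus unit_def)
  moreover have "z *\<^sub>C (1 - inverse z *\<^sub>C a) = z *\<^sub>C 1 - a"
    using z by (simp add: scaleC_diff_right scaleC_scaleC)
  ultimately have "unit (z *\<^sub>C 1 - a)" using z by (metis unit_scaleC)
  then show False using assms by (simp add: spec_def)
qed

lemma spec_shift: "z + w \<in> spec (a + w *\<^sub>C 1) \<longleftrightarrow> z \<in> spec a"
  by (simp add: spec_def scaleC_add_left)

lemma spec_minus: "z \<in> spec (- a) \<longleftrightarrow> - z \<in> spec a"
  using unit_scaleC[of "-1" "z *\<^sub>C 1 + a"] by (simp add: spec_def)

text \<open>Translate by i t with t real. The square of \<open>norm (a + ...)\<close> grows at most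
  like t^2 plus a constant, while the square of the modulus of z + i t contains the linear term 2 t
  Im z, which must therefore vanish.\<close>

lemma spec_real:
  fixes a :: "'a::cstar_algebra_1"
  assumes a: "adj a = a" and z: "z \<in> spec a"
  shows "Im z = 0"
proof (rule ccontr)
  assume nz: "Im z \<noteq> 0"
  have key: "(Re z)\<^sup>2 + (Im z + t)\<^sup>2 \<le> (norm a)\<^sup>2 + t\<^sup>2" for t :: real
  proof -
    let ?w = "\<i> * complex_of_real t"
    have "cmod (z + ?w) \<le> norm (a + ?w *\<^sub>C 1)" using z by (intro spec_norm_le) (simp add: spec_shift)
    then have "(cmod (z + ?w))\<^sup>2 \<le> norm (adj (a + ?w *\<^sub>C 1) * (a + ?w *\<^sub>C 1))"
      unfolding cstar_identity by (intro power_mono) auto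
    also have "adj (a + ?w *\<^sub>C 1) * (a + ?w *\<^sub>C 1) = a * a + (t\<^sup>2) *\<^sub>R 1"
      by (simp add: a adj_add adj_scaleC algebra_simps mult_scaleC_left mult_scaleC_right
          scaleC_scaleC scaleR_scaleC scaleC_diff_right power2_eq_square)
    also have "norm \<dots> \<le> (norm a)\<^sup>2 + t\<^sup>2"
      using norm_triangle_ineq[of "a * a" "(t\<^sup>2) *\<^sub>R 1"] norm_mult_ineq[of a a]
      by (simp add: power2_eq_square)
    finally show ?thesis by (simp add: cmod_power2)
  qed
  have "(Im z)\<^sup>2 + 2 * Im z * t \<le> (norm a)\<^sup>2" for t
  proof -
    have "(Im z + t)\<^sup>2 = (Im z)\<^sup>2 + 2 * Im z * t + t\<^sup>2" by (simp add: power2_sum)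
    then show ?thesis using key[of t] zero_le_power2[of "Re z"] by linarith
  qed
  \<comment> \<open>This t makes the linear term equal to
    \<open>(norm a)\<^sup>2 + 1\<close>.\<close>
  from this[of "((norm a)\<^sup>2 + 1) / (2 * Im z)"] have "(Im z)\<^sup>2 + ((norm a)\<^sup>2 + 1) \<le> (norm a)\<^sup>2"
    using nz by simp
  then show False using zero_le_power2[of "Im z"] by linarith
qed

text \<open>After normalization this is the hypothesis of \<open>ex_circle_not_unit\<close>; dyadic
  exponents suffice there and follow by iterating the C*-identity.\<close>

lemma norm_power_selfadjoint:
  fixes a :: "'a::cstar_algebra_1"
  assumes "adj a = a"
  shows "norm (a ^ 2 ^ k) = norm a ^ 2 ^ k"
proof (induction k)
  case (Suc k)
  have adj: "adj (a ^ n) = a ^ n" for n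
    by (induction n) (simp_all add: adj_mult assms power_commutes)
  have "norm (a ^ 2 ^ Suc k) = norm (adj (a ^ 2 ^ k) * a ^ 2 ^ k)"
    unfolding adj by (simp add: power_add[symmetric] mult_2)
  also have "\<dots> = (norm a ^ 2 ^ k)\<^sup>2" unfolding cstar_identity by (simp add: Suc)
  finally show ?case by (simp add: power_mult[symmetric] mult.commute)
qed simp

lemma ex_spec_norm:
  fixes a :: "'a::cstar_algebra_1"
  assumes a: "adj a = a"
  shows "\<exists>z\<in>spec a. cmod z = norm a"
proof (cases "a = 0")
  case True
  have "\<not> unit (0::'a)" by (simp add: unit_def inverse_of_def)
  then show ?thesis using True by (intro bexI[of _ 0]) (auto simp: spec_def)
next
  case False
  define b where "b = (1 / norm a) *\<^sub>R a"
  have "adj b = b" by (simp add: b_def adj_scaleR a)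
  then have "norm (b ^ 2 ^ k) = 1" for k
    using False by (simp add: norm_power_selfadjoint) (simp add: b_def)
  then obtain u where u: "cmod u = 1" "\<not> unit (1 - u *\<^sub>C b)" using ex_circle_not_unit by metis
  \<comment> \<open>Undoes the normalization: 1 - u b is not invertible exactly when z - a is
    not.\<close>
  define z where "z = complex_of_real (norm a) / u"
  have "u \<noteq> 0" using u by auto
  then have z0: "z \<noteq> 0" using False by (simp add: z_def)
  have "z *\<^sub>C (1 - u *\<^sub>C b) = z *\<^sub>C 1 - a"
    using \<open>u \<noteq> 0\<close> False by (simp add: scaleC_diff_right b_def scaleR_scaleC scaleC_scaleC z_def)
  then have "z \<in> spec a" using u unit_scaleC[OF z0, of "1 - u *\<^sub>C b"] by (simp add: spec_def)
  moreover have "cmod z = norm a" using u by (simp add: z_def norm_divide)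
  ultimately show ?thesis by blast
qed

text \<open>If w inverts z - y x, then (1 + x w y) / z inverts z - x y.\<close>

lemma spec_mult_commute:
  fixes x y :: "'a::cstar_algebra_1"
  assumes "z \<in> spec (x * y)" "z \<noteq> 0"
  shows "z \<in> spec (y * x)"
proof (rule ccontr)
  assume "z \<notin> spec (y * x)"
  then obtain w where w: "(z *\<^sub>C 1 - y * x) * w = 1" "w * (z *\<^sub>C 1 - y * x) = 1"
    unfolding spec_def unit_def inverse_of_def by blast
  have w1: "y * x * w = z *\<^sub>C w - 1" using w(1) by (simp add: algebra_simps mult_scaleC_left)
  have w2: "w * y * x = z *\<^sub>C w - 1" using w(2) by (simp add: algebra_simps mult_scaleC_right)
  have "x * y * (x * w * y) = x * (z *\<^sub>C w - 1) * y" by (simp only: mult.assoc flip: w1)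
  then have e1: "x * y * (x * w * y) = z *\<^sub>C (x * w * y) - x * y"
    by (simp add: left_diff_distrib right_diff_distrib mult_scaleC_left mult_scaleC_right)
  have "x * w * y * (x * y) = x * (z *\<^sub>C w - 1) * y" by (simp only: mult.assoc flip: w2)
  then have e2: "x * w * y * (x * y) = z *\<^sub>C (x * w * y) - x * y"
    by (simp add: left_diff_distrib right_diff_distrib mult_scaleC_left mult_scaleC_right)
  have "(z *\<^sub>C 1 - x * y) * (1 + x * w * y) = z *\<^sub>C 1" "(1 + x * w * y) * (z *\<^sub>C 1 - x * y) = z *\<^sub>C 1"
    using e1 e2
    by (simp_all add: algebra_simps mult_scaleC_left mult_scaleC_right scaleC_add_right)
  then have "unit (z *\<^sub>C 1 - x * y)"
    using assms(2)
    by (intro unitI[of _ "inverse z *\<^sub>C (1 + x * w * y)"])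
      (simp_all add: mult_scaleC_left mult_scaleC_right scaleC_scaleC)
  then show False using assms(1) by (simp add: spec_def)
qed

lemma compact_spec:
  fixes a :: "'a::cstar_algebra_1"
  shows "compact (spec a)"
proof -
  have "bounded (spec a)" using spec_norm_le by (auto simp: bounded_iff)
  moreover have "open (- spec a)"
    unfolding open_dist
  proof
    fix z assume "z \<in> - spec a"
    then obtain b where b: "inverse_of (z *\<^sub>C 1 - a) b" by (auto simp: spec_def unit_def)
    define e where "e = 1 / (2 * (norm b + 1))"
    have p: "0 < norm b + 1" by (rule add_nonneg_pos) auto
    then have e: "0 < e" "norm b * e \<le> 1 / 2" by (simp_all add: e_def field_simps)
    have "y \<in> - spec a" if "dist y z < e" for y
    proof -
      have "norm ((y - z) *\<^sub>C (1::'a)) \<le> e" using that by (simp add: norm_scaleC dist_norm)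
      then have "norm b * norm ((y - z) *\<^sub>C (1::'a)) \<le> 1 / 2"
        using mult_left_mono[of _ e "norm b"] e(2) by (meson norm_ge_zero order_trans)
      then obtain c where "inverse_of (z *\<^sub>C 1 - a + (y - z) *\<^sub>C 1) c" using b inverse_of_perturb by metis
      then show ?thesis by (auto simp: spec_def unit_def scaleC_diff_left algebra_simps)
    qed
    then show "\<exists>e>0. \<forall>y. dist y z < e \<longrightarrow> y \<in> - spec a" using e(1) by blast
  qed
  ultimately show ?thesis by (simp add: compact_eq_bounded_closed closed_def)
qed

section \<open>Polynomials in a self-adjoint element\<close>

text \<open>Horner evaluation with the complex coefficients acting by \<open>*\<^sub>C\<close>;
  \<open>poly\<close> requires coefficients and argument of one type.\<close>

definition ev :: "complex poly \<Rightarrow> 'a::cstar_algebra_1 \<Rightarrow> 'a" where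
  "ev p a = fold_coeffs (\<lambda>c b. c *\<^sub>C 1 + a * b) p 0"

lemma ev_0 [simp]: "ev 0 a = 0"
  by (simp add: ev_def)

lemma ev_pCons [simp]: "ev (pCons c p) a = c *\<^sub>C 1 + a * ev p a"
  by (cases "p = 0 \<and> c = 0") (auto simp: ev_def)

lemma ev_add: "ev (p + q) a = ev p a + ev q a"
  by (induction p q rule: poly_induct2) (simp_all add: scaleC_add_left distrib_left)

lemma ev_smult: "ev (smult c p) a = c *\<^sub>C ev p a"
  by (induction p) (simp_all add: scaleC_add_right scaleC_scaleC mult_scaleC_right)

lemma ev_diff: "ev (p - q) a = ev p a - ev q a"
  using ev_add[of p "- q" a] ev_smult[of "-1" q a] by simp

lemma ev_mult: "ev (p * q) a = ev p a * ev q a"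
  by (induction p) (simp_all add: ev_add ev_smult distrib_right mult_scaleC_left mult.assoc)

lemma adj_ev: "adj a = a \<Longrightarrow> adj (ev p a) = ev (map_poly cnj p) a"
proof (induction p)
  case (pCons c p)
  have comm: "a * ev q a = ev q a * a" for q
    using ev_mult[of "[:0, 1:]" q a] ev_mult[of q "[:0, 1:]" a] by (simp add: mult.commute)
  show ?case using pCons by (simp add: map_poly_pCons adj_add adj_scaleC adj_mult comm)
qed simp

lemma poly_map_cnj: "poly (map_poly cnj p) z = cnj (poly p (cnj z))"
  by (induction p) (simp_all add: map_poly_pCons)

text \<open>Induction on the degree: the fundamental theorem of algebra splits off a factor X - w,
  and w lies outside the spectrum because it is a root.\<close>

lemma unit_ev:
  "p \<noteq> 0 \<Longrightarrow> (\<And>z. poly p z = 0 \<Longrightarrow> z \<notin> spec a) \<Longrightarrow> unit (ev p (a::'a::cstar_algebra_1))"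
proof (induction "degree p" arbitrary: p)
  case 0
  then obtain c where "p = [:c:]" by (metis degree_0_id pCons_0_0 degree_eq_zeroE)
  then show ?case using 0 unit_scaleC[of c "1::'a"] by (auto intro: unitI[of 1 1])
next
  case (Suc n)
  have "\<not> constant (poly p)" using Suc.hyps(2) by (simp add: constant_degree)
  then obtain w where w: "poly p w = 0" using fundamental_theorem_of_algebra by blast
  then obtain q where q: "p = [:- w, 1:] * q" using poly_eq_0_iff_dvd by (metis dvdE)
  have "q \<noteq> 0" using q Suc.prems(1) by auto
  moreover have "degree q = n"
    using degree_mult_eq[of "[:- w, 1:]" q] Suc.hyps(2) \<open>q \<noteq> 0\<close> unfolding q by simp
  moreover have "z \<notin> spec a" if "poly q z = 0" for z using Suc.prems(2)[of z] that q by simp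
  ultimately have "unit (ev q a)" using Suc.hyps(1) by blast
  moreover have "unit (w *\<^sub>C 1 - a)" using Suc.prems(2)[OF w] by (simp add: spec_def)
  then have "unit (ev [:- w, 1:] a)"
    using unit_scaleC[of "-1" "w *\<^sub>C 1 - a"] by simp
  ultimately show ?case unfolding q ev_mult by (intro unit_mult)
qed

text \<open>Half of the spectral mapping theorem. If p is the constant z, every point of the
  spectrum is a witness, so there must be one.\<close>

lemma spec_ev:
  fixes a :: "'a::cstar_algebra_1"
  assumes z: "z \<in> spec (ev p a)" and ne: "spec a \<noteq> {}"
  shows "\<exists>w\<in>spec a. z = poly p w"
proof (cases "[:z:] - p = 0")
  case True
  then show ?thesis using ne by auto
next
  case False
  have "ev ([:z:] - p) a = z *\<^sub>C 1 - ev p a" by (simp add: ev_diff)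
  then have "\<not> unit (ev ([:z:] - p) a)" using z by (simp add: spec_def)
  then obtain w where "poly ([:z:] - p) w = 0" "w \<in> spec a" using unit_ev[OF False] by blast
  then show ?thesis by auto
qed

text \<open>The other half: X - z divides p(z) - p, and since polynomials in a commute,
  invertibility of the product would pass to the factor z - a.\<close>

lemma poly_in_spec_ev:
  fixes a :: "'a::cstar_algebra_1"
  assumes "z \<in> spec a"
  shows "poly p z \<in> spec (ev p a)"
proof -
  have "poly ([:poly p z:] - p) z = 0" by simp
  then obtain q where q: "[:poly p z:] - p = [:- z, 1:] * q" by (metis poly_eq_0_iff_dvd dvdE)
  have e: "ev ([:poly p z:] - p) a = poly p z *\<^sub>C 1 - ev p a" by (simp add: ev_diff)
  show ?thesis
  proof (rule ccontr)
    assume "poly p z \<notin> spec (ev p a)"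
    then have "unit (ev [:- z, 1:] a * ev q a)"
      unfolding ev_mult[symmetric] q[symmetric] e by (simp add: spec_def)
    then have "unit (ev [:- z, 1:] a)"
      by (rule unit_factor) (simp only: ev_mult[symmetric] mult.commute)
    then have "unit (z *\<^sub>C 1 - a)" using unit_scaleC[of "-1" "z *\<^sub>C 1 - a"] by simp
    then show False using assms by (simp add: spec_def)
  qed
qed

lemma poly_le_norm_ev: "z \<in> spec a \<Longrightarrow> cmod (poly p z) \<le> norm (ev p a)"
  by (intro spec_norm_le poly_in_spec_ev)

text \<open>\<open>ev p a\<close> need not be self-adjoint, but by the C*-identity its squared norm
  is the norm of \<open>ev ?q a\<close>, which is. On the real spectrum \<open>?q\<close> equals the
  squared modulus of p.\<close>

lemma ex_norm_ev:
  fixes a :: "'a::cstar_algebra_1"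
  assumes a: "adj a = a"
  shows "\<exists>z\<in>spec a. norm (ev p a) = cmod (poly p z)"
proof -
  let ?q = "map_poly cnj p * p"
  have q: "ev ?q a = adj (ev p a) * ev p a" by (simp add: ev_mult adj_ev[OF a])
  then have "adj (ev ?q a) = ev ?q a" by (simp add: adj_mult)
  then obtain w where w: "w \<in> spec (ev ?q a)" "cmod w = norm (ev ?q a)" using ex_spec_norm by blast
  have "spec a \<noteq> {}" using ex_spec_norm[OF a] by blast
  then obtain z where z: "z \<in> spec a" "w = poly ?q z" using spec_ev[OF w(1)] by blast
  have "cnj z = z" using spec_real[OF a z(1)] by (simp add: complex_eq_iff)
  then have "cmod w = (cmod (poly p z))\<^sup>2"
    unfolding z(2) by (simp add: poly_map_cnj norm_mult power2_eq_square)
  moreover have "norm (ev ?q a) = (norm (ev p a))\<^sup>2" by (simp add: q cstar_identity)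
  ultimately have "norm (ev p a) = cmod (poly p z)" using w(2) by simp
  then show ?thesis using z(1) by blast
qed

section \<open>Continuous functional calculus\<close>

definition rspec :: "'a::cstar_algebra_1 \<Rightarrow> real set" where
  "rspec a = Re ` spec a"

lemma spec_eq_rspec: "adj a = a \<Longrightarrow> spec a = complex_of_real ` rspec a"
proof -
  assume "adj a = a"
  then have "complex_of_real (Re z) = z" if "z \<in> spec a" for z
    using spec_real[OF _ that] by (simp add: complex_eq_iff)
  then show ?thesis by (force simp: rspec_def image_image)
qed

lemma rspecD: "adj a = a \<Longrightarrow> t \<in> rspec a \<Longrightarrow> complex_of_real t \<in> spec a"
  by (simp add: spec_eq_rspec)

lemma poly_le_norm_ev_real:
  "adj a = a \<Longrightarrow> t \<in> rspec a \<Longrightarrow> cmod (poly p (complex_of_real t)) \<le> norm (ev p a)"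
  by (intro poly_le_norm_ev rspecD)

lemma norm_ev_le:
  "adj a = a \<Longrightarrow> (\<And>t. t \<in> rspec a \<Longrightarrow> cmod (poly p (complex_of_real t)) \<le> B) \<Longrightarrow> norm (ev p a) \<le> B"
  using ex_norm_ev[of a p] by (auto simp: spec_eq_rspec)

lemma rspec_le_norm: "t \<in> rspec a \<Longrightarrow> \<bar>t\<bar> \<le> norm a"
  unfolding rspec_def by (metis abs_Re_le_cmod imageE order_trans spec_norm_le)

lemma ex_rspec_norm: "adj a = a \<Longrightarrow> \<exists>t\<in>rspec a. \<bar>t\<bar> = norm a"
  using ex_spec_norm[of a] by (auto simp: spec_eq_rspec)

lemma compact_rspec: "compact (rspec a)"
  unfolding rspec_def by (intro compact_continuous_image continuous_intros compact_spec)

text \<open>The graph of the functional calculus: one polynomial approximates f on the spectrum and,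
  evaluated at a, approximates b. As a relation it obeys the algebraic laws before any limit has
  been shown to exist.\<close>

definition calc :: "'a::cstar_algebra_1 \<Rightarrow> (real \<Rightarrow> complex) \<Rightarrow> 'a \<Rightarrow> bool" where
  "calc a f b \<longleftrightarrow> (\<forall>e>0. \<exists>p. (\<forall>t\<in>rspec a. cmod (f t - poly p (complex_of_real t)) \<le> e) \<and>
      norm (ev p a - b) \<le> e)"

lemma calcE:
  assumes "calc a f b" "e > 0"
  obtains p where "\<And>t. t \<in> rspec a \<Longrightarrow> cmod (f t - poly p (complex_of_real t)) \<le> e"
    "norm (ev p a - b) \<le> e"
  using assms unfolding calc_def by metis

lemma calc_ev: "calc a (\<lambda>t. poly p (complex_of_real t)) (ev p a)"
  unfolding calc_def by (intro allI impI exI[of _ p]) simp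

lemma calc_cong:
  "calc a f b \<Longrightarrow> (\<And>t. t \<in> rspec a \<Longrightarrow> f t = g t) \<Longrightarrow> calc a g b"
  unfolding calc_def by simp

lemma calc_norm_le:
  assumes a: "adj a = a" and c: "calc a f b" and f: "\<And>t. t \<in> rspec a \<Longrightarrow> cmod (f t) \<le> B"
  shows "norm b \<le> B"
proof (rule field_le_epsilon)
  fix e :: real assume "0 < e"
  then have "0 < e / 2" by simp
  with c obtain p where p: "\<And>t. t \<in> rspec a \<Longrightarrow> cmod (f t - poly p (complex_of_real t)) \<le> e / 2"
    "norm (ev p a - b) \<le> e / 2" by (rule calcE) blast
  have "norm (ev p a) \<le> B + e / 2"
  proof (rule norm_ev_le[OF a])
    fix t assume t: "t \<in> rspec a"
    show "cmod (poly p (complex_of_real t)) \<le> B + e / 2"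
      using norm_triangle_ineq3[of "f t" "poly p (complex_of_real t)"] p(1)[OF t] f[OF t] by linarith
  qed
  then show "norm b \<le> B + e"
    using norm_triangle_ineq3[of "ev p a" b] p(2) by linarith
qed

lemma calc_norm_ge:
  assumes a: "adj a = a" and c: "calc a f b" and t: "t \<in> rspec a"
  shows "cmod (f t) \<le> norm b"
proof (rule field_le_epsilon)
  fix e :: real assume "0 < e"
  then have "0 < e / 2" by simp
  with c obtain p where p: "\<And>t. t \<in> rspec a \<Longrightarrow> cmod (f t - poly p (complex_of_real t)) \<le> e / 2"
    "norm (ev p a - b) \<le> e / 2" by (rule calcE) blast
  show "cmod (f t) \<le> norm b + e"
    using norm_triangle_ineq3[of "f t" "poly p (complex_of_real t)"] p(1)[OF t]
      norm_triangle_ineq3[of "ev p a" b] p(2) poly_le_norm_ev_real[OF a t, of p] by linarith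
qed

lemma calc_add:
  assumes "calc a f b" "calc a g c"
  shows "calc a (\<lambda>t. f t + g t) (b + c)"
  unfolding calc_def
proof (intro allI impI)
  fix e :: real assume "0 < e"
  then have e: "0 < e / 2" by simp
  obtain p where p: "\<And>t. t \<in> rspec a \<Longrightarrow> cmod (f t - poly p (complex_of_real t)) \<le> e / 2"
    "norm (ev p a - b) \<le> e / 2" using assms(1) e by (rule calcE) blast
  obtain q where q: "\<And>t. t \<in> rspec a \<Longrightarrow> cmod (g t - poly q (complex_of_real t)) \<le> e / 2"
    "norm (ev q a - c) \<le> e / 2" using assms(2) e by (rule calcE) blast
  have "cmod (f t + g t - poly (p + q) (complex_of_real t)) \<le> e" if "t \<in> rspec a" for t
    using norm_triangle_ineq[of "f t - poly p (complex_of_real t)" "g t - poly q (complex_of_real t)"]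
      p(1)[OF that] q(1)[OF that] by (simp add: algebra_simps)
  moreover have "norm (ev (p + q) a - (b + c)) \<le> e"
    using norm_triangle_ineq[of "ev p a - b" "ev q a - c"] p(2) q(2)
    by (simp add: algebra_simps ev_add)
  ultimately show "\<exists>p. (\<forall>t\<in>rspec a. cmod (f t + g t - poly p (complex_of_real t)) \<le> e) \<and>
      norm (ev p a - (b + c)) \<le> e" by blast
qed

lemma calc_mult:
  assumes a: "adj a = a" and f: "calc a f b" and g: "calc a g c"
  shows "calc a (\<lambda>t. f t * g t) (b * c)"
  unfolding calc_def
proof (intro allI impI)
  fix e :: real assume e: "0 < e"
  \<comment> \<open>The product error is at most \<open>norm b * d + d * (norm c + d)\<close>; with
    d at most 1 this is bounded by d N, hence by e.\<close>
  define N where "N = norm b + norm c + 1"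
  have N: "N > 0" unfolding N_def by (intro add_nonneg_pos add_nonneg_nonneg) auto
  define d where "d = min 1 (e / N)"
  have d: "0 < d" "d \<le> 1" using e N by (auto simp: d_def)
  have "d * N \<le> e / N * N" using N by (intro mult_right_mono) (auto simp: d_def)
  then have dN: "d * N \<le> e" using N by simp
  have bound: "norm b * d + d * (norm c + d) \<le> e"
  proof -
    have "d * d \<le> d * 1" using d by (intro mult_left_mono) auto
    then show ?thesis using dN by (simp add: N_def algebra_simps)
  qed
  obtain p where p: "\<And>t. t \<in> rspec a \<Longrightarrow> cmod (f t - poly p (complex_of_real t)) \<le> d"
    "norm (ev p a - b) \<le> d" using f d(1) by (rule calcE) blast
  obtain q where q: "\<And>t. t \<in> rspec a \<Longrightarrow> cmod (g t - poly q (complex_of_real t)) \<le> d"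
    "norm (ev q a - c) \<le> d" using g d(1) by (rule calcE) blast
  have nq: "norm (ev q a) \<le> norm c + d"
    using norm_triangle_ineq3[of "ev q a" c] q(2) by linarith
  have "cmod (f t * g t - poly (p * q) (complex_of_real t)) \<le> e" if t: "t \<in> rspec a" for t
  proof -
    let ?P = "poly p (complex_of_real t)" and ?Q = "poly q (complex_of_real t)"
    have "f t * g t - poly (p * q) (complex_of_real t) = f t * (g t - ?Q) + (f t - ?P) * ?Q"
      by (simp add: algebra_simps)
    then have "cmod (f t * g t - poly (p * q) (complex_of_real t))
        \<le> cmod (f t) * cmod (g t - ?Q) + cmod (f t - ?P) * cmod ?Q"
      by (metis norm_mult norm_triangle_ineq)
    also have "\<dots> \<le> norm b * d + d * (norm c + d)"
      using calc_norm_ge[OF a f t] p(1)[OF t] q(1)[OF t] poly_le_norm_ev_real[OF a t, of q] nq d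
      by (intro add_mono mult_mono) auto
    finally show ?thesis using bound by linarith
  qed
  moreover have "norm (ev (p * q) a - b * c) \<le> e"
  proof -
    have "ev (p * q) a - b * c = b * (ev q a - c) + (ev p a - b) * ev q a"
      by (simp add: ev_mult algebra_simps)
    then have "norm (ev (p * q) a - b * c)
        \<le> norm b * norm (ev q a - c) + norm (ev p a - b) * norm (ev q a)"
      by (metis add_mono norm_mult_ineq norm_triangle_le)
    also have "\<dots> \<le> norm b * d + d * (norm c + d)"
      using p(2) q(2) nq d by (intro add_mono mult_mono) auto
    finally show ?thesis using bound by linarith
  qed
  ultimately show "\<exists>p. (\<forall>t\<in>rspec a. cmod (f t * g t - poly p (complex_of_real t)) \<le> e) \<and>
      norm (ev p a - b * c) \<le> e" by blast
qed

lemma calc_scaleC: "adj a = a \<Longrightarrow> calc a f b \<Longrightarrow> calc a (\<lambda>t. z * f t) (z *\<^sub>C b)"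
  using calc_mult[of a "\<lambda>t. z" "z *\<^sub>C 1" f b] calc_ev[of a "[:z:]"]
  by (simp add: mult_scaleC_left)

lemma calc_cnj:
  assumes a: "adj a = a" and f: "calc a f b"
  shows "calc a (\<lambda>t. cnj (f t)) (adj b)"
  unfolding calc_def
proof (intro allI impI)
  fix e :: real assume "0 < e"
  with f obtain p where p: "\<And>t. t \<in> rspec a \<Longrightarrow> cmod (f t - poly p (complex_of_real t)) \<le> e"
    "norm (ev p a - b) \<le> e" by (rule calcE) blast
  let ?q = "map_poly cnj p"
  have "cmod (cnj (f t) - poly ?q (complex_of_real t)) \<le> e" if "t \<in> rspec a" for t
    using p(1)[OF that] by (simp add: poly_map_cnj flip: complex_cnj_diff)
  moreover have "norm (ev ?q a - adj b) \<le> e"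
    using p(2) by (simp add: adj_ev[OF a, symmetric] flip: adj_diff)
  ultimately show "\<exists>p. (\<forall>t\<in>rspec a. cmod (cnj (f t) - poly p (complex_of_real t)) \<le> e) \<and>
      norm (ev p a - adj b) \<le> e" by blast
qed

lemma calc_diff:
  "adj a = a \<Longrightarrow> calc a f b \<Longrightarrow> calc a g c \<Longrightarrow> calc a (\<lambda>t. f t - g t) (b - c)"
  using calc_add[of a f b "\<lambda>t. -1 * g t" "-1 *\<^sub>C c"] calc_scaleC[of a g c "-1"] by simp

lemma calc_unique: "adj a = a \<Longrightarrow> calc a f b \<Longrightarrow> calc a f c \<Longrightarrow> b = c"
  using calc_norm_le[OF _ calc_diff, of a f b f c 0] by simp

section \<open>Existence by polynomial approximation\<close>

lemma Weierstrass_complex_poly: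
  fixes f :: "real \<Rightarrow> complex"
  assumes S: "compact S" and f: "continuous_on S f" and e: "0 < e"
  shows "\<exists>p. \<forall>t\<in>S. cmod (f t - poly p (complex_of_real t)) \<le> e"
proof -
  have real: "\<exists>p. \<forall>t\<in>S. cmod (complex_of_real (g t) - poly p (complex_of_real t)) \<le> e / 2"
    if g: "continuous_on S g" for g :: "real \<Rightarrow> real"
  proof -
    obtain h where h: "real_polynomial_function h" "\<And>t. t \<in> S \<Longrightarrow> \<bar>g t - h t\<bar> < e / 2"
      using Stone_Weierstrass_real_polynomial_function[OF S g, of "e / 2"] e by auto
    obtain a n where an: "h = (\<lambda>x. \<Sum>i\<le>n. a i * x ^ i)"
      using h(1) unfolding real_polynomial_function_iff_sum by blast
    define p where "p = (\<Sum>i\<le>n. monom (complex_of_real (a i)) i)"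
    have p: "poly p (complex_of_real t) = complex_of_real (h t)" for t
      by (simp add: p_def an poly_sum poly_monom)
    have "cmod (complex_of_real (g t) - poly p (complex_of_real t)) \<le> e / 2" if "t \<in> S" for t
      using h(2)[OF that] unfolding p by (simp flip: of_real_diff)
    then show ?thesis by blast
  qed
  have "continuous_on S (\<lambda>t. Re (f t))" "continuous_on S (\<lambda>t. Im (f t))"
    by (simp_all add: continuous_on_Re continuous_on_Im f)
  then obtain p q where p: "\<forall>t\<in>S. cmod (complex_of_real (Re (f t)) - poly p (complex_of_real t)) \<le> e / 2"
    and q: "\<forall>t\<in>S. cmod (complex_of_real (Im (f t)) - poly q (complex_of_real t)) \<le> e / 2"
    using real by meson
  have "cmod (f t - poly (p + smult \<i> q) (complex_of_real t)) \<le> e" if t: "t \<in> S" for t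
  proof -
    have "f t - poly (p + smult \<i> q) (complex_of_real t) =
        (complex_of_real (Re (f t)) - poly p (complex_of_real t)) +
        \<i> * (complex_of_real (Im (f t)) - poly q (complex_of_real t))"
      by (simp add: algebra_simps complex_eq[symmetric])
    also have "cmod \<dots> \<le> e / 2 + e / 2"
      using p q t by (intro norm_triangle_le add_mono) (auto simp: norm_mult)
    finally show ?thesis by simp
  qed
  then show ?thesis by blast
qed

text \<open>By \<open>norm_ev_le\<close>, polynomials that are close on the spectrum are close in
  norm at a. So evaluating Weierstrass approximations of f gives a Cauchy sequence.\<close>

lemma calc_exists:
  fixes a :: "'a::cstar_algebra_1"
  assumes a: "adj a = a" and f: "continuous_on (rspec a) f"
  shows "\<exists>b. calc a f b"
proof -
  have "\<exists>p. \<forall>t\<in>rspec a. cmod (f t - poly p (complex_of_real t)) \<le> inverse (real (Suc n))" for n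
    using f by (intro Weierstrass_complex_poly compact_rspec) auto
  then obtain p where
    p: "\<And>n t. t \<in> rspec a \<Longrightarrow> cmod (f t - poly (p n) (complex_of_real t)) \<le> inverse (real (Suc n))"
    by metis
  have diff: "norm (ev (p m) a - ev (p n) a) \<le> inverse (real (Suc m)) + inverse (real (Suc n))" for m n
    unfolding ev_diff[symmetric]
  proof (rule norm_ev_le[OF a])
    fix t assume t: "t \<in> rspec a"
    show "cmod (poly (p m - p n) (complex_of_real t)) \<le> inverse (real (Suc m)) + inverse (real (Suc n))"
      using norm_triangle_ineq4[of "f t - poly (p n) (complex_of_real t)" "f t - poly (p m) (complex_of_real t)"]
        p[OF t, of m] p[OF t, of n] by simp
  qed
  have small: "\<exists>M. \<forall>n\<ge>M. inverse (real (Suc n)) < e" if "0 < e" for e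
    by (metis inverse_Suc le_less_trans le_imp_inverse_le of_nat_0_less_iff of_nat_le_iff
        reals_Archimedean that zero_less_Suc Suc_le_mono)
  have "Cauchy (\<lambda>n. ev (p n) a)"
  proof (rule CauchyI)
    fix e :: real assume "0 < e"
    then obtain M where M: "\<And>n. n \<ge> M \<Longrightarrow> inverse (real (Suc n)) < e / 2" using small[of "e / 2"] by auto
    have "norm (ev (p m) a - ev (p n) a) < e" if "m \<ge> M" "n \<ge> M" for m n
      using diff[of m n] M[OF that(1)] M[OF that(2)] by linarith
    then show "\<exists>M. \<forall>m\<ge>M. \<forall>n\<ge>M. norm (ev (p m) a - ev (p n) a) < e" by blast
  qed
  then obtain b where b: "(\<lambda>n. ev (p n) a) \<longlonglongrightarrow> b" by (metis Cauchy_convergent_iff convergent_def)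
  have "calc a f b"
    unfolding calc_def
  proof (intro allI impI)
    fix e :: real assume e: "0 < e"
    obtain M where M: "\<And>n. n \<ge> M \<Longrightarrow> inverse (real (Suc n)) < e" using small[OF e] by auto
    obtain N where N: "\<And>n. n \<ge> N \<Longrightarrow> norm (ev (p n) a - b) < e" using b e by (metis LIMSEQ_D)
    let ?n = "max M N"
    have "\<forall>t\<in>rspec a. cmod (f t - poly (p ?n) (complex_of_real t)) \<le> e"
      using p M[of ?n] by (meson less_imp_le max.cobounded1 order_trans)
    moreover have "norm (ev (p ?n) a - b) \<le> e" using N[of ?n] by simp
    ultimately show "\<exists>p. (\<forall>t\<in>rspec a. cmod (f t - poly p (complex_of_real t)) \<le> e) \<and> norm (ev p a - b) \<le> e"
      by blast
  qed
  then show ?thesis ..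
qed

definition fc :: "'a::cstar_algebra_1 \<Rightarrow> (real \<Rightarrow> complex) \<Rightarrow> 'a" where
  "fc a f = (THE b. calc a f b)"

lemma fc_eqI: "adj a = a \<Longrightarrow> calc a f b \<Longrightarrow> fc a f = b"
  unfolding fc_def using calc_unique by blast

lemma calc_fc: "adj a = a \<Longrightarrow> continuous_on (rspec a) f \<Longrightarrow> calc a f (fc a f)"
  using calc_exists fc_eqI by metis

definition rfc :: "'a::cstar_algebra_1 \<Rightarrow> (real \<Rightarrow> real) \<Rightarrow> 'a" where
  "rfc a g = fc a (\<lambda>t. complex_of_real (g t))"

context
  fixes a :: "'a::cstar_algebra_1"
  assumes a: "adj a = a"
begin

lemma rfc_eqI: "calc a (\<lambda>t. complex_of_real (g t)) b \<Longrightarrow> rfc a g = b"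
  unfolding rfc_def by (rule fc_eqI[OF a])

lemma calc_rfc:
  assumes "continuous_on UNIV g"
  shows "calc a (\<lambda>t. complex_of_real (g t)) (rfc a g)"
  unfolding rfc_def
  by (intro calc_fc[OF a] continuous_intros continuous_on_subset[OF assms]) simp

lemma rfc_const: "rfc a (\<lambda>t. c) = c *\<^sub>R 1"
  using calc_ev[of a "[:complex_of_real c:]"] by (intro rfc_eqI) (simp add: scaleR_scaleC)

lemma rfc_id: "rfc a (\<lambda>t. t) = a"
  using calc_ev[of a "[:0, 1:]"] by (intro rfc_eqI) simp

lemma adj_rfc: "continuous_on UNIV g \<Longrightarrow> adj (rfc a g) = rfc a g"
  using calc_cnj[OF a calc_rfc[of g]] by (intro rfc_eqI[symmetric]) simp

text \<open>Functions are asked to be continuous on the whole line, while identities between them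
  often hold only on a nonnegative spectrum. Truncations such as \<open>max t 0\<close> secure the
  first; this lemma permits the second.\<close>

lemma rfc_cong:
  assumes "continuous_on UNIV f" "\<And>t. t \<in> rspec a \<Longrightarrow> f t = g t"
  shows "rfc a f = rfc a g"
  by (rule rfc_eqI[symmetric], rule calc_cong[OF calc_rfc[OF assms(1)]]) (simp add: assms(2))

lemma norm_rfc_ge: "continuous_on UNIV g \<Longrightarrow> t \<in> rspec a \<Longrightarrow> \<bar>g t\<bar> \<le> norm (rfc a g)"
  using calc_norm_ge[OF a calc_rfc[of g]] by simp

lemma norm_rfc_le:
  "continuous_on UNIV g \<Longrightarrow> (\<And>t. t \<in> rspec a \<Longrightarrow> \<bar>g t\<bar> \<le> B) \<Longrightarrow> norm (rfc a g) \<le> B"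
  using calc_norm_le[OF a calc_rfc[of g]] by simp

context
  fixes f g :: "real \<Rightarrow> real"
  assumes f: "continuous_on UNIV f" and g: "continuous_on UNIV g"
begin

lemma rfc_mult: "rfc a (\<lambda>t. f t * g t) = rfc a f * rfc a g"
  using calc_mult[OF a calc_rfc[OF f] calc_rfc[OF g]] by (intro rfc_eqI) simp

lemma rfc_diff: "rfc a (\<lambda>t. f t - g t) = rfc a f - rfc a g"
  using calc_diff[OF a calc_rfc[OF f] calc_rfc[OF g]] by (intro rfc_eqI) simp

end

end

section \<open>Positive elements of a unital C*-algebra\<close>

text \<open>For self-adjoint x this is equivalent to a nonnegative spectrum
  (\<open>pos_iff_rspec\<close>); in this form sums are handled by the triangle inequality
  alone.\<close>

definition pos :: "'a::cstar_algebra_1 \<Rightarrow> bool" where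
  "pos x \<longleftrightarrow> adj x = x \<and> (\<exists>t. norm (t *\<^sub>R 1 - x) \<le> t)"

lemma pos_adj: "pos x \<Longrightarrow> adj x = x"
  by (simp add: pos_def)

lemma pos_iff_rspec: "pos x \<longleftrightarrow> adj x = x \<and> (\<forall>t\<in>rspec x. 0 \<le> t)"
proof (cases "adj x = x")
  case True
  have ev: "s *\<^sub>R 1 - x = ev [:complex_of_real s, -1:] x" for s
    by (simp add: scaleR_scaleC)
  have "0 \<le> t" if "t \<in> rspec x" "norm (s *\<^sub>R 1 - x) \<le> s" for s t
  proof -
    have "cmod (complex_of_real s - complex_of_real t) \<le> norm (s *\<^sub>R 1 - x)"
      unfolding ev using poly_le_norm_ev_real[OF True that(1), of "[:complex_of_real s, -1:]"] by simp
    then show ?thesis using that(2) by (simp flip: of_real_diff)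
  qed
  moreover have "norm (norm x *\<^sub>R 1 - x) \<le> norm x" if "\<forall>t\<in>rspec x. 0 \<le> t"
    unfolding ev
  proof (rule norm_ev_le[OF True])
    fix t assume t: "t \<in> rspec x"
    then show "cmod (poly [:complex_of_real (norm x), -1:] (complex_of_real t)) \<le> norm x"
      using that rspec_le_norm[OF t] by (simp flip: of_real_diff)
  qed
  ultimately show ?thesis using True by (auto simp: pos_def)
qed (simp add: pos_def)

lemma pos_rspec: "pos x \<Longrightarrow> t \<in> rspec x \<Longrightarrow> 0 \<le> t"
  by (simp add: pos_iff_rspec)

lemma pos_rfc:
  assumes a: "adj a = a" and g: "continuous_on UNIV g" and "\<And>t. t \<in> rspec a \<Longrightarrow> 0 \<le> g t"
  shows "pos (rfc a g)"
proof -
  let ?N = "norm (rfc a g)"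
  have "?N *\<^sub>R 1 - rfc a g = rfc a (\<lambda>t. ?N - g t)"
    using rfc_diff[OF a _ g, of "\<lambda>_. ?N"] by (simp add: rfc_const[OF a])
  also have "norm \<dots> \<le> ?N"
    using assms norm_rfc_ge[OF a g]
    by (intro norm_rfc_le[OF a] continuous_intros g) (auto simp: abs_le_iff)
  finally show ?thesis using adj_rfc[OF a g] by (auto simp: pos_def)
qed

section \<open>The cone of positive elements\<close>

lemma pos_zero [simp]: "pos 0"
  by (auto simp: pos_def intro: exI[of _ 0])

lemma pos_add:
  assumes "pos x" "pos y"
  shows "pos (x + y)"
proof -
  obtain s t where "norm (s *\<^sub>R 1 - x) \<le> s" "norm (t *\<^sub>R 1 - y) \<le> t" using assms by (auto simp: pos_def)
  then have "norm ((s + t) *\<^sub>R 1 - (x + y)) \<le> s + t"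
    using norm_triangle_ineq[of "s *\<^sub>R 1 - x" "t *\<^sub>R 1 - y"] by (simp add: algebra_simps)
  then show ?thesis using assms by (auto simp: pos_def adj_add)
qed

lemma pos_scaleR:
  assumes "pos x" "0 \<le> r"
  shows "pos (r *\<^sub>R x)"
proof -
  obtain s where "norm (s *\<^sub>R 1 - x) \<le> s" using assms by (auto simp: pos_def)
  then have "norm (r *\<^sub>R (s *\<^sub>R 1 - x)) \<le> r * s" using assms(2) by (simp add: mult_left_mono)
  then have "norm ((r * s) *\<^sub>R 1 - r *\<^sub>R x) \<le> r * s" by (simp add: algebra_simps)
  then show ?thesis using assms by (auto simp: pos_def adj_scaleR)
qed

lemma pos_sum: "(\<And>i. i \<in> S \<Longrightarrow> pos (f i)) \<Longrightarrow> pos (sum f S)"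
  by (induction S rule: infinite_finite_induct) (auto intro: pos_add)

lemma pos_sum_list: "(\<And>x. x \<in> set xs \<Longrightarrow> pos x) \<Longrightarrow> pos (sum_list xs)"
  by (induction xs) (auto intro: pos_add)

lemma pos_norm_minus: "adj x = x \<Longrightarrow> norm x \<le> r \<Longrightarrow> pos (r *\<^sub>R 1 - x)"
  unfolding pos_def by (auto simp: adj_diff adj_scaleR intro!: exI[of _ r])

lemma pos_sqrt:
  assumes "pos x"
  shows "\<exists>y. adj y = y \<and> y * y = x"
proof -
  let ?g = "\<lambda>t::real. sqrt (max t 0)"
  have g: "continuous_on UNIV ?g" by (intro continuous_intros)
  have x: "adj x = x" using assms by (rule pos_adj)
  have "rfc x ?g * rfc x ?g = rfc x (\<lambda>t. ?g t * ?g t)" by (simp only: rfc_mult[OF x g g])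
  also have "\<dots> = rfc x (\<lambda>t. t)"
    by (intro rfc_cong[OF x] continuous_intros) (simp add: pos_rspec[OF assms])
  finally show ?thesis using adj_rfc[OF x g] rfc_id[OF x] by auto
qed

lemma pos_square:
  assumes "adj y = y"
  shows "pos (y * y)"
proof -
  have "pos (rfc y (\<lambda>t. t * t))" by (intro pos_rfc assms continuous_intros) simp
  then show ?thesis using rfc_mult[OF assms, of "\<lambda>t. t" "\<lambda>t. t"] by (simp add: rfc_id[OF assms])
qed

lemma pos_antisym:
  assumes "pos x" "pos (- x)"
  shows "x = 0"
proof -
  obtain t where t: "t \<in> rspec x" "\<bar>t\<bar> = norm x" using ex_rspec_norm[OF pos_adj[OF assms(1)]] by blast
  then obtain z where "z \<in> spec x" "Re z = t" by (auto simp: rspec_def)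
  then have "- t \<in> rspec (- x)" unfolding rspec_def by (intro image_eqI[of _ _ "- z"]) (auto simp: spec_minus)
  then show ?thesis using pos_rspec[OF assms(2)] pos_rspec[OF assms(1)] t by force
qed

text \<open>
  With \<open>n\<close> the negative part of \<open>x\<^sup>*x\<close> and \<open>y = xn\<close>, the element \<open>y\<^sup>*y = -n\<^sup>3\<close> is negative, while
  \<open>yy\<^sup>*\<close>, which has the same nonzero spectrum, is a sum of squares minus \<open>y\<^sup>*y\<close>.
\<close>

lemma pos_adj_mult:
  fixes x :: "'a::cstar_algebra_1"
  shows "pos (adj x * x)"
proof -
  define h where "h = adj x * x"
  have h: "adj h = h" by (simp add: h_def adj_mult)
  let ?n = "\<lambda>t::real. max (- t) 0"
  have cn: "continuous_on UNIV ?n" "continuous_on UNIV (\<lambda>t. t * ?n t)"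
    "continuous_on UNIV (\<lambda>t. ?n t * (t * ?n t))"
    by (intro continuous_intros)+
  define n where "n = rfc h ?n"
  have n: "adj n = n" unfolding n_def by (rule adj_rfc[OF h cn(1)])
  define y where "y = x * n"
  have "adj y * y = n * (h * n)" by (simp add: y_def h_def adj_mult n mult.assoc)
  also have "\<dots> = rfc h (\<lambda>t. ?n t * (t * ?n t))"
    unfolding n_def
    by (subst rfc_mult[OF h cn(1,2)], subst rfc_mult[OF h _ cn(1), of "\<lambda>t. t"])
      (simp_all add: rfc_id[OF h])
  finally have yy: "adj y * y = rfc h (\<lambda>t. ?n t * (t * ?n t))" .
  have "- (adj y * y) = rfc h (\<lambda>t. 0 - ?n t * (t * ?n t))"
    unfolding yy by (subst rfc_diff[OF h _ cn(3)]) (simp_all add: rfc_const[OF h])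
  moreover have "pos (rfc h (\<lambda>t. 0 - ?n t * (t * ?n t)))"
    by (intro pos_rfc[OF h] continuous_intros)
      (simp add: max_def mult_nonpos_nonneg mult_nonneg_nonpos zero_le_mult_iff mult_le_0_iff)
  ultimately have neg: "pos (- (adj y * y))" by simp
  \<comment> \<open>\<open>u\<close> and \<open>v\<close> are twice the real part and minus twice
    the imaginary part of y, so the sum of their squares is 2 (y y* + y* y).\<close>
  define u where "u = y + adj y"
  define v where "v = \<i> *\<^sub>C (y - adj y)"
  have uv: "adj u = u" "adj v = v"
    by (simp_all add: u_def v_def adj_add adj_diff adj_scaleC scaleC_diff_right)
  have "v * v = - ((y - adj y) * (y - adj y))"
    by (simp add: v_def mult_scaleC_left mult_scaleC_right scaleC_scaleC)
  then have "u * u + v * v = 2 *\<^sub>R (y * adj y) + 2 *\<^sub>R (adj y * y)"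
    by (simp add: u_def algebra_simps scaleR_2)
  then have "y * adj y = (1 / 2) *\<^sub>R (u * u + v * v) + - (adj y * y)"
    by (simp add: scaleR_right_distrib)
  moreover have "pos ((1 / 2) *\<^sub>R (u * u + v * v) + - (adj y * y))"
    using neg by (intro pos_add pos_scaleR pos_square uv) auto
  ultimately have yy': "pos (y * adj y)" by simp
  have "pos (adj y * y)"
    unfolding pos_iff_rspec
  proof
    show "adj (adj y * y) = adj y * y" by (simp add: adj_mult)
    show "\<forall>t\<in>rspec (adj y * y). 0 \<le> t"
    proof
      fix t assume "t \<in> rspec (adj y * y)"
      then obtain z where z: "z \<in> spec (adj y * y)" "t = Re z" by (auto simp: rspec_def)
      show "0 \<le> t"
      proof (cases "z = 0")
        case False
        then have "Re z \<in> rspec (y * adj y)" using spec_mult_commute[OF z(1)] by (auto simp: rspec_def)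
        then show ?thesis using pos_rspec[OF yy'] z by blast
      qed (simp add: z)
    qed
  qed
  then have "adj y * y = 0" using neg by (rule pos_antisym)
  \<comment> \<open>At a negative t this function equals t^3, so its vanishing on the spectrum
    excludes such points.\<close>
  then have zero: "\<bar>?n t * (t * ?n t)\<bar> \<le> 0" if "t \<in> rspec h" for t
    using norm_rfc_ge[OF h cn(3) that] yy by simp
  have "0 \<le> t" if "t \<in> rspec h" for t
    using zero[OF that] by (cases "t < 0") auto
  then show ?thesis using h unfolding pos_iff_rspec h_def by blast
qed

lemma pos_conj:
  assumes "pos x"
  shows "pos (z * x * adj z)"
proof -
  obtain y where "adj y = y" "y * y = x" using pos_sqrt[OF assms] by blast
  then have "z * x * adj z = adj (y * adj z) * (y * adj z)" by (auto simp: adj_mult mult.assoc)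
  then show ?thesis by (simp only: pos_adj_mult)
qed

text \<open>\<open>norm y *\<^sub>R 1 - x\<close> is positive as the sum of
  \<open>norm y *\<^sub>R 1 - y\<close> and \<open>y - x\<close>. The point \<open>norm x\<close> of
  the spectrum of x then gives the inequality.\<close>

lemma norm_mono_pos:
  assumes "pos x" "pos (y - x)"
  shows "norm x \<le> norm y"
proof -
  have x: "adj x = x" by (rule pos_adj[OF assms(1)])
  have "adj y = y" using pos_adj[OF assms(2)] x by (simp add: adj_diff)
  then have "pos ((norm y *\<^sub>R 1 - y) + (y - x))" by (intro pos_add assms pos_norm_minus) auto
  then obtain s where s: "norm (s *\<^sub>R 1 - (norm y *\<^sub>R 1 - x)) \<le> s" by (auto simp: pos_def)
  obtain t where t: "t \<in> rspec x" "\<bar>t\<bar> = norm x" using ex_rspec_norm[OF x] by blast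
  have "s *\<^sub>R 1 - (norm y *\<^sub>R 1 - x) = ev [:complex_of_real (s - norm y), 1:] x"
    by (simp add: scaleR_scaleC scaleC_diff_left)
  then have "norm (ev [:complex_of_real (s - norm y), 1:] x) \<le> s" using s by (simp only:)
  then have "cmod (complex_of_real (s - norm y) + complex_of_real t) \<le> s"
    using poly_le_norm_ev_real[OF x t(1), of "[:complex_of_real (s - norm y), 1:]"]
    by (simp del: ev_pCons)
  then have "\<bar>s - norm y + t\<bar> \<le> s" by (metis norm_of_real of_real_add)
  then show ?thesis using t pos_rspec[OF assms(1) t(1)] by linarith
qed

section \<open>Functional calculus in a C*-algebra without unit\<close>

lemma emb_simps:
  "emb x + emb y = emb (x + y)" "emb x - emb y = emb (x - y)" "- emb x = emb (- x)"
  "emb x * emb y = emb (x * y)" "adj (emb x) = emb (adj x)" "z *\<^sub>C emb x = emb (z *\<^sub>C x)"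
  "r *\<^sub>R emb x = emb (r *\<^sub>R x)" "(0 :: 'a::cstar_algebra unitz) = emb 0"
  for x :: "'a::cstar_algebra"
  by (simp_all add: unitz_eqI scaleR_unitz_def Defs.scaleR_scaleC)

lemma emb_vec: "scal u = 0 \<Longrightarrow> emb (vec u) = u"
  by (simp add: unitz_eqI)

lemma spectrum_eq_spec: "spectrum a = spec (emb a)"
proof -
  have mult: "Unitz (fst u) (snd u) * Unitz (fst v) (snd v) = 1 \<longleftrightarrow> unitization_mult u v = (1, 0)"
    for u v :: "complex \<times> 'a"
    by (auto simp: unitization_mult_def one_unitz_def times_unitz_def)
  have e: "z *\<^sub>C 1 - emb a = Unitz (fst (z, - a)) (snd (z, - a))" for z
    by (simp add: unitz_eqI)
  have "unit (z *\<^sub>C 1 - emb a) \<longleftrightarrow>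
      (\<exists>u. unitization_mult (z, - a) u = (1, 0) \<and> unitization_mult u (z, - a) = (1, 0))" for z
  proof
    assume "unit (z *\<^sub>C 1 - emb a)"
    then obtain v where v: "(z *\<^sub>C 1 - emb a) * v = 1" "v * (z *\<^sub>C 1 - emb a) = 1"
      unfolding unit_def inverse_of_def by blast
    have "v = Unitz (fst (scal v, vec v)) (snd (scal v, vec v))" by simp
    then show "\<exists>u. unitization_mult (z, - a) u = (1, 0) \<and> unitization_mult u (z, - a) = (1, 0)"
      using v mult unfolding e by metis
  next
    assume "\<exists>u. unitization_mult (z, - a) u = (1, 0) \<and> unitization_mult u (z, - a) = (1, 0)"
    then show "unit (z *\<^sub>C 1 - emb a)" unfolding e mult[symmetric] by (blast intro: unitI)
  qed
  then show ?thesis by (simp add: spectrum_def spec_def)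
qed

lemma zero_in_spectrum: "0 \<in> spectrum a"
  by (auto simp: spectrum_def unitization_mult_def)

lemma zero_in_rspec: "0 \<in> rspec (emb a)"
  using zero_in_spectrum[of a] unfolding spectrum_eq_spec rspec_def by force

lemma positive_element_iff: "positive_element a \<longleftrightarrow> pos (emb a)"
proof (cases "adj a = a")
  case True
  then have "adj (emb a) = emb a" by (simp add: emb_simps)
  then show ?thesis using True
    by (simp add: positive_element_def pos_iff_rspec spectrum_eq_spec spec_eq_rspec)
next
  case False
  then show ?thesis by (simp add: positive_element_def pos_def emb_simps)
qed

lemma scal_ev: "scal (ev p (emb a)) = poly p 0"
  by (induction p) (simp_all add: scaleC_unitz_def)

text \<open>\<open>scal\<close> is a character of the unitization that sends \<open>emb a\<close> to
  0, hence f(a) to f(0). So f(a) lies in A exactly when f vanishes at 0.\<close>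

lemma scal_calc:
  assumes a: "adj a = a" and c: "calc (emb a) f b"
  shows "scal b = f 0"
proof -
  have "cmod (f 0 - scal b) \<le> 0"
  proof (rule field_le_epsilon)
    fix e :: real assume "0 < e"
    then have "0 < e / 2" by simp
    with c obtain p where p: "\<And>t. t \<in> rspec (emb a) \<Longrightarrow> cmod (f t - poly p (complex_of_real t)) \<le> e / 2"
      "norm (ev p (emb a) - b) \<le> e / 2" by (rule calcE) blast
    have "cmod (poly p 0 - scal b) \<le> e / 2"
      using norm_scal_le[of "ev p (emb a) - b"] p(2) by (simp add: scal_ev)
    then show "cmod (f 0 - scal b) \<le> 0 + e"
      using p(1)[OF zero_in_rspec] norm_triangle_ineq[of "f 0 - poly p 0" "poly p 0 - scal b"] by simp
  qed
  then show ?thesis by simp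
qed

lemma scal_rfc:
  "adj a = a \<Longrightarrow> continuous_on UNIV g \<Longrightarrow> scal (rfc (emb a) g) = complex_of_real (g 0)"
  using scal_calc[of a, OF _ calc_rfc[of "emb a" g]] by (simp add: emb_simps)

lemma continuous_on_rspec:
  assumes "adj a = a" "f \<in> C0_spectrum a"
  shows "continuous_on (rspec (emb a)) (\<lambda>t. f (complex_of_real t))"
proof (rule continuous_on_compose2[of "spectrum a" f _ complex_of_real])
  show "continuous_on (spectrum a) f" using assms by (simp add: C0_spectrum_def)
  show "complex_of_real ` rspec (emb a) \<subseteq> spectrum a"
    using assms(1) by (simp add: spectrum_eq_spec spec_eq_rspec emb_simps)
qed (intro continuous_intros)

text \<open>As f vanishes at 0, the value in the unitization has zero scalar part, and passing to
  \<open>vec\<close> preserves products and norms.\<close>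

lemma functional_calculus_exists:
  fixes a :: "'a::cstar_algebra"
  assumes a: "adj a = a"
  shows "functional_calculus a (\<lambda>f. vec (fc (emb a) (\<lambda>t. f (complex_of_real t))))"
    (is "functional_calculus a ?\<Phi>")
proof -
  have A: "adj (emb a) = emb a" using a by (simp add: emb_simps)
  let ?F = "\<lambda>f. fc (emb a) (\<lambda>t. f (complex_of_real t))"
  have calc: "calc (emb a) (\<lambda>t. f (complex_of_real t)) (?F f)" if "f \<in> C0_spectrum a" for f
    by (intro calc_fc A continuous_on_rspec a that)
  have scal: "scal (?F f) = 0" if f: "f \<in> C0_spectrum a" for f
    using scal_calc[OF a calc[OF f]] f by (simp add: C0_spectrum_def)
  have spec: "spectrum a = complex_of_real ` rspec (emb a)"
    by (simp add: spectrum_eq_spec spec_eq_rspec[OF A])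
  show ?thesis
    unfolding functional_calculus_def
  proof (intro conjI ballI allI)
    have "?F (\<lambda>z. z) = emb a" using fc_eqI[OF A, OF calc_ev[of "emb a" "[:0, 1:]"]] by simp
    then show "?\<Phi> (\<lambda>z. z) = a" by simp
  next
    fix f g c assume f: "f \<in> C0_spectrum a" and g: "g \<in> C0_spectrum a"
    show "?\<Phi> (\<lambda>z. f z + g z) = ?\<Phi> f + ?\<Phi> g"
      using fc_eqI[OF A calc_add[OF calc[OF f] calc[OF g]]] by simp
    show "?\<Phi> (\<lambda>z. f z * g z) = ?\<Phi> f * ?\<Phi> g"
      using fc_eqI[OF A calc_mult[OF A calc[OF f] calc[OF g]]] scal[OF f] scal[OF g] by simp
  next
    fix f c assume f: "f \<in> C0_spectrum a"
    show "?\<Phi> (\<lambda>z. cnj (f z)) = adj (?\<Phi> f)"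
      using fc_eqI[OF A calc_cnj[OF A calc[OF f]]] by simp
    show "?\<Phi> (\<lambda>z. c * f z) = c *\<^sub>C ?\<Phi> f"
      using fc_eqI[OF A calc_scaleC[OF A calc[OF f]]] by simp
    have n: "norm (?\<Phi> f) = norm (?F f)" by (metis emb_vec norm_emb scal[OF f])
    have le: "cmod (f z) \<le> norm (?F f)" if "z \<in> spectrum a" for z
      using calc_norm_ge[OF A calc[OF f]] that by (auto simp: spec)
    have bdd: "bdd_above ((\<lambda>z. cmod (f z)) ` spectrum a)" using le by (intro bdd_aboveI2)
    show "norm (?\<Phi> f) = (SUP z\<in>spectrum a. cmod (f z))"
      unfolding n
    proof (rule antisym)
      show "norm (?F f) \<le> (SUP z\<in>spectrum a. cmod (f z))"
        by (rule calc_norm_le[OF A calc[OF f]], rule cSUP_upper[OF _ bdd]) (simp add: spec)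
      show "(SUP z\<in>spectrum a. cmod (f z)) \<le> norm (?F f)"
        using le zero_in_spectrum[of a] by (intro cSUP_least) auto
    qed
  qed
qed

section \<open>Uniqueness of the functional calculus\<close>

lemma C0_spectrum_poly: "(\<lambda>z. z * poly p z) \<in> C0_spectrum a"
  by (auto simp: C0_spectrum_def intro!: continuous_intros)

lemma
  assumes "functional_calculus a \<Phi>"
  shows functional_calculus_id: "\<Phi> (\<lambda>z. z) = a"
    and functional_calculus_norm: "f \<in> C0_spectrum a \<Longrightarrow> norm (\<Phi> f) = (SUP z\<in>spectrum a. cmod (f z))"
    and functional_calculus_scaleC: "f \<in> C0_spectrum a \<Longrightarrow> \<Phi> (\<lambda>z. c * f z) = c *\<^sub>C \<Phi> f"
    and functional_calculus_add:
      "f \<in> C0_spectrum a \<Longrightarrow> g \<in> C0_spectrum a \<Longrightarrow> \<Phi> (\<lambda>z. f z + g z) = \<Phi> f + \<Phi> g"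
    and functional_calculus_mult:
      "f \<in> C0_spectrum a \<Longrightarrow> g \<in> C0_spectrum a \<Longrightarrow> \<Phi> (\<lambda>z. f z * g z) = \<Phi> f * \<Phi> g"
  using assms unfolding functional_calculus_def by simp_all

text \<open>Polynomials without constant term are built from the identity function, whose image is
  prescribed. The form z p(z) keeps every intermediate function in \<open>C0_spectrum a\<close>,
  where the laws are available.\<close>

lemma functional_calculus_poly:
  assumes "functional_calculus a \<Phi>" "functional_calculus a \<Psi>"
  shows "\<Phi> (\<lambda>z. z * poly p z) = \<Psi> (\<lambda>z. z * poly p z)"
proof -
  have id: "(\<lambda>z. z) \<in> C0_spectrum a" by (auto simp: C0_spectrum_def intro!: continuous_intros)
  show ?thesis
  proof (induction p)
    case 0
    show ?case
      using functional_calculus_scaleC[OF assms(1) id, of 0] functional_calculus_scaleC[OF assms(2) id, of 0]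
      by simp
  next
    case (pCons c p)
    have "X (\<lambda>z. z * poly (pCons c p) z) = c *\<^sub>C a + a * X (\<lambda>z. z * poly p z)"
      if X: "functional_calculus a X" for X
    proof -
      have c: "(\<lambda>z. c * z) \<in> C0_spectrum a" by (auto simp: C0_spectrum_def intro!: continuous_intros)
      have m: "(\<lambda>z. z * (z * poly p z)) \<in> C0_spectrum a"
        by (auto simp: C0_spectrum_def intro!: continuous_intros)
      have "X (\<lambda>z. z * poly (pCons c p) z) = X (\<lambda>z. c * z + z * (z * poly p z))"
        by (simp add: algebra_simps)
      also have "\<dots> = X (\<lambda>z. c * z) + X (\<lambda>z. z * (z * poly p z))"
        by (rule functional_calculus_add[OF X c m])
      also have "X (\<lambda>z. z * (z * poly p z)) = X (\<lambda>z. z) * X (\<lambda>z. z * poly p z)"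
        by (rule functional_calculus_mult[OF X id C0_spectrum_poly])
      also have "X (\<lambda>z. c * z) = c *\<^sub>C X (\<lambda>z. z)"
        by (rule functional_calculus_scaleC[OF X id])
      also have "X (\<lambda>z. z) = a" by (rule functional_calculus_id[OF X])
      finally show ?thesis .
    qed
    from this[OF assms(1)] this[OF assms(2)] show ?case by (simp only: pCons.IH)
  qed
qed

lemma functional_calculus_dist:
  assumes \<Phi>: "functional_calculus a \<Phi>" and f: "f \<in> C0_spectrum a" and g: "g \<in> C0_spectrum a"
    and le: "\<And>z. z \<in> spectrum a \<Longrightarrow> cmod (f z - g z) \<le> B"
  shows "norm (\<Phi> f - \<Phi> g) \<le> B"
proof -
  have mg: "(\<lambda>z. -1 * g z) \<in> C0_spectrum a"
    using g by (auto simp: C0_spectrum_def intro!: continuous_intros)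
  have fg: "(\<lambda>z. f z + -1 * g z) \<in> C0_spectrum a"
    using f g by (auto simp: C0_spectrum_def intro!: continuous_intros)
  have "\<Phi> (\<lambda>z. f z + -1 * g z) = \<Phi> f + \<Phi> (\<lambda>z. -1 * g z)"
    by (rule functional_calculus_add[OF \<Phi> f mg])
  also have "\<Phi> (\<lambda>z. -1 * g z) = -1 *\<^sub>C \<Phi> g"
    by (rule functional_calculus_scaleC[OF \<Phi> g])
  finally have "\<Phi> f - \<Phi> g = \<Phi> (\<lambda>z. f z + -1 * g z)" by simp
  also have "norm \<dots> = (SUP z\<in>spectrum a. cmod (f z + -1 * g z))"
    by (rule functional_calculus_norm[OF \<Phi> fg])
  also have "\<dots> \<le> B" using zero_in_spectrum[of a] le by (intro cSUP_least) auto
  finally show ?thesis .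
qed

lemma functional_calculus_unique:
  assumes a: "adj a = a" and \<Phi>: "functional_calculus a \<Phi>" and \<Psi>: "functional_calculus a \<Psi>"
    and f: "f \<in> C0_spectrum a"
  shows "\<Phi> f = \<Psi> f"
proof -
  have A: "adj (emb a) = emb a" using a by (simp add: emb_simps)
  have "norm (\<Phi> f - \<Psi> f) \<le> 0"
  proof (rule field_le_epsilon)
    fix e :: real assume e: "0 < e"
    then have "0 < e / 4" by simp
    then obtain p where p: "\<forall>t\<in>rspec (emb a). cmod (f (complex_of_real t) - poly p (complex_of_real t)) \<le> e / 4"
      using Weierstrass_complex_poly[OF compact_rspec continuous_on_rspec[OF a f]] by blast
    have "f 0 = 0" using f by (simp add: C0_spectrum_def)
    then have p0: "cmod (poly p 0) \<le> e / 4" using p[rule_format, OF zero_in_rspec] by simp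
    \<comment> \<open>Removing the constant term makes p divisible by X. As f vanishes at 0, this
      costs a second e/4.\<close>
    have "poly (p - [:poly p 0:]) 0 = 0" by simp
    then obtain q where q: "p - [:poly p 0:] = [:- 0, 1:] * q" by (metis poly_eq_0_iff_dvd dvdE)
    have q': "z * poly q z = poly p z - poly p 0" for z
      using arg_cong[OF q, of "\<lambda>r. poly r z"] by simp
    have le: "cmod (f z - z * poly q z) \<le> e / 2" if "z \<in> spectrum a" for z
    proof -
      obtain t where t: "t \<in> rspec (emb a)" "z = complex_of_real t"
        using \<open>z \<in> spectrum a\<close> by (auto simp: spectrum_eq_spec spec_eq_rspec[OF A])
      have "cmod (f z - poly p z) \<le> e / 4" using p t by blast
      moreover have eq: "f z - z * poly q z = f z - poly p z + poly p 0" by (simp add: q')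
      ultimately show ?thesis
        unfolding eq using p0 norm_triangle_ineq[of "f z - poly p z" "poly p 0"] by linarith
    qed
    have "norm (\<Phi> f - \<Phi> (\<lambda>z. z * poly q z)) \<le> e / 2"
      by (rule functional_calculus_dist[OF \<Phi> f C0_spectrum_poly le])
    moreover have "norm (\<Psi> f - \<Psi> (\<lambda>z. z * poly q z)) \<le> e / 2"
      by (rule functional_calculus_dist[OF \<Psi> f C0_spectrum_poly le])
    ultimately show "norm (\<Phi> f - \<Psi> f) \<le> 0 + e"
      using norm_triangle_ineq4[of "\<Phi> f - \<Phi> (\<lambda>z. z * poly q z)" "\<Psi> f - \<Psi> (\<lambda>z. z * poly q z)"]
        functional_calculus_poly[OF \<Phi> \<Psi>, of q] by simp
  qed
  then show ?thesis by simp
qed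

lemma cfc_eq:
  assumes "adj a = a" "f \<in> C0_spectrum a"
  shows "cfc f a = vec (fc (emb a) (\<lambda>t. f (complex_of_real t)))"
  unfolding cfc_def
  using functional_calculus_exists[OF assms(1)] functional_calculus_unique[OF assms(1) _ _ assms(2)]
  by (intro the_equality) blast+

section \<open>Cut-down elements\<close>

lemma emb_cut_down:
  assumes a: "adj a = a" and "0 \<le> \<epsilon>"
  shows "emb (cut_down a \<epsilon>) = rfc (emb a) (\<lambda>t. max (t - \<epsilon>) 0)"
proof -
  let ?f = "\<lambda>z. complex_of_real (max (Re z - \<epsilon>) 0)"
  have "?f \<in> C0_spectrum a"
    using assms by (auto simp: C0_spectrum_def intro!: continuous_intros)
  then have "cut_down a \<epsilon> = vec (rfc (emb a) (\<lambda>t. max (t - \<epsilon>) 0))"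
    unfolding cut_down_def rfc_def by (simp add: cfc_eq[OF a])
  moreover have "scal (rfc (emb a) (\<lambda>t. max (t - \<epsilon>) 0)) = 0"
    using assms by (subst scal_rfc) (auto intro!: continuous_intros)
  ultimately show ?thesis by (simp add: emb_vec)
qed

lemma positive_cut_down:
  assumes "adj a = a" "0 \<le> \<epsilon>"
  shows "positive_element (cut_down a \<epsilon>)"
  unfolding positive_element_iff emb_cut_down[OF assms]
  using assms by (intro pos_rfc continuous_intros) (auto simp: emb_simps)

lemma norm_cut_down:
  assumes a: "positive_element a" and e: "0 \<le> \<epsilon>"
  shows "norm (a - cut_down a \<epsilon>) \<le> \<epsilon>"
proof -
  have P: "pos (emb a)" using a by (simp add: positive_element_iff)
  then have A: "adj (emb a) = emb a" by (rule pos_adj)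
  have a: "adj a = a" using a by (simp add: positive_element_def)
  have "norm (a - cut_down a \<epsilon>) = norm (emb a - emb (cut_down a \<epsilon>))" by (simp add: emb_simps)
  also have "emb a - emb (cut_down a \<epsilon>) = rfc (emb a) (\<lambda>t. t - max (t - \<epsilon>) 0)"
    unfolding emb_cut_down[OF a e]
    by (subst rfc_diff[OF A]) (auto intro!: continuous_intros simp: rfc_id[OF A])
  also have "norm \<dots> \<le> \<epsilon>"
    using e by (intro norm_rfc_le[OF A] continuous_intros) (auto simp: max_def dest!: pos_rspec[OF P])
  finally show ?thesis .
qed

section \<open>Cuntz comparison with sums\<close>

text \<open>What \<open>corner d \<precsim> diag bs\<close> amounts to inside A: the members of
  \<open>xs\<close> form the first row of the conjugating matrix.\<close>

definition cuntz_sum :: "'a::cstar_algebra \<Rightarrow> 'a list \<Rightarrow> bool" where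
  "cuntz_sum d bs \<longleftrightarrow> (\<forall>\<eta>>0. \<exists>xs. length xs = length bs \<and>
     norm (d - sum_list (map2 (\<lambda>x b. x * b * adj x) xs bs)) \<le> \<eta>)"

lemma cuntz_sum_pad:
  assumes "cuntz_sum d bs"
  shows "cuntz_sum d (us @ bs @ vs)"
  unfolding cuntz_sum_def
proof (intro allI impI)
  fix \<eta> :: real assume "0 < \<eta>"
  then obtain xs where xs: "length xs = length bs"
    "norm (d - sum_list (map2 (\<lambda>x b. x * b * adj x) xs bs)) \<le> \<eta>"
    using assms unfolding cuntz_sum_def by blast
  have z: "sum_list (map2 (\<lambda>x b. x * b * adj x) (replicate (length ws) (0::'a)) ws) = 0" for ws
    by (induction ws) simp_all
  show "\<exists>xs. length xs = length (us @ bs @ vs) \<and>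
     norm (d - sum_list (map2 (\<lambda>x b. x * b * adj x) xs (us @ bs @ vs))) \<le> \<eta>"
    using xs z[of us] z[of vs]
    by (intro exI[of _ "replicate (length us) 0 @ xs @ replicate (length vs) 0"]) simp
qed

lemma cuntz_sum_scaleR:
  assumes d: "cuntz_sum d bs" and r: "0 < r"
  shows "cuntz_sum (r *\<^sub>R d) bs"
  unfolding cuntz_sum_def
proof (intro allI impI)
  fix \<eta> :: real assume "0 < \<eta>"
  then have "0 < \<eta> / r" using r by simp
  then obtain xs where xs: "length xs = length bs"
    "norm (d - sum_list (map2 (\<lambda>x b. x * b * adj x) xs bs)) \<le> \<eta> / r"
    using d unfolding cuntz_sum_def by blast
  have s: "sum_list (map2 (\<lambda>x b. x * b * adj x) (map ((*\<^sub>R) (sqrt r)) xs) bs) =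
      r *\<^sub>R sum_list (map2 (\<lambda>x b. x * b * adj x) xs bs)"
    using xs(1) r
    by (induction xs bs rule: list_induct2) (simp_all add: adj_scaleR scaleR_right_distrib)
  have "norm (r *\<^sub>R (d - sum_list (map2 (\<lambda>x b. x * b * adj x) xs bs))) \<le> \<eta>"
    using xs(2) r by (simp only: norm_scaleR) (simp add: field_simps)
  then show "\<exists>xs. length xs = length bs \<and>
     norm (r *\<^sub>R d - sum_list (map2 (\<lambda>x b. x * b * adj x) xs bs)) \<le> \<eta>"
    using xs(1) s by (intro exI[of _ "map ((*\<^sub>R) (sqrt r)) xs"]) (simp add: scaleR_right_diff_distrib)
qed

text \<open>If \<open>0 \<le> d \<le> y\<close>, then \<open>zyz\<^sup>* \<rightarrow> d\<close> for \<open>z = d\<^sup>1\<^sup>/\<^sup>2(y + \<eta>)\<^sup>-\<^sup>1\<^sup>/\<^sup>2\<close>.\<close>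

lemma ex_conj_approx:
  fixes d :: "'a::cstar_algebra"
  assumes D: "pos (emb d)" and YD: "pos (Y - emb d)" and \<eta>: "0 < \<eta>"
  shows "\<exists>z. norm (emb d - emb z * Y * adj (emb z)) \<le> \<eta>"
proof -
  have Y: "pos Y" using pos_add[OF D YD] by simp
  have aD: "adj (emb d) = emb d" and aY: "adj Y = Y" using D Y by (simp_all add: pos_adj)
  have ad: "adj d = d" using aD by (simp add: emb_simps)
  let ?g = "\<lambda>t::real. sqrt (max t 0)"
  let ?h = "\<lambda>t::real. 1 / sqrt (max t 0 + \<eta>)"
  have p: "0 < max t 0 + \<eta>" for t :: real using \<eta> by (intro add_nonneg_pos) auto
  then have p': "max t 0 + \<eta> \<noteq> 0" for t :: real by (metis less_irrefl)
  have cg: "continuous_on UNIV ?g" and ch: "continuous_on UNIV ?h"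
    "continuous_on UNIV (\<lambda>t. t * ?h t)" "continuous_on UNIV (\<lambda>t. ?h t * (t * ?h t))"
    "continuous_on UNIV (\<lambda>t. ?h t * ?h t)"
    using p' by (auto intro!: continuous_intros)
  define s where "s = rfc (emb d) ?g"
  define w where "w = rfc Y ?h"
  have s: "adj s = s" "scal s = 0"
    unfolding s_def using adj_rfc[OF aD cg] scal_rfc[OF ad cg] by simp_all
  have w: "adj w = w" unfolding w_def by (rule adj_rfc[OF aY ch(1)])
  have ss: "s * s = emb d"
  proof -
    have "s * s = rfc (emb d) (\<lambda>t. ?g t * ?g t)" unfolding s_def by (simp only: rfc_mult[OF aD cg cg])
    also have "\<dots> = rfc (emb d) (\<lambda>t. t)"
      by (intro rfc_cong[OF aD] continuous_intros) (simp add: pos_rspec[OF D])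
    finally show ?thesis by (simp add: rfc_id[OF aD])
  qed
  have wYw: "w * (Y * w) = rfc Y (\<lambda>t. ?h t * (t * ?h t))"
    unfolding w_def
    by (subst rfc_mult[OF aY ch(1,2)], subst rfc_mult[OF aY _ ch(1), of "\<lambda>t. t"])
      (simp_all add: rfc_id[OF aY])
  \<comment> \<open>On the spectrum h(t)^2 = 1 / (t + \<eta>), so 1 - t h(t)^2 = \<eta>
    h(t)^2.\<close>
  have ww: "\<eta> *\<^sub>R (w * w) = 1 - w * (Y * w)"
  proof -
    have "1 - w * (Y * w) = rfc Y (\<lambda>t. 1 - ?h t * (t * ?h t))"
      unfolding wYw by (subst rfc_diff[OF aY _ ch(3)]) (simp_all add: rfc_const[OF aY])
    also have "\<dots> = rfc Y (\<lambda>t. \<eta> * (?h t * ?h t))"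
    proof (rule rfc_cong[OF aY])
      fix t assume "t \<in> rspec Y"
      then have "0 \<le> t" by (rule pos_rspec[OF Y])
      then show "1 - ?h t * (t * ?h t) = \<eta> * (?h t * ?h t)" using \<eta> by (simp add: field_simps)
    qed (intro continuous_intros ch)
    also have "\<dots> = \<eta> *\<^sub>R (w * w)"
      unfolding w_def
      by (subst rfc_mult[OF aY _ ch(4)], simp, subst rfc_mult[OF aY ch(1,1)])
        (simp add: rfc_const[OF aY])
    finally show ?thesis by simp
  qed
  have nwYw: "norm (w * (Y * w)) \<le> 1"
    unfolding wYw
  proof (rule norm_rfc_le[OF aY ch(3)])
    fix t assume "t \<in> rspec Y"
    then have "0 \<le> t" by (rule pos_rspec[OF Y])
    then show "\<bar>?h t * (t * ?h t)\<bar> \<le> 1" using \<eta> by (simp add: field_simps)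
  qed
  \<comment> \<open>The final error has norm \<eta> times that of \<open>w * emb d * w\<close>.
    Since d lies below Y, this norm is at most that of \<open>w * Y * w\<close>, hence at most
    1.\<close>
  have "norm (w * emb d * adj w) \<le> norm (w * Y * adj w)"
  proof (rule norm_mono_pos)
    show "pos (w * emb d * adj w)" by (rule pos_conj[OF D])
    have "w * Y * adj w - w * emb d * adj w = w * (Y - emb d) * adj w" by (simp add: algebra_simps)
    then show "pos (w * Y * adj w - w * emb d * adj w)" using pos_conj[OF YD] by simp
  qed
  then have nw: "norm (w * emb d * w) \<le> 1" using nwYw by (simp add: w mult.assoc)
  have "emb d - s * w * Y * adj (s * w) = s * (1 - w * (Y * w)) * s"
    by (simp add: adj_mult s w algebra_simps ss)
  also have "\<dots> = \<eta> *\<^sub>R (adj (w * s) * (w * s))" by (simp add: adj_mult s w mult.assoc flip: ww)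
  finally have "norm (emb d - s * w * Y * adj (s * w)) = \<eta> * (norm (w * s))\<^sup>2"
    using \<eta> by (simp add: cstar_identity)
  also have "(norm (w * s))\<^sup>2 = norm (w * s * adj (w * s))" by (simp add: norm_mult_adj)
  also have "w * s * adj (w * s) = w * emb d * w" by (simp add: adj_mult s w mult.assoc flip: ss)
  also have "\<eta> * norm (w * emb d * w) \<le> \<eta>" using nw \<eta> by simp
  \<comment> \<open>The function defining \<open>s\<close> vanishes at 0, so \<open>s * w\<close>
    comes from A although \<open>w\<close> does not.\<close>
  finally show ?thesis
    using s(2) by (intro exI[of _ "vec (s * w)"]) (simp add: emb_vec del: unitz_sel(10))
qed

text \<open>A may have no unit to conjugate with; \<open>ex_conj_approx\<close> with d = Y = b takes
  its place.\<close>

lemma cuntz_sum_refl: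
  assumes "positive_element b"
  shows "cuntz_sum b [b]"
  unfolding cuntz_sum_def
proof (intro allI impI)
  fix \<eta> :: real assume "0 < \<eta>"
  then obtain z where "norm (emb b - emb z * emb b * adj (emb z)) \<le> \<eta>"
    using ex_conj_approx[of b "emb b" \<eta>] assms by (auto simp: positive_element_iff)
  then show "\<exists>xs. length xs = length [b] \<and>
      norm (b - sum_list (map2 (\<lambda>x b. x * b * adj x) xs [b])) \<le> \<eta>"
    by (intro exI[of _ "[z]"]) (simp add: emb_simps)
qed

section \<open>Generated ideals and the estimate of cut-downs\<close>

lemma closed_ideal_closure:
  fixes T :: "'a::cstar_algebra set"
  assumes "0 \<in> T" "\<And>x y. x \<in> T \<Longrightarrow> y \<in> T \<Longrightarrow> x + y \<in> T" "\<And>c x. x \<in> T \<Longrightarrow> c *\<^sub>C x \<in> T"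
    "\<And>a x. x \<in> T \<Longrightarrow> a * x \<in> T" "\<And>a x. x \<in> T \<Longrightarrow> x * a \<in> T"
  shows "closed_ideal (closure T)"
proof -
  have image: "f x \<in> closure T" if f: "bounded_linear f" "\<And>x. x \<in> T \<Longrightarrow> f x \<in> T" and x: "x \<in> closure T"
    for f and x :: 'a
  proof -
    have "continuous_on (closure T) f" using f(1) by (rule linear_continuous_on)
    then have "f ` closure T \<subseteq> closure T"
      using f(2) closure_subset[of T] by (intro image_closure_subset) auto
    then show ?thesis using x by blast
  qed
  have scale: "bounded_linear (\<lambda>x::'a. c *\<^sub>C x)" for c
    by (rule bounded_linear_intro[where K = "cmod c"])
      (simp_all add: scaleC_add_right Defs.scaleR_scaleC scaleC_scaleC mult.commute norm_scaleC)
  have sum: "x + y \<in> closure T" if xy: "x \<in> closure T" "y \<in> closure T" for x y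
  proof -
    obtain X Y where X: "\<And>n. X n \<in> T" "X \<longlonglongrightarrow> x" and Y: "\<And>n. Y n \<in> T" "Y \<longlonglongrightarrow> y"
      using xy unfolding closure_sequential by blast
    have "(\<lambda>n. X n + Y n) \<longlonglongrightarrow> x + y" by (intro tendsto_add X Y)
    then show ?thesis
      unfolding closure_sequential
      using X(1) Y(1) assms(2) by (intro exI[of _ "\<lambda>n. X n + Y n"]) blast
  qed
  show ?thesis
    unfolding closed_ideal_def
  proof (intro conjI ballI allI)
    show "0 \<in> closure T" using assms(1) closure_subset by blast
    show "x + y \<in> closure T" if "x \<in> closure T" "y \<in> closure T" for x y using sum that .
    show "c *\<^sub>C x \<in> closure T" if "x \<in> closure T" for c x
      by (rule image[OF scale assms(3) that])
    show "a * x \<in> closure T" if "x \<in> closure T" for a x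
      by (rule image[OF bounded_linear_mult_right assms(4) that])
    show "x * a \<in> closure T" if "x \<in> closure T" for a x
      by (rule image[OF bounded_linear_mult_left assms(5) that])
  qed simp
qed

text \<open>With x and y in the unitization, b itself is the sum 1 b 1 and complex multiples are
  absorbed into x. The elements of A that are such finite sums have a closed ideal as
  closure.\<close>

lemma closed_ideal_hull_approx:
  fixes S :: "'a::cstar_algebra set"
  assumes a: "a \<in> closed_ideal hull S" and e: "0 < e"
  shows "\<exists>L. (\<forall>(x, b, y)\<in>set L. b \<in> S) \<and>
    norm (emb a - sum_list (map (\<lambda>(x, b, y). x * emb b * y) L)) < e"
proof -
  let ?s = "\<lambda>L. sum_list (map (\<lambda>(x, b, y). x * emb b * y) L)"
  define T where "T = {t. \<exists>L. (\<forall>(x, b, y)\<in>set L. b \<in> S) \<and> emb t = ?s L}"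
  have TI: "t \<in> T" if "emb t = ?s L" "\<forall>(x, b, y)\<in>set L. b \<in> S" for t L
    using that by (auto simp: T_def)
  have "closed_ideal (closure T)"
  proof (rule closed_ideal_closure)
    show "0 \<in> T" by (rule TI[of _ "[]"]) (simp_all add: emb_simps)
  next
    fix x y assume "x \<in> T" "y \<in> T"
    then obtain L M where L: "\<forall>(x, b, y)\<in>set L. b \<in> S" "emb x = ?s L"
      and M: "\<forall>(x, b, y)\<in>set M. b \<in> S" "emb y = ?s M" unfolding T_def by blast
    show "x + y \<in> T"
      by (rule TI[of _ "L @ M"]) (use L M in \<open>auto simp: emb_simps(1)[symmetric]\<close>)
  next
    fix x assume "x \<in> T"
    then obtain L where L: "\<forall>(x, b, y)\<in>set L. b \<in> S" "emb x = ?s L" unfolding T_def by blast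
    have l: "?s (map (\<lambda>(x, b, y). (u * x, b, y)) L) = u * ?s L" for u
      by (induction L) (auto simp: algebra_simps)
    have r: "?s (map (\<lambda>(x, b, y). (x, b, y * u)) L) = ?s L * u" for u
      by (induction L) (auto simp: algebra_simps)
    show "c *\<^sub>C x \<in> T" for c
      by (rule TI[of _ "map (\<lambda>(x, b, y). ((c *\<^sub>C 1) * x, b, y)) L"], unfold l)
        (use L in \<open>auto simp: emb_simps(6)[symmetric] mult_scaleC_left\<close>)
    show "a * x \<in> T" for a
      by (rule TI[of _ "map (\<lambda>(x, b, y). (emb a * x, b, y)) L"], unfold l)
        (use L in \<open>auto simp: emb_simps(4)[symmetric]\<close>)
    show "x * a \<in> T" for a
      by (rule TI[of _ "map (\<lambda>(x, b, y). (x, b, y * emb a)) L"], unfold r)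
        (use L in \<open>auto simp: emb_simps(4)[symmetric]\<close>)
  qed
  moreover have "S \<subseteq> closure T"
  proof
    fix b assume "b \<in> S"
    then have "b \<in> T" by (intro TI[of _ "[(1, b, 1)]"]) simp_all
    then show "b \<in> closure T" using closure_subset by blast
  qed
  ultimately have "closed_ideal hull S \<subseteq> closure T" by (intro hull_minimal)
  then have "a \<in> closure T" using a by blast
  then obtain t where t: "t \<in> T" "dist t a < e" using e by (metis closure_approachable)
  obtain L where L: "\<forall>(x, b, y)\<in>set L. b \<in> S" "emb t = ?s L" using t(1) unfolding T_def by blast
  have "norm (emb a - ?s L) < e"
    using t(2) unfolding L(2)[symmetric] by (simp add: emb_simps dist_norm norm_minus_commute)
  then show ?thesis using L(1) by blast
qed

text \<open>The \<open>xs\<close> lie only in the unitization; a left factor \<open>w\<close> with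
  zero scalar part brings the conjugators back into A.\<close>

lemma emb_sum_list_conj:
  assumes "length xs = length bs" "scal w = 0"
  shows "emb (sum_list (map2 (\<lambda>x b. x * b * adj x) (map (\<lambda>x. vec (w * x)) xs) bs)) =
    w * sum_list (map2 (\<lambda>x b. x * emb b * adj x) xs bs) * adj w"
  using assms(1)
proof (induction xs bs rule: list_induct2)
  case (Cons x xs b bs)
  have "emb (vec (w * x) * b * adj (vec (w * x))) = emb (vec (w * x)) * emb b * adj (emb (vec (w * x)))"
    by (simp only: emb_simps)
  also have "emb (vec (w * x)) = w * x" by (rule emb_vec) (simp add: assms(2))
  finally have "emb (vec (w * x) * b * adj (vec (w * x))) = w * (x * emb b * adj x) * adj w"
    by (simp add: adj_mult mult.assoc)
  then show ?case using Cons.IH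
    by (simp add: distrib_left distrib_right flip: emb_simps(1) del: unitz_sel)
qed (simp flip: emb_simps(8))

text \<open>
  Symmetrizing \<open>a \<approx> \<Sum> xby\<close> with \<open>xby + (xby)\<^sup>* \<le> xbx\<^sup>* + y\<^sup>*by\<close> bounds \<open>a - \<epsilon>/2\<close> by a sum
  \<open>c = 1/2 \<Sum> (xbx\<^sup>* + y\<^sup>*by)\<close>.  Then \<open>(a - \<epsilon>)\<^sub>+ = e(a - \<epsilon>/2)e \<le> ece\<close> for a suitable function \<open>e\<close>
  of \<open>a\<close>.
\<close>

lemma ex_cuntz_sum_cut_down:
  fixes S :: "'a::cstar_algebra set"
  assumes S: "\<And>b. b \<in> S \<Longrightarrow> positive_element b" and aS: "a \<in> closed_ideal hull S"
    and a: "positive_element a" and \<epsilon>: "0 < \<epsilon>"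
  shows "\<exists>bs. set bs \<subseteq> S \<and> cuntz_sum (cut_down a \<epsilon>) bs"
proof -
  define A where "A = emb a"
  have P: "pos A" using a by (simp add: positive_element_iff A_def)
  have A: "adj A = A" by (rule pos_adj[OF P])
  have aa: "adj a = a" using a by (simp add: positive_element_def)
  obtain L where L: "\<forall>(x, b, y)\<in>set L. b \<in> S"
    and "norm (emb a - sum_list (map (\<lambda>(x, b, y). x * emb b * y) L)) < \<epsilon> / 2"
    using closed_ideal_hull_approx[OF aS, of "\<epsilon> / 2"] \<epsilon> by auto
  define s where "s = sum_list (map (\<lambda>(x, b, y). x * emb b * y) L)"
  have s: "norm (A - s) \<le> \<epsilon> / 2" using \<open>norm _ < _\<close> by (simp add: A_def s_def)
  \<comment> \<open>Each b occurs twice: it is conjugated once by x and once by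
    \<open>adj y\<close>.\<close>
  define bs where "bs = map (\<lambda>(x, b, y). b) L @ map (\<lambda>(x, b, y). b) L"
  define xs where "xs = map (\<lambda>(x, b, y). x) L @ map (\<lambda>(x, b, y). adj y) L"
  have len: "length xs = length bs" by (simp add: xs_def bs_def)
  have bs: "set bs \<subseteq> S" using L by (auto simp: bs_def)
  define c where "c = sum_list (map2 (\<lambda>x b. x * emb b * adj x) xs bs)"
  have c: "c = sum_list (map (\<lambda>(x, b, y). x * emb b * adj x) L)
      + sum_list (map (\<lambda>(x, b, y). adj y * emb b * y) L)"
    unfolding c_def xs_def bs_def
    by (simp add: zip_map_map zip_same_conv_map comp_def case_prod_unfold)
  have sa: "emb b = adj (emb b)" if "b \<in> S" for b
    using S[OF that] by (simp add: positive_element_iff pos_adj)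
  have cs: "c - (s + adj s) = sum_list (map (\<lambda>(x, b, y). (x - adj y) * emb b * adj (x - adj y)) L)"
    unfolding c s_def using L
  proof (induction L)
    case (Cons q L)
    obtain x b y where q: "q = (x, b, y)" by (cases q)
    have "b \<in> S" using Cons.prems q by auto
    then have "adj (x * emb b * y) = adj y * emb b * adj x"
      using sa[of b] by (simp add: adj_mult mult.assoc)
    then have "x * emb b * adj x + adj y * emb b * y - (x * emb b * y + adj (x * emb b * y))
        = (x - adj y) * emb b * adj (x - adj y)"
      by (simp add: adj_diff algebra_simps)
    then show ?case using Cons by (simp add: q adj_add algebra_simps)
  qed simp
  have "pos (c - (s + adj s))"
    unfolding cs using L S
    by (intro pos_sum_list) (fastforce intro!: pos_conj simp: positive_element_iff)
  then have p1: "pos ((1 / 2) *\<^sub>R (c - (s + adj s)))" by (rule pos_scaleR) simp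
  \<comment> \<open>\<open>A\<close> is self-adjoint, so replacing \<open>s\<close> by its real part
    keeps the error within \<epsilon>/2.\<close>
  have "norm ((1 / 2) *\<^sub>R ((A - s) + adj (A - s))) \<le> \<epsilon> / 2"
    using norm_triangle_ineq[of "A - s" "adj (A - s)"] s by simp
  then have p2: "pos ((\<epsilon> / 2) *\<^sub>R 1 - (1 / 2) *\<^sub>R ((A - s) + adj (A - s)))"
    by (intro pos_norm_minus) (simp_all add: adj_scaleR adj_add add.commute)
  have half: "(1 / 2) *\<^sub>R (A + A) = A" by (simp flip: scaleR_2)
  have "(\<epsilon> / 2) *\<^sub>R 1 - (1 / 2) *\<^sub>R ((A - s) + adj (A - s)) + (1 / 2) *\<^sub>R (c - (s + adj s))
      = (1 / 2) *\<^sub>R c - ((1 / 2) *\<^sub>R (A + A) - (\<epsilon> / 2) *\<^sub>R 1)"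
    by (simp add: A adj_diff algebra_simps)
  then have p: "pos ((1 / 2) *\<^sub>R c - (A - (\<epsilon> / 2) *\<^sub>R 1))"
    using pos_add[OF p2 p1] by (simp only: half)
  \<comment> \<open>Chosen so that (t - \<epsilon>/2) h(t)^2 = max (t - \<epsilon>) 0. The maximum
    in the denominator keeps it away from 0 and changes nothing for t \<ge> \<epsilon>.\<close>
  let ?h = "\<lambda>t. sqrt (max (t - \<epsilon>) 0 / max (t - \<epsilon> / 2) (\<epsilon> / 2))"
  have q: "max (t - \<epsilon> / 2) (\<epsilon> / 2) \<noteq> 0" for t using \<epsilon> by (auto simp: max_def)
  have ch: "continuous_on UNIV ?h" "continuous_on UNIV (\<lambda>t. (t - \<epsilon> / 2) * ?h t)"
    "continuous_on UNIV (\<lambda>t. ?h t * ((t - \<epsilon> / 2) * ?h t))" "continuous_on UNIV (\<lambda>t. t - \<epsilon> / 2)"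
    using q by (auto intro!: continuous_intros)
  define e where "e = rfc A ?h"
  have e: "adj e = e" unfolding e_def by (rule adj_rfc[OF A ch(1)])
  have "A - (\<epsilon> / 2) *\<^sub>R 1 = rfc A (\<lambda>t. t - \<epsilon> / 2)"
    by (subst rfc_diff[OF A]) (simp_all add: rfc_id[OF A] rfc_const[OF A])
  then have "e * ((A - (\<epsilon> / 2) *\<^sub>R 1) * e) = rfc A (\<lambda>t. ?h t * ((t - \<epsilon> / 2) * ?h t))"
    unfolding e_def by (simp only: rfc_mult[OF A ch(1,2)] rfc_mult[OF A ch(4,1)])
  also have "\<dots> = rfc A (\<lambda>t. max (t - \<epsilon>) 0)"
  proof (rule rfc_cong[OF A ch(3)])
    fix t
    have "?h t * ((t - \<epsilon> / 2) * ?h t) = (t - \<epsilon> / 2) * (?h t * ?h t)" by (simp only: mult_ac)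
    also have "?h t * ?h t = max (t - \<epsilon>) 0 / max (t - \<epsilon> / 2) (\<epsilon> / 2)"
    proof -
      have "0 \<le> max (t - \<epsilon>) 0 / max (t - \<epsilon> / 2) (\<epsilon> / 2)"
        using \<epsilon> by (intro divide_nonneg_nonneg) auto
      then show ?thesis by (simp only: real_sqrt_mult_self abs_of_nonneg)
    qed
    also have "(t - \<epsilon> / 2) * \<dots> = max (t - \<epsilon>) 0"
    proof (cases "t \<le> \<epsilon>")
      case False
      then have "max (t - \<epsilon> / 2) (\<epsilon> / 2) = t - \<epsilon> / 2" "t - \<epsilon> / 2 \<noteq> 0" using \<epsilon> by auto
      then show ?thesis by simp
    qed simp
    finally show "?h t * ((t - \<epsilon> / 2) * ?h t) = max (t - \<epsilon>) 0" .
  qed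
  also have "\<dots> = emb (cut_down a \<epsilon>)" unfolding A_def using emb_cut_down[OF aa] \<epsilon> by simp
  finally have D: "e * (A - (\<epsilon> / 2) *\<^sub>R 1) * adj e = emb (cut_down a \<epsilon>)" by (simp add: e mult.assoc)
  have "e * ((1 / 2) *\<^sub>R c - (A - (\<epsilon> / 2) *\<^sub>R 1)) * adj e = e * ((1 / 2) *\<^sub>R c) * adj e - emb (cut_down a \<epsilon>)"
    unfolding D[symmetric] by (simp only: right_diff_distrib left_diff_distrib)
  then have YD: "pos (e * ((1 / 2) *\<^sub>R c) * adj e - emb (cut_down a \<epsilon>))" using pos_conj[OF p, of e] by simp
  have Dpos: "pos (emb (cut_down a \<epsilon>))"
    using positive_cut_down[OF aa] \<epsilon> by (simp add: positive_element_iff)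
  have "cuntz_sum (cut_down a \<epsilon>) bs"
    unfolding cuntz_sum_def
  proof (intro allI impI)
    fix \<eta> :: real assume "0 < \<eta>"
    then obtain z where z: "norm (emb (cut_down a \<epsilon>) - emb z * (e * ((1 / 2) *\<^sub>R c) * adj e) * adj (emb z)) \<le> \<eta>"
      using ex_conj_approx[OF Dpos YD] by blast
    \<comment> \<open>The factor 1/2 before \<open>c\<close> enters as a square root, and
      \<open>emb z\<close> makes the scalar part vanish.\<close>
    define w where "w = sqrt (1 / 2) *\<^sub>R (emb z * e)"
    have sw: "scal w = 0" by (simp add: w_def scaleR_scaleC)
    have "w * c * adj w = (sqrt (1 / 2) * sqrt (1 / 2)) *\<^sub>R (emb z * e * c * (adj e * adj (emb z)))"
      by (simp only: w_def adj_scaleR adj_mult mult_scaleR_left mult_scaleR_right scaleR_scaleR)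
    also have "\<dots> = emb z * (e * ((1 / 2) *\<^sub>R c) * adj e) * adj (emb z)"
      by (simp only: real_sqrt_mult_self) (simp add: mult.assoc)
    finally have wc: "w * c * adj w = emb z * (e * ((1 / 2) *\<^sub>R c) * adj e) * adj (emb z)" .
    have "norm (cut_down a \<epsilon> - sum_list (map2 (\<lambda>x b. x * b * adj x) (map (\<lambda>x. vec (w * x)) xs) bs)) \<le> \<eta>"
      by (subst norm_emb[symmetric], subst emb_simps(2)[symmetric],
          subst emb_sum_list_conj[OF len sw], fold c_def, unfold wc, rule z)
    then show "\<exists>xs. length xs = length bs \<and>
        norm (cut_down a \<epsilon> - sum_list (map2 (\<lambda>x b. x * b * adj x) xs bs)) \<le> \<eta>"
      using len by (intro exI[of _ "map (\<lambda>x. vec (w * x)) xs"]) simp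
  qed
  then show ?thesis using bs by blast
qed

section \<open>Cuntz comparison of diagonal matrices\<close>

lemma emb_sum: "emb (sum f S) = (\<Sum>i\<in>S. emb (f i))"
  by (induction S rule: infinite_finite_induct) (simp_all add: emb_simps(8) flip: emb_simps(1))

text \<open>One summand \<open>adj (\<xi> k) * \<xi> k\<close> lies below the whole positive sum,
  and the norm is monotone on positive elements.\<close>

lemma norm_le_column_norm:
  fixes \<xi> :: "nat \<Rightarrow> 'a::cstar_algebra"
  assumes fin: "finite {i. \<xi> i \<noteq> 0}"
  shows "norm (\<xi> k) \<le> column_norm \<xi>"
proof (cases "\<xi> k = 0")
  case True
  then show ?thesis by (simp add: column_norm_def)
next
  case False
  let ?f = "\<lambda>i. adj (\<xi> i) * \<xi> i" and ?S = "{i. \<xi> i \<noteq> 0}"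
  have P: "pos (emb (?f i))" for i
    using pos_adj_mult[of "emb (\<xi> i)"] by (simp add: emb_simps)
  have "emb (sum ?f ?S) - emb (?f k) = (\<Sum>i\<in>?S - {k}. emb (?f i))"
    using False fin by (simp add: sum.remove[of ?S k] emb_simps(2) flip: emb_sum)
  then have "norm (emb (?f k)) \<le> norm (emb (sum ?f ?S))"
    by (intro norm_mono_pos P) (auto intro: pos_sum P)
  then have "(norm (\<xi> k))\<^sup>2 \<le> norm (sum ?f ?S)" by (simp add: cstar_identity)
  then show ?thesis by (simp add: column_norm_def real_le_rsqrt)
qed

lemma column_norm_le:
  assumes fin: "finite F" and F: "\<And>i. i \<notin> F \<Longrightarrow> \<xi> i = 0"
  shows "column_norm \<xi> \<le> (\<Sum>i\<in>F. norm (\<xi> i))"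
proof -
  have "norm (\<Sum>i | \<xi> i \<noteq> 0. adj (\<xi> i) * \<xi> i) \<le> (\<Sum>i | \<xi> i \<noteq> 0. (norm (\<xi> i))\<^sup>2)"
    unfolding cstar_identity[symmetric] by (rule norm_sum)
  also have "\<dots> \<le> (\<Sum>i\<in>F. (norm (\<xi> i))\<^sup>2)"
    using F by (intro sum_mono2 fin) auto
  finally have "column_norm \<xi> \<le> L2_set (\<lambda>i. norm (\<xi> i)) F"
    by (simp add: column_norm_def L2_set_def)
  also have "\<dots> \<le> (\<Sum>i\<in>F. norm (\<xi> i))" by (rule L2_set_le_sum) simp
  finally show ?thesis .
qed

lemma apply_column_eq:
  "x \<in> mats n \<Longrightarrow> apply_column x \<xi> i = (\<Sum>k<n. entry x i k * \<xi> k)"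
  by (simp add: apply_column_def sum_row_eq)

lemma column_norm_apply_le:
  assumes x: "x \<in> mats n" and fin: "finite {i. \<xi> i \<noteq> 0}" and \<xi>: "column_norm \<xi> \<le> 1"
  shows "column_norm (apply_column x \<xi>) \<le> (\<Sum>i<n. \<Sum>k<n. norm (entry x i k))"
proof -
  have le1: "norm (\<xi> k) \<le> 1" for k using norm_le_column_norm[OF fin, of k] \<xi> by simp
  have "column_norm (apply_column x \<xi>) \<le> (\<Sum>i<n. norm (apply_column x \<xi> i))"
  proof (rule column_norm_le)
    fix i assume "i \<notin> {..<n}"
    then have "entry x i k = 0" for k using x by (simp add: mats_def)
    then show "apply_column x \<xi> i = 0" by (simp add: apply_column_eq[OF x])
  qed simp
  also have "\<dots> \<le> (\<Sum>i<n. \<Sum>k<n. norm (entry x i k))"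
  proof (rule sum_mono)
    fix i
    have "norm (apply_column x \<xi> i) \<le> (\<Sum>k<n. norm (entry x i k * \<xi> k))"
      unfolding apply_column_eq[OF x] by (rule norm_sum)
    also have "\<dots> \<le> (\<Sum>k<n. norm (entry x i k))"
    proof (rule sum_mono)
      fix k
      have "norm (entry x i k * \<xi> k) \<le> norm (entry x i k) * norm (\<xi> k)" by (rule norm_mult_ineq)
      also have "\<dots> \<le> norm (entry x i k)" using le1[of k] by (simp add: mult_left_le)
      finally show "norm (entry x i k * \<xi> k) \<le> norm (entry x i k)" .
    qed
    finally show "norm (apply_column x \<xi> i) \<le> (\<Sum>k<n. norm (entry x i k))" .
  qed
  finally show ?thesis .
qed

text \<open>For matrices of a fixed size, this crude bound and
  \<open>norm_entry_le_matrix_norm\<close> together identify convergence in the matrix norm with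
  entrywise convergence.\<close>

lemma matrix_norm_le:
  fixes x :: "'a::cstar_algebra minf"
  assumes "x \<in> mats n"
  shows "matrix_norm x \<le> (\<Sum>i<n. \<Sum>k<n. norm (entry x i k))"
  unfolding matrix_norm_def
proof (rule cSUP_least)
  have "(\<lambda>_. 0) \<in> {\<xi>::nat \<Rightarrow> 'a. finite {i. \<xi> i \<noteq> 0} \<and> column_norm \<xi> \<le> 1}"
    by (simp add: column_norm_def)
  then show "{\<xi>::nat \<Rightarrow> 'a. finite {i. \<xi> i \<noteq> 0} \<and> column_norm \<xi> \<le> 1} \<noteq> {}"
    unfolding ex_in_conv[symmetric] by (intro exI[of _ "\<lambda>_. 0"])
next
  fix \<xi> :: "nat \<Rightarrow> 'a" assume "\<xi> \<in> {\<xi>. finite {i. \<xi> i \<noteq> 0} \<and> column_norm \<xi> \<le> 1}"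
  then show "column_norm (apply_column x \<xi>) \<le> (\<Sum>i<n. \<Sum>k<n. norm (entry x i k))"
    using column_norm_apply_le[OF assms, of \<xi>] by simp
qed

lemma norm_entry_le_matrix_norm:
  fixes x :: "'a::cstar_algebra minf"
  shows "norm (entry x i j) \<le> matrix_norm x"
proof -
  obtain n where n: "x \<in> mats n" using ex_M by blast
  \<comment> \<open>The normalized adjoint, placed in position j, extracts the norm of the entry. A
    zero entry gives the zero column, because \<open>1 / 0 = 0\<close>.\<close>
  let ?u = "(1 / norm (entry x i j)) *\<^sub>R adj (entry x i j)"
  define \<xi> where "\<xi> k = (if k = j then ?u else 0)" for k
  have fin: "finite {k. \<xi> k \<noteq> 0}"
    by (rule finite_subset[of _ "{j}"]) (auto simp: \<xi>_def)
  have "column_norm \<xi> \<le> (\<Sum>i\<in>{j}. norm (\<xi> i))" by (rule column_norm_le) (auto simp: \<xi>_def)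
  also have "\<dots> \<le> 1" by (simp add: \<xi>_def)
  finally have le1: "column_norm \<xi> \<le> 1" .
  have "norm (entry x i j) = norm (entry x i j * ?u)"
    by (simp add: norm_mult_adj power2_eq_square)
  also have "entry x i j * ?u = apply_column x \<xi> i"
  proof (cases "j < n")
    case True
    then show ?thesis
      by (simp add: apply_column_eq[OF n] \<xi>_def if_distrib[of "\<lambda>t. _ * t"] sum.delta cong: if_cong)
  next
    case False
    then have z: "entry x i j = 0" using n by (simp add: mats_def)
    then have "\<xi> = (\<lambda>_. 0)" by (simp add: \<xi>_def fun_eq_iff)
    then show ?thesis using z by (simp add: apply_column_eq[OF n])
  qed
  also have "norm \<dots> \<le> column_norm (apply_column x \<xi>)"
  proof (rule norm_le_column_norm)
    have "apply_column x \<xi> i = 0" if "n \<le> i" for i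
      using n that unfolding apply_column_eq[OF n] by (simp add: mats_def)
    then have "{i. apply_column x \<xi> i \<noteq> 0} \<subseteq> {..<n}" using leI by blast
    then show "finite {i. apply_column x \<xi> i \<noteq> 0}" by (rule finite_subset) simp
  qed
  also have "\<dots> \<le> matrix_norm x"
    unfolding matrix_norm_def
  proof (rule cSUP_upper)
    show "bdd_above ((\<lambda>\<xi>. column_norm (apply_column x \<xi>)) ` {\<xi>. finite {i. \<xi> i \<noteq> 0} \<and> column_norm \<xi> \<le> 1})"
    proof (rule bdd_aboveI2)
      fix \<xi> :: "nat \<Rightarrow> 'a" assume "\<xi> \<in> {\<xi>. finite {i. \<xi> i \<noteq> 0} \<and> column_norm \<xi> \<le> 1}"
      then show "column_norm (apply_column x \<xi>) \<le> (\<Sum>i<n. \<Sum>k<n. norm (entry x i k))"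
        using column_norm_apply_le[OF n, of \<xi>] by simp
    qed
  qed (use fin le1 in simp)
  finally show ?thesis .
qed

section \<open>Ideals and matrix entries\<close>

lemma closed_idealD:
  assumes "closed_ideal I"
  shows "closed I" "0 \<in> I" "x \<in> I \<Longrightarrow> y \<in> I \<Longrightarrow> x + y \<in> I" "x \<in> I \<Longrightarrow> c *\<^sub>C x \<in> I"
    "x \<in> I \<Longrightarrow> a * x \<in> I" "x \<in> I \<Longrightarrow> x * a \<in> I"
  using assms by (auto simp: closed_ideal_def)

lemma closed_ideal_sum: "closed_ideal I \<Longrightarrow> (\<And>i. i \<in> S \<Longrightarrow> f i \<in> I) \<Longrightarrow> sum f S \<in> I"
  by (induction S rule: infinite_finite_induct) (auto intro: closed_idealD)

lemma closed_ideal_hull: "closed_ideal (closed_ideal hull S)"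
proof (rule hull_in)
  fix T :: "'a set set" assume "Ball T closed_ideal"
  then have "closed_ideal I" if "I \<in> T" for I using that by blast
  note I = closed_idealD[OF this]
  show "closed_ideal (\<Inter> T)"
    unfolding closed_ideal_def
  proof (intro conjI ballI allI InterI)
    show "closed (\<Inter> T)" using I(1) by (intro closed_Inter) blast
  next
    fix I x y assume T: "I \<in> T" and "x \<in> \<Inter> T"
    then have x: "x \<in> I" by blast
    show "c *\<^sub>C x \<in> I" "a * x \<in> I" "x * a \<in> I" for c a using I(4-6)[OF T] x by blast+
    show "x + y \<in> I" if "y \<in> \<Inter> T" using I(3)[OF T x] T that by blast
  qed (use I(2) in blast)
qed

lemma closed_approach:
  fixes x :: "'a::real_normed_vector"
  assumes "closed I" "\<And>e. 0 < e \<Longrightarrow> \<exists>y\<in>I. norm (x - y) \<le> e"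
  shows "x \<in> I"
proof -
  have "\<exists>y\<in>I. dist y x < e" if "0 < e" for e
  proof -
    obtain y where "y \<in> I" "norm (x - y) \<le> e / 2" using assms(2)[of "e / 2"] \<open>0 < e\<close> by auto
    then show ?thesis using \<open>0 < e\<close> by (intro bexI[of _ y]) (simp_all add: dist_norm norm_minus_commute)
  qed
  then have "x \<in> closure I" by (simp add: closure_approachable)
  then show ?thesis using assms(1) by simp
qed

lemma entry_minus: "entry (x - y) i j = entry x i j - entry (y :: 'a::star_algebra minf) i j"
  by (simp only: minus_minf_def plus_minf.rep_eq uminus_minf.rep_eq) simp

text \<open>Entries of the conjugates of y are finite sums of two-sided multiples of entries of y;
  they converge entrywise and I is closed.\<close>

lemma closed_ideal_entries:
  assumes I: "closed_ideal I" and xy: "x \<precsim> y" and y: "\<And>i j. entry y i j \<in> I"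
  shows "entry x i j \<in> I"
proof -
  obtain n X where n: "x \<in> mats n" "y \<in> mats n" and X: "\<And>k. X k \<in> mats n"
    and lim: "(\<lambda>k. matrix_norm (X k * y * adj (X k) - x)) \<longlonglongrightarrow> 0"
    using xy unfolding cuntz_below_def by blast
  have mem: "entry (X k * y * adj (X k)) i j \<in> I" for k
  proof -
    have "entry (X k * y) i l \<in> I" for l
      unfolding entry_times[OF X] by (intro closed_ideal_sum[OF I] closed_idealD(5)[OF I] y)
    then show ?thesis
      unfolding entry_times[OF times_in_M[OF X n(2)]]
      by (intro closed_ideal_sum[OF I] closed_idealD(6)[OF I])
  qed
  show ?thesis
  proof (rule closed_approach[OF closed_idealD(1)[OF I]])
    fix e :: real assume "0 < e"
    then obtain N where "\<forall>k\<ge>N. norm (matrix_norm (X k * y * adj (X k) - x) - 0) < e"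
      using LIMSEQ_D[OF lim, of e] by auto
    then obtain k where "norm (matrix_norm (X k * y * adj (X k) - x) - 0) < e" by blast
    then have "\<bar>matrix_norm (X k * y * adj (X k) - x)\<bar> < e" by simp
    then have "norm (entry (X k * y * adj (X k) - x) i j) \<le> e"
      using norm_entry_le_matrix_norm[of "X k * y * adj (X k) - x" i j] by linarith
    moreover have "entry (X k * y * adj (X k) - x) i j = entry (X k * y * adj (X k)) i j - entry x i j"
      by (simp add: entry_minus)
    ultimately have "norm (entry x i j - entry (X k * y * adj (X k)) i j) \<le> e"
      by (metis norm_minus_commute)
    then show "\<exists>y\<in>I. norm (entry x i j - y) \<le> e" using mem[of k] by (rule bexI)
  qed
qed

section \<open>Block comparison of diagonal matrices\<close>

lemma ex_minf:
  obtains x :: "'a::zero minf" where "x \<in> mats n" "\<And>i j. i < n \<Longrightarrow> j < n \<Longrightarrow> entry x i j = f i j"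
proof
  let ?g = "\<lambda>i j. if i < n \<and> j < n then f i j else 0"
  have e: "entry (Abs_minf ?g) = ?g" by (rule Abs_minf_inverse) (auto intro!: exI[of _ n])
  show "Abs_minf ?g \<in> mats n" by (simp add: mats_def e)
  show "\<And>i j. i < n \<Longrightarrow> j < n \<Longrightarrow> entry (Abs_minf ?g) i j = f i j" by (simp add: e)
qed

lemma diag_in_mats: "length ds \<le> n \<Longrightarrow> diag ds \<in> mats n"
  by (simp add: mats_def diag.rep_eq)

lemma adj_in_mats: "x \<in> mats n \<Longrightarrow> adj (x :: 'a::star_algebra minf) \<in> mats n"
  by (simp add: mats_def adj_minf.rep_eq)

lemma minus_in_mats: "x \<in> mats n \<Longrightarrow> y \<in> mats n \<Longrightarrow> x - (y :: 'a::star_algebra minf) \<in> mats n"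
  by (simp add: mats_def entry_minus)

text \<open>Row \<open>i\<close> of the conjugating matrices is supported on the \<open>i\<close>-th block of \<open>m\<close> columns.\<close>

lemma diag_below_diag:
  fixes ds bs :: "'a::cstar_algebra list"
  assumes len: "length bs = length ds * m" and m: "1 \<le> m"
    and ds: "\<And>i. i < length ds \<Longrightarrow> cuntz_sum (ds ! i) (take m (drop (i * m) bs))"
  shows "diag ds \<precsim> diag bs"
proof -
  let ?r = "length ds" and ?n = "length bs"
  \<comment> \<open>All matrices are taken of size \<open>?n\<close>, which holds
    \<open>diag ds\<close> because m is at least 1.\<close>
  have rn: "?r \<le> ?n" using len m by simp
  have im: "i * m + t < ?n" if "i < ?r" "t < m" for i t
  proof -
    have "Suc i * m \<le> ?r * m" using that by (intro mult_right_mono) auto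
    then show ?thesis using len that by simp
  qed
  have len_block: "length (take m (drop (i * m) bs)) = m" if "i < ?r" for i
    using im[OF that, of "m - 1"] m by simp
  let ?E = "\<lambda>i xs. ds ! i - (\<Sum>t<m. xs ! t * bs ! (i * m + t) * adj (xs ! t))"
  have "\<exists>xs. i < ?r \<longrightarrow> norm (?E i xs) \<le> inverse (real (Suc k))" for i k
  proof (cases "i < ?r")
    case True
    obtain xs where xs: "length xs = m"
      "norm (ds ! i - sum_list (map2 (\<lambda>x b. x * b * adj x) xs (take m (drop (i * m) bs)))) \<le> inverse (real (Suc k))"
      using ds[OF True, unfolded cuntz_sum_def, rule_format, of "inverse (real (Suc k))"]
      unfolding len_block[OF True] by auto
    have "sum_list (map2 (\<lambda>x b. x * b * adj x) xs (take m (drop (i * m) bs)))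
        = (\<Sum>t<m. xs ! t * bs ! (i * m + t) * adj (xs ! t))"
      using im[OF True] xs(1) len_block[OF True]
      by (simp add: sum_list_sum_nth atLeast0LessThan)
    then show ?thesis using xs(2) by auto
  qed simp
  then obtain xs where xs: "\<And>i k. i < ?r \<Longrightarrow> norm (?E i (xs i k)) \<le> inverse (real (Suc k))" by metis
  have "\<exists>x. x \<in> mats ?n \<and> (\<forall>i<?n. \<forall>l<?n. entry x i l = (if l div m = i then xs i k ! (l mod m) else 0))" for k
    by (rule ex_minf[of ?n "\<lambda>i l. if l div m = i then xs i k ! (l mod m) else 0"]) blast
  then obtain X where X: "\<And>k. X k \<in> mats ?n"
    "\<And>k i l. i < ?n \<Longrightarrow> l < ?n \<Longrightarrow> entry (X k) i l = (if l div m = i then xs i k ! (l mod m) else 0)"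
    by metis
  have b: "diag bs \<in> mats ?n" by (rule diag_in_mats) simp
  have prod: "entry (X k * diag bs * adj (X k)) i j
      = (\<Sum>l<?n. entry (X k) i l * bs ! l * adj (entry (X k) j l))" for i j k
  proof -
    have "entry (X k * diag bs) i l = entry (X k) i l * bs ! l" if "l < ?n" for l
      using that
      by (simp add: entry_times[OF X(1)] diag.rep_eq if_distrib[of "\<lambda>t. _ * t"] sum.delta cong: if_cong)
    then show ?thesis
      by (simp add: entry_times[OF times_in_M[OF X(1) b]] adj_minf.rep_eq)
  qed
  \<comment> \<open>Distinct rows are supported on disjoint blocks of columns, and multiplication by
    \<open>diag bs\<close> keeps the supports.\<close>
  have off: "entry (X k * diag bs * adj (X k)) i j = 0" if "i < ?n" "j < ?n" "i \<noteq> j" for i j k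
    unfolding prod using that by (intro sum.neutral ballI) (simp add: X(2))
  \<comment> \<open>Every column index below \<open>?n\<close> belongs to a block with number less
    than \<open>?r\<close>, so the rows from \<open>?r\<close> on are zero.\<close>
  have beyond: "entry (X k * diag bs * adj (X k)) i i = 0" if "i < ?n" "?r \<le> i" for i k
    unfolding prod
  proof (intro sum.neutral ballI)
    fix l assume l: "l \<in> {..<?n}"
    then have "l div m < ?r" using len m by (simp add: less_mult_imp_div_less)
    then show "entry (X k) i l * bs ! l * adj (entry (X k) i l) = 0" using that l by (simp add: X(2))
  qed
  have on: "entry (X k * diag bs * adj (X k)) i i
      = (\<Sum>t<m. xs i k ! t * bs ! (i * m + t) * adj (xs i k ! t))" if i: "i < ?r" for i k
  proof -
    let ?g = "\<lambda>l. entry (X k) i l * bs ! l * adj (entry (X k) i l)"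
    have "sum ?g {..<?n} = sum ?g ((\<lambda>t. i * m + t) ` {..<m})"
    proof (rule sum.mono_neutral_right)
      show "(\<lambda>t. i * m + t) ` {..<m} \<subseteq> {..<?n}" using im[OF i] by auto
      show "\<forall>l\<in>{..<?n} - (\<lambda>t. i * m + t) ` {..<m}. ?g l = 0"
      proof
        fix l assume l: "l \<in> {..<?n} - (\<lambda>t. i * m + t) ` {..<m}"
        have "l div m \<noteq> i"
        proof
          assume "l div m = i"
          then have "l = i * m + l mod m" by (metis div_mult_mod_eq)
          moreover have "l mod m < m" using m by simp
          ultimately show False using l by blast
        qed
        then show "?g l = 0" using l i rn by (simp add: X(2))
      qed
    qed simp
    also have "\<dots> = (\<Sum>t<m. ?g (i * m + t))" by (subst sum.reindex) (auto simp: inj_on_def)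
    also have "\<dots> = (\<Sum>t<m. xs i k ! t * bs ! (i * m + t) * adj (xs i k ! t))"
    proof (rule sum.cong[OF refl])
      fix t assume "t \<in> {..<m}"
      then have t: "t < m" by simp
      have "(i * m + t) div m = i" "(i * m + t) mod m = t" using t by simp_all
      then show "?g (i * m + t) = xs i k ! t * bs ! (i * m + t) * adj (xs i k ! t)"
        using im[OF i t] i rn by (simp add: X(2))
    qed
    finally show ?thesis unfolding prod .
  qed
  define D where "D k = X k * diag bs * adj (X k) - diag ds" for k
  have D_entry: "entry (D k) i j = entry (X k * diag bs * adj (X k)) i j - entry (diag ds) i j" for k i j
    by (simp add: D_def entry_minus)
  have D_le: "norm (entry (D k) i j) \<le> (if i = j then inverse (real (Suc k)) else 0)"
    if "i < ?n" "j < ?n" for i j k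
  proof (cases "i = j")
    case False
    then show ?thesis using off[OF that] by (simp add: D_entry diag.rep_eq)
  next
    case True
    show ?thesis
    proof (cases "i < ?r")
      case ir: True
      have "entry (D k) i j = - ?E i (xs i k)" using True ir by (simp add: D_entry on diag.rep_eq)
      then have "norm (entry (D k) i j) = norm (?E i (xs i k))" by (simp only: norm_minus_cancel)
      then show ?thesis using xs[OF ir, of k] True by simp
    next
      case False
      then show ?thesis using True that by (simp add: D_entry beyond diag.rep_eq)
    qed
  qed
  have D_mats: "D k \<in> mats ?n" for k
    unfolding D_def using rn by (intro minus_in_mats times_in_M adj_in_mats X(1) b diag_in_mats)
  have up: "matrix_norm (D k) \<le> real ?n * inverse (real (Suc k))" for k
  proof -
    have "matrix_norm (D k) \<le> (\<Sum>i<?n. \<Sum>j<?n. norm (entry (D k) i j))"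
      by (rule matrix_norm_le[OF D_mats])
    also have "\<dots> \<le> (\<Sum>i<?n. \<Sum>j<?n. if i = j then inverse (real (Suc k)) else 0)"
      by (intro sum_mono D_le) auto
    also have "\<dots> = real ?n * inverse (real (Suc k))" by (simp add: sum.delta)
    finally show ?thesis .
  qed
  have low: "0 \<le> matrix_norm (D k)" for k
    using norm_entry_le_matrix_norm[of "D k" 0 0] norm_ge_zero order_trans by blast
  have "(\<lambda>k. real ?n * inverse (real (Suc k))) \<longlonglongrightarrow> real ?n * 0"
    by (intro tendsto_intros LIMSEQ_inverse_real_of_nat)
  then have "(\<lambda>k. matrix_norm (D k)) \<longlonglongrightarrow> 0"
    using up low by (intro tendsto_sandwich[of "\<lambda>_. 0" "\<lambda>k. matrix_norm (D k)"]) (auto intro!: always_eventually)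
  then show ?thesis
    unfolding cuntz_below_def D_def using X(1) b diag_in_mats[OF rn] by blast
qed

lemma cuntz_sum_below:
  assumes "cuntz_sum d bs" "bs \<noteq> []"
  shows "corner d \<precsim> diag bs"
  using assms by (intro diag_below_diag[where m = "length bs"]) (simp_all add: Suc_le_eq)

text \<open>The type \<open>minf\<close> is given only as a star algebra, so positivity is read off
  the spectrum: for nonzero z, the diagonal of the resolvents of the entries is a resolvent of the
  matrix.\<close>

lemma positive_diag:
  fixes ds :: "'a::cstar_algebra list"
  assumes "\<And>d. d \<in> set ds \<Longrightarrow> positive_element d"
  shows "positive_element (diag ds)"
  unfolding positive_element_def
proof
  have "adj (ds ! i) = ds ! i" if "i < length ds" for i
    using assms[of "ds ! i"] that by (simp add: positive_element_def)
  then show "adj (diag ds) = diag ds"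
    by (intro minf_eqI) (simp add: adj_minf.rep_eq diag.rep_eq)
  show "\<forall>z\<in>spectrum (diag ds). z \<in> \<real> \<and> 0 \<le> Re z"
  proof
    fix z assume z: "z \<in> spectrum (diag ds)"
    have "z = 0 \<or> (\<exists>d\<in>set ds. z \<in> spectrum d)"
    proof (rule ccontr)
      assume *: "\<not> ?thesis"
      then have "z \<noteq> 0" by blast
      \<comment> \<open>The equations for the second coordinate of an inverse of (z, -d) in the
        unitization; the first coordinate is necessarily \<open>inverse z\<close>.\<close>
      have "\<exists>y. z *\<^sub>C y + inverse z *\<^sub>C (- d) + (- d) * y = 0 \<and>
          inverse z *\<^sub>C (- d) + z *\<^sub>C y + y * (- d) = 0" if "d \<in> set ds" for d
      proof -
        have "z \<notin> spectrum d" using * that by blast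
        then obtain u where u: "unitization_mult (z, - d) u = (1, 0)" "unitization_mult u (z, - d) = (1, 0)"
          unfolding spectrum_def mem_Collect_eq not_not by blast
        then have "fst u = inverse z" using \<open>z \<noteq> 0\<close>
          by (auto simp: unitization_mult_def field_simps)
        then show ?thesis using u by (intro exI[of _ "snd u"]) (simp add: unitization_mult_def)
      qed
      then obtain Y where Y: "\<And>d. d \<in> set ds \<Longrightarrow> z *\<^sub>C Y d + inverse z *\<^sub>C (- d) + (- d) * Y d = 0"
        "\<And>d. d \<in> set ds \<Longrightarrow> inverse z *\<^sub>C (- d) + z *\<^sub>C Y d + Y d * (- d) = 0"
        by metis
      let ?n = "length ds"
      have M: "diag ds \<in> mats ?n" "diag (map Y ds) \<in> mats ?n"
        by (simp_all add: diag_in_mats)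
      have "z *\<^sub>C diag (map Y ds) + inverse z *\<^sub>C (- diag ds) + (- diag ds) * diag (map Y ds) = 0"
      proof (rule minf_eqI)
        fix i j
        show "entry (z *\<^sub>C diag (map Y ds) + inverse z *\<^sub>C (- diag ds) + (- diag ds) * diag (map Y ds)) i j
            = entry 0 i j"
          using Y(1)[of "ds ! i"]
          by (cases "i < ?n")
            (auto simp: entry_minus plus_minf.rep_eq scaleC_minf.rep_eq uminus_minf.rep_eq zero_minf.rep_eq
              entry_times[OF M(1)] diag.rep_eq if_distrib[of "\<lambda>t. t * _"] if_distrib[of uminus]
              sum.delta sum.delta' cong: if_cong)
      qed
      moreover have "inverse z *\<^sub>C (- diag ds) + z *\<^sub>C diag (map Y ds) + diag (map Y ds) * (- diag ds) = 0"
      proof (rule minf_eqI)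
        fix i j
        show "entry (inverse z *\<^sub>C (- diag ds) + z *\<^sub>C diag (map Y ds) + diag (map Y ds) * (- diag ds)) i j
            = entry 0 i j"
          using Y(2)[of "ds ! i"]
          by (cases "i < ?n")
            (auto simp: entry_minus plus_minf.rep_eq scaleC_minf.rep_eq uminus_minf.rep_eq zero_minf.rep_eq
              entry_times[OF M(2)] diag.rep_eq if_distrib[of "\<lambda>t. t * _"] if_distrib[of uminus]
              sum.delta sum.delta' cong: if_cong)
      qed
      ultimately have "z \<notin> spectrum (diag ds)"
        using \<open>z \<noteq> 0\<close>
        by (auto simp: spectrum_def unitization_mult_def intro!: exI[of _ "inverse z"] exI[of _ "diag (map Y ds)"])
      then show False using z by blast
    qed
    then show "z \<in> \<real> \<and> 0 \<le> Re z" using assms by (auto simp: positive_element_def)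
  qed
qed

text \<open>Reflexivity of the comparison. It matters because \<open>\<le>\<^sub>W\<close> and
  \<open>+\<^sub>W\<close> range over the members of classes, so a matrix must be known to belong to
  its own.\<close>

lemma diag_in_cuntz_class:
  fixes ds :: "'a::cstar_algebra list"
  assumes ds: "\<And>d. d \<in> set ds \<Longrightarrow> positive_element d"
  shows "diag ds \<in> \<langle>diag ds\<rangle>"
proof -
  have "diag ds \<precsim> diag ds"
  proof (rule diag_below_diag[where m = 1])
    fix i assume "i < length ds"
    then show "cuntz_sum (ds ! i) (take 1 (drop (i * 1) ds))"
      using cuntz_sum_refl[OF ds] by (simp add: take_Suc drop_eq_Nil hd_drop_conv_nth)
  qed simp_all
  then show ?thesis
    using positive_diag[OF ds] by (simp add: cuntz_class_def cuntz_equiv_def)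
qed

section \<open>Order and multiples in the Cuntz semigroup\<close>

lemma cuntz_le_diag:
  assumes "\<And>d. d \<in> set ds \<Longrightarrow> positive_element d" "\<And>b. b \<in> set bs \<Longrightarrow> positive_element b"
    "diag ds \<precsim> diag bs"
  shows "\<langle>diag ds\<rangle> \<le>\<^sub>W \<langle>diag bs\<rangle>"
  using diag_in_cuntz_class[OF assms(1)] diag_in_cuntz_class[OF assms(2)] assms(3)
  unfolding cuntz_le_def by blast

lemma diag_replicate_in_multiple:
  fixes b :: "'a::cstar_algebra"
  assumes b: "positive_element b"
  shows "diag (replicate m b) \<in> m \<cdot>\<^sub>W \<langle>corner b\<rangle>"
proof (induction m)
  case 0
  have "diag [] = (0 :: 'a minf)" by (rule minf_eqI) (simp add: diag.rep_eq zero_minf.rep_eq)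
  then show ?case using diag_in_cuntz_class[of "[] :: 'a list"] by simp
next
  case (Suc m)
  have "direct_sum 1 (corner b) (diag (replicate m b)) = diag (replicate (Suc m) b)"
    by (rule minf_eqI) (auto simp: direct_sum.rep_eq diag.rep_eq nth_Cons split: nat.split)
  moreover have "diag (replicate (Suc m) b) \<in> \<langle>diag (replicate (Suc m) b)\<rangle>"
    by (rule diag_in_cuntz_class) (use b in auto)
  moreover have "corner b \<in> \<langle>corner b\<rangle>" by (rule diag_in_cuntz_class) (use b in simp)
  moreover have "corner b \<in> mats 1" by (rule diag_in_mats) simp
  ultimately have "diag (replicate (Suc m) b) \<in> \<langle>corner b\<rangle> +\<^sub>W m \<cdot>\<^sub>W \<langle>corner b\<rangle>"
    using Suc unfolding cuntz_plus_def by force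
  then show ?case by simp
qed

lemma cuntz_class_below: "y \<in> \<langle>x\<rangle> \<Longrightarrow> y \<precsim> x" "y \<in> \<langle>x\<rangle> \<Longrightarrow> x \<precsim> y"
  by (auto simp: cuntz_class_def cuntz_equiv_def)

lemma multiple_entries:
  assumes I: "closed_ideal I" and x: "\<And>i j. entry x i j \<in> I"
  shows "y \<in> m \<cdot>\<^sub>W \<langle>x\<rangle> \<Longrightarrow> entry y i j \<in> I"
proof (induction m arbitrary: y i j)
  case 0
  then have "y \<precsim> 0" by (auto dest: cuntz_class_below)
  then show ?case
    by (rule closed_ideal_entries[OF I]) (simp add: zero_minf.rep_eq closed_idealD[OF I])
next
  case (Suc m)
  then obtain u v n where u: "u \<in> \<langle>x\<rangle>" and v: "v \<in> m \<cdot>\<^sub>W \<langle>x\<rangle>" and y: "y \<in> \<langle>direct_sum n u v\<rangle>"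
    by (auto simp: cuntz_plus_def)
  have "entry u i j \<in> I" for i j by (rule closed_ideal_entries[OF I cuntz_class_below(1)[OF u] x])
  moreover have "entry v i j \<in> I" for i j by (rule Suc.IH[OF v])
  ultimately have "entry (direct_sum n u v) i j \<in> I" for i j
    by (simp add: direct_sum.rep_eq closed_idealD(2)[OF I])
  then show ?case by (rule closed_ideal_entries[OF I cuntz_class_below(1)[OF y]])
qed

text \<open>Membership in the ideal is passed back from y to a representative x' and from there to
  x, one comparison at a time, without composing the comparisons.\<close>

lemma cuntz_le_entries:
  assumes I: "closed_ideal I" and le: "\<langle>x\<rangle> \<le>\<^sub>W Y" and Y: "\<And>y i j. y \<in> Y \<Longrightarrow> entry y i j \<in> I"
  shows "entry x i j \<in> I"
proof -
  obtain x' y where x': "x' \<in> \<langle>x\<rangle>" and y: "y \<in> Y" and below: "x' \<precsim> y"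
    using le unfolding cuntz_le_def by blast
  have "entry x' i j \<in> I" for i j by (rule closed_ideal_entries[OF I below Y[OF y]])
  then show ?thesis by (rule closed_ideal_entries[OF I cuntz_class_below(2)[OF x']])
qed

lemma cuntz_class_entries:
  assumes I: "closed_ideal I" and x: "\<And>i j. entry x i j \<in> I"
  shows "y \<in> \<langle>x\<rangle> \<Longrightarrow> entry y i j \<in> I"
  by (rule closed_ideal_entries[OF I cuntz_class_below(1) x])

section \<open>The ideal property\<close>

lemma spectrum_projection:
  assumes p: "projection p"
  shows "spectrum p \<subseteq> {0, 1}"
proof
  fix z assume z: "z \<in> spectrum p"
  have pp: "p * p = p" using p by (simp add: projection_def)
  show "z \<in> {0, 1}"
  proof (rule ccontr)
    assume "z \<notin> {0, 1}"
    then have z01: "z \<noteq> 0" "z - 1 \<noteq> 0" by auto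
    \<comment> \<open>Found by solving (z - p)(1/z + c p) = 1 with p p = p.\<close>
    define c where "c = 1 / (z * (z - 1))"
    have "z * c - inverse z - c = 0" using z01 by (simp add: c_def field_simps)
    then have "(z * c - inverse z - c) *\<^sub>C p = 0" by simp
    then have e: "z *\<^sub>C (c *\<^sub>C p) - inverse z *\<^sub>C p - c *\<^sub>C p = 0"
      by (simp add: scaleC_diff_left scaleC_scaleC)
    have "unitization_mult (z, - p) (inverse z, c *\<^sub>C p) = (1, 0)"
      "unitization_mult (inverse z, c *\<^sub>C p) (z, - p) = (1, 0)"
      using z01 e by (simp_all add: unitization_mult_def mult_scaleC_left mult_scaleC_right pp)
    then show False using z by (auto simp: spectrum_def)
  qed
qed

lemma positive_projection: "projection p \<Longrightarrow> positive_element p"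
  using spectrum_projection[of p] by (auto simp: positive_element_def projection_def)

text \<open>At the only possible spectral points 0 and 1, max (t - 1/2) 0 equals t/2.\<close>

lemma cut_down_projection:
  fixes p :: "'a::cstar_algebra"
  assumes p: "projection p"
  shows "cut_down p (1 / 2) = (1 / 2) *\<^sub>R p"
proof -
  have P: "adj p = p" and A: "adj (emb p) = emb p" using p by (simp_all add: projection_def emb_simps)
  have t01: "t = 0 \<or> t = 1" if "t \<in> rspec (emb p)" for t
    using rspecD[OF A that] spectrum_projection[OF p] by (auto simp: spectrum_eq_spec)
  have "emb (cut_down p (1 / 2)) = rfc (emb p) (\<lambda>t. max (t - 1 / 2) 0)"
    using emb_cut_down[OF P] by simp
  also have "\<dots> = rfc (emb p) (\<lambda>t. 1 / 2 * t)"
    by (intro rfc_cong[OF A] continuous_intros) (use t01 in fastforce)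
  also have "\<dots> = emb ((1 / 2) *\<^sub>R p)"
    by (subst rfc_mult[OF A]) (simp_all add: rfc_const[OF A] rfc_id[OF A] emb_simps)
  finally show ?thesis by simp
qed

lemma projection_diag:
  fixes ps :: "'a::star_algebra list"
  assumes "\<And>q. q \<in> set ps \<Longrightarrow> projection q"
  shows "projection (diag ps)"
proof -
  have q: "adj (ps ! i) = ps ! i" "ps ! i * ps ! i = ps ! i" if "i < length ps" for i
    using assms[of "ps ! i"] that by (simp_all add: projection_def)
  have M: "diag ps \<in> mats (length ps)" by (simp add: mats_def diag.rep_eq)
  show ?thesis
    unfolding projection_def
  proof
    show "adj (diag ps) = diag ps" by (rule minf_eqI) (auto simp: adj_minf.rep_eq diag.rep_eq q)
    show "diag ps * diag ps = diag ps"
      by (rule minf_eqI)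
        (auto simp: entry_times[OF M] diag.rep_eq q if_distrib[of "\<lambda>t. t * _"] sum.delta sum.delta' cong: if_cong)
  qed
qed

text \<open>\<open>ex_cuntz_sum_cut_down\<close> at 1/2, rescaled by 2, bounds p itself. Padding
  admits every larger m, so that one multiplicity can serve several projections and several
  b.\<close>

lemma cuntz_sum_projection:
  assumes p: "projection p" and b: "positive_element b" and pb: "p \<in> closed_ideal hull {b}"
  shows "\<exists>k. \<forall>m\<ge>k. cuntz_sum p (replicate m b)"
proof -
  obtain bs where bs: "set bs \<subseteq> {b}" "cuntz_sum (cut_down p (1 / 2)) bs"
    using ex_cuntz_sum_cut_down[of "{b}" p "1 / 2"] b pb positive_projection[OF p] by auto
  have "cuntz_sum (2 *\<^sub>R cut_down p (1 / 2)) bs" by (rule cuntz_sum_scaleR[OF bs(2)]) simp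
  then have c: "cuntz_sum p bs" by (simp add: cut_down_projection[OF p])
  have r: "bs = replicate (length bs) b" using bs(1) by (metis replicate_eqI singletonD subsetD)
  have "cuntz_sum p (replicate m b)" if "m \<ge> length bs" for m
  proof -
    have "replicate m b = bs @ replicate (m - length bs) b"
      using that by (subst r) (simp flip: replicate_add)
    then show ?thesis using cuntz_sum_pad[OF c, of "[]" "replicate (m - length bs) b"] by simp
  qed
  then show ?thesis by blast
qed

text \<open>
  \<open>x(x\<^sup>*x)(x\<^sup>*x + \<eta>)\<^sup>-\<^sup>1\<close> lies in the ideal since the inverse is a scalar plus an element of \<open>A\<close>, and it
  converges to \<open>x\<close>.
\<close>

lemma closed_ideal_adj_mult:
  fixes x :: "'a::cstar_algebra"
  assumes J: "closed_ideal J" and h: "adj x * x \<in> J"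
  shows "x \<in> J"
proof (rule closed_approach[OF closed_idealD(1)[OF J]])
  fix e :: real assume e: "0 < e"
  \<comment> \<open>The C*-identity will bound the square of \<open>norm (emb x * g)\<close> by
    \<eta>.\<close>
  define \<eta> where "\<eta> = e\<^sup>2"
  have \<eta>: "0 < \<eta>" using e by (simp add: \<eta>_def)
  define H where "H = emb (adj x * x)"
  have H: "H = adj (emb x) * emb x" by (simp add: H_def emb_simps)
  have P: "pos H" unfolding H by (rule pos_adj_mult)
  have A: "adj H = H" by (rule pos_adj[OF P])
  \<comment> \<open>\<open>?w\<close> gives a regularized inverse of H, and \<open>?g\<close> the
    defect 1 - H w, by which x is multiplied in the error.\<close>
  let ?w = "\<lambda>t::real. 1 / (max t 0 + \<eta>)" and ?g = "\<lambda>t::real. \<eta> / (max t 0 + \<eta>)"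
  have "0 < max t 0 + \<eta>" for t :: real using \<eta> by (intro add_nonneg_pos) auto
  then have ne: "max t 0 + \<eta> \<noteq> 0" for t :: real by (metis less_irrefl)
  have c: "continuous_on UNIV ?w" "continuous_on UNIV ?g" "continuous_on UNIV (\<lambda>t. t * ?w t)"
    "continuous_on UNIV (\<lambda>t. t * ?g t)" "continuous_on UNIV (\<lambda>t. ?g t * (t * ?g t))"
    using ne by (auto intro!: continuous_intros)
  define w where "w = rfc H ?w"
  define g where "g = rfc H ?g"
  have ag: "adj g = g" unfolding g_def by (rule adj_rfc[OF A c(2)])
  have "H * w = rfc H (\<lambda>t. t * ?w t)"
    unfolding w_def by (subst rfc_mult[OF A _ c(1)]) (simp_all add: rfc_id[OF A])
  then have "1 - H * w = rfc H (\<lambda>t. 1 - t * ?w t)"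
    by (subst rfc_diff[OF A _ c(3)]) (simp_all add: rfc_const[OF A])
  also have "\<dots> = g"
    unfolding g_def
  proof (rule rfc_cong[OF A])
    fix t assume "t \<in> rspec H"
    then have "0 \<le> t" by (rule pos_rspec[OF P])
    then show "1 - t * ?w t = ?g t" using \<eta> by (simp add: field_simps)
  qed (intro continuous_intros c)
  finally have g: "1 - H * w = g" .
  have "g * (H * g) = rfc H (\<lambda>t. ?g t * (t * ?g t))"
    unfolding g_def
    by (subst rfc_mult[OF A c(2,4)], subst rfc_mult[OF A _ c(2), of "\<lambda>t. t"])
      (simp_all add: rfc_id[OF A])
  also have "norm \<dots> \<le> \<eta>"
  proof (rule norm_rfc_le[OF A c(5)])
    fix t assume "t \<in> rspec H"
    then have t: "0 \<le> t" by (rule pos_rspec[OF P])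
    have "?g t * (t * ?g t) = \<eta> * (\<eta> / (t + \<eta>) * (t / (t + \<eta>)))" using t \<eta> by simp
    also have "\<dots> \<le> \<eta> * (1 * 1)"
      using t \<eta> by (intro mult_left_mono mult_mono) (auto simp: field_simps)
    finally show "\<bar>?g t * (t * ?g t)\<bar> \<le> \<eta>" using t \<eta> by simp
  qed
  finally have n: "norm (g * (H * g)) \<le> \<eta>" .
  have "(norm (emb x * g))\<^sup>2 = norm (adj (emb x * g) * (emb x * g))" by (rule cstar_identity[symmetric])
  also have "adj (emb x * g) * (emb x * g) = g * (H * g)" by (simp add: adj_mult ag H mult.assoc)
  finally have "(norm (emb x * g))\<^sup>2 \<le> e\<^sup>2" using n by (simp add: \<eta>_def)
  then have xg: "norm (emb x * g) \<le> e" by (rule power2_le_imp_le) (use e in simp)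
  define y where "y = scal w *\<^sub>C (x * (adj x * x)) + (x * (adj x * x)) * vec w"
  have yJ: "y \<in> J" unfolding y_def by (intro closed_idealD[OF J] h)
  have "emb x * (H * w) = emb y"
    by (rule unitz_eqI) (simp_all add: H_def y_def mult_scaleC_right distrib_left mult.assoc)
  then have "emb (x - y) = emb x * g" by (simp add: right_diff_distrib emb_simps(2)[symmetric] flip: g)
  then have "norm (x - y) \<le> e" using xg by (metis norm_emb)
  then show "\<exists>y\<in>J. norm (x - y) \<le> e" using yJ by blast
qed

section \<open>The implications between the three conditions\<close>

lemma cuntz_le_corner_imp_hull:
  assumes "\<langle>corner a\<rangle> \<le>\<^sub>W \<langle>corner b\<rangle>"
  shows "a \<in> closed_ideal hull {b}"
proof -
  let ?I = "closed_ideal hull {b}"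
  have b: "entry (corner b) i j \<in> ?I" for i j
    using hull_inc[of b "{b}"] closed_idealD(2)[OF closed_ideal_hull]
    by (auto simp: diag.rep_eq)
  have "entry (corner a) 0 0 \<in> ?I"
    by (rule cuntz_le_entries[OF closed_ideal_hull assms cuntz_class_entries[OF closed_ideal_hull b]])
  then show ?thesis by (simp add: diag.rep_eq)
qed

text \<open>The projections are taken from the one ideal generated by both a_1 and a_2. It lies in
  the ideal generated by each b_j, so a projection chosen for either a_i is bounded by multiples of
  both b_j.\<close>

lemma ideal_property_imp_interpolation:
  fixes a b :: "nat \<Rightarrow> 'a::cstar_algebra"
  assumes ip: "ideal_property TYPE('a)"
    and pos: "\<forall>i\<in>{1, 2}. positive_element (a i) \<and> positive_element (b i)"
    and le: "\<forall>i\<in>{1, 2}. \<forall>j\<in>{1, 2}. \<langle>corner (a i)\<rangle> \<le>\<^sub>W \<langle>corner (b j)\<rangle>"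
    and \<epsilon>: "0 < \<epsilon>"
  shows "\<exists>p m. projection p \<and> 1 \<le> m \<and> sum_of_projections p \<and>
    (\<forall>i\<in>{1, 2}. \<forall>j\<in>{1, 2}. \<langle>corner (cut_down (a i) \<epsilon>)\<rangle> \<le>\<^sub>W \<langle>p\<rangle> \<and> \<langle>p\<rangle> \<le>\<^sub>W m \<cdot>\<^sub>W \<langle>corner (b j)\<rangle>)"
proof -
  define I where "I = closed_ideal hull {a 1, a 2}"
  define S where "S = {p \<in> I. projection p}"
  have I: "closed_ideal I" unfolding I_def by (rule closed_ideal_hull)
  have hS: "closed_ideal hull S = I" using ip I unfolding ideal_property_def S_def by blast
  have Ib: "I \<subseteq> closed_ideal hull {b j}" if j: "j \<in> {1, 2}" for j
    unfolding I_def
  proof (intro hull_minimal closed_ideal_hull)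
    have "\<langle>corner (a i)\<rangle> \<le>\<^sub>W \<langle>corner (b j)\<rangle>" if "i \<in> {1, 2}" for i using le j that by blast
    then show "{a 1, a 2} \<subseteq> closed_ideal hull {b j}" by (simp add: cuntz_le_corner_imp_hull)
  qed
  have ex: "\<exists>bs. set bs \<subseteq> S \<and> cuntz_sum (cut_down (a i) \<epsilon>) bs" if i: "i \<in> {1, 2}" for i
  proof (rule ex_cuntz_sum_cut_down)
    show "a i \<in> closed_ideal hull S" unfolding hS I_def using i by (auto intro: hull_inc)
    show "positive_element (a i)" using pos i by blast
    show "positive_element p" if "p \<in> S" for p using that by (simp add: S_def positive_projection)
  qed (rule \<epsilon>)
  obtain qs where qs: "set qs \<subseteq> S" "cuntz_sum (cut_down (a 1) \<epsilon>) qs" using ex[of 1] by auto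
  obtain rs where rs: "set rs \<subseteq> S" "cuntz_sum (cut_down (a 2) \<epsilon>) rs" using ex[of 2] by auto
  \<comment> \<open>The zero projection ensures that there is at least one summand.\<close>
  define ps where "ps = 0 # qs @ rs"
  have "0 \<in> S" using closed_idealD(2)[OF I] by (simp add: S_def projection_def)
  then have psS: "set ps \<subseteq> S" using qs(1) rs(1) by (simp add: ps_def)
  have proj: "projection q" if "q \<in> set ps" for q using psS that by (auto simp: S_def)
  then have psp: "positive_element q" if "q \<in> set ps" for q using that positive_projection by blast
  have cut: "cuntz_sum (cut_down (a i) \<epsilon>) ps" if "i \<in> {1, 2}" for i
    using that cuntz_sum_pad[OF qs(2), of "[0]" rs] cuntz_sum_pad[OF rs(2), of "0 # qs" "[]"]
    by (auto simp: ps_def)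
  have "\<exists>k. \<forall>m\<ge>k. cuntz_sum q (replicate m (b j))" if "q \<in> set ps" "j \<in> {1, 2}" for q j
  proof (rule cuntz_sum_projection)
    show "q \<in> closed_ideal hull {b j}" using Ib[OF that(2)] psS that(1) by (auto simp: S_def)
  qed (use proj that pos in auto)
  then obtain k where k: "\<And>q j m. q \<in> set ps \<Longrightarrow> j \<in> {1, 2} \<Longrightarrow> k q j \<le> m \<Longrightarrow> cuntz_sum q (replicate m (b j))"
    by metis
  \<comment> \<open>Exceeds every \<open>k q j\<close> and is positive. \<open>?M\<close> then
    provides a block of m copies of b_j for each summand.\<close>
  define m where "m = Suc (\<Sum>q\<in>set ps. k q 1 + k q 2)"
  have km: "k q j \<le> m" if "q \<in> set ps" "j \<in> {1, 2}" for q j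
  proof -
    have "k q 1 + k q 2 \<le> (\<Sum>q\<in>set ps. k q 1 + k q 2)"
      using that(1) by (intro member_le_sum) auto
    then show ?thesis using that(2) by (auto simp: m_def)
  qed
  let ?M = "length ps * m"
  have up: "diag ps \<precsim> diag (replicate ?M (b j))" if j: "j \<in> {1, 2}" for j
  proof (rule diag_below_diag)
    fix i assume i: "i < length ps"
    have "Suc i * m \<le> ?M" using i by (intro mult_right_mono) auto
    then have "m \<le> ?M - i * m" by simp
    then have "take m (drop (i * m) (replicate ?M (b j))) = replicate m (b j)"
      by (simp add: min_def)
    then show "cuntz_sum (ps ! i) (take m (drop (i * m) (replicate ?M (b j))))"
      using k[OF _ j km[OF _ j]] i by simp
  qed (simp_all add: m_def)
  have "\<langle>corner (cut_down (a i) \<epsilon>)\<rangle> \<le>\<^sub>W \<langle>diag ps\<rangle>" if "i \<in> {1, 2}" for i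
  proof (rule cuntz_le_diag)
    show "corner (cut_down (a i) \<epsilon>) \<precsim> diag ps" using cut[OF that] by (rule cuntz_sum_below) (simp add: ps_def)
    have "adj (a i) = a i" using pos that unfolding positive_element_def by blast
    then show "\<And>d. d \<in> set [cut_down (a i) \<epsilon>] \<Longrightarrow> positive_element d"
      using positive_cut_down[of "a i" \<epsilon>] \<epsilon> by simp
  qed (use psp in blast)
  moreover have "\<langle>diag ps\<rangle> \<le>\<^sub>W ?M \<cdot>\<^sub>W \<langle>corner (b j)\<rangle>" if j: "j \<in> {1, 2}" for j
  proof -
    have "positive_element (b j)" using pos j by blast
    then show ?thesis
      using diag_in_cuntz_class[OF psp] diag_replicate_in_multiple up[OF j]
      unfolding cuntz_le_def by blast
  qed
  moreover have "sum_of_projections (diag ps)"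
    unfolding sum_of_projections_def using proj by (intro exI[of _ ps]) (simp add: ps_def)
  moreover have "1 \<le> ?M" by (simp add: ps_def m_def)
  ultimately show ?thesis
    using projection_diag[of ps, OF proj] by (intro exI[of _ "diag ps"] exI[of _ ?M] conjI ballI)
qed

lemma ideal_property_of_cut_down:
  assumes iii: "\<And>(a :: 'a::cstar_algebra) \<epsilon>. positive_element a \<Longrightarrow> 0 < \<epsilon> \<Longrightarrow>
    \<exists>p m. projection p \<and> 1 \<le> m \<and> sum_of_projections p \<and>
      \<langle>corner (cut_down a \<epsilon>)\<rangle> \<le>\<^sub>W \<langle>p\<rangle> \<and> \<langle>p\<rangle> \<le>\<^sub>W m \<cdot>\<^sub>W \<langle>corner a\<rangle>"
  shows "ideal_property TYPE('a)"
  unfolding ideal_property_def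
proof (intro allI impI antisym)
  fix I :: "'a set" assume I: "closed_ideal I"
  define J where "J = closed_ideal hull {p \<in> I. projection p}"
  have J: "closed_ideal J" unfolding J_def by (rule closed_ideal_hull)
  show "closed_ideal hull {p \<in> I. projection p} \<subseteq> I"
  proof (rule hull_minimal)
    show "{p \<in> I. projection p} \<subseteq> I" by blast
  qed (rule I)
  have "x \<in> J" if x: "x \<in> I" for x
  proof (rule closed_ideal_adj_mult[OF J])
    define h where "h = adj x * x"
    have hI: "h \<in> I" unfolding h_def by (rule closed_idealD(5)[OF I x])
    have hp: "positive_element h"
      using pos_adj_mult[of "emb x"] by (simp add: positive_element_iff h_def emb_simps)
    show "adj x * x \<in> J"
      unfolding h_def[symmetric]
    proof (rule closed_approach[OF closed_idealD(1)[OF J]])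
      fix \<epsilon> :: real assume \<epsilon>: "0 < \<epsilon>"
      obtain p m where p: "sum_of_projections p" and cut: "\<langle>corner (cut_down h \<epsilon>)\<rangle> \<le>\<^sub>W \<langle>p\<rangle>"
        and pm: "\<langle>p\<rangle> \<le>\<^sub>W m \<cdot>\<^sub>W \<langle>corner h\<rangle>"
        using iii[OF hp \<epsilon>] by (elim exE conjE) (rule that)
      obtain ps where ps: "\<And>q. q \<in> set ps \<Longrightarrow> projection q" "p = diag ps"
        using p unfolding sum_of_projections_def by blast
      have hI: "entry (corner h) i j \<in> I" for i j
        using hI closed_idealD(2)[OF I] by (cases "i = 0") (simp_all add: diag.rep_eq)
      have pI: "entry p i j \<in> I" for i j
        by (rule cuntz_le_entries[OF I pm multiple_entries[OF I hI]])
      \<comment> \<open>Here the diagonal form of p is used: its diagonal entries are themselves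
        projections in I, hence among the generators of J.\<close>
      have pJ: "entry p i j \<in> J" for i j
      proof (cases "i = j \<and> i < length ps")
        case True
        then have "ps ! i \<in> {p \<in> I. projection p}" using pI[of i i] ps by (simp add: diag.rep_eq)
        then have "ps ! i \<in> J" unfolding J_def by (rule hull_inc)
        then show ?thesis using True by (simp add: ps(2) diag.rep_eq)
      next
        case False
        then have "entry p i j = 0" by (simp only: ps(2) diag.rep_eq if_False)
        then show ?thesis using closed_idealD(2)[OF J] by simp
      qed
      have "entry (corner (cut_down h \<epsilon>)) 0 0 \<in> J"
        by (rule cuntz_le_entries[OF J cut cuntz_class_entries[OF J pJ]])
      then have "cut_down h \<epsilon> \<in> J" by (simp add: diag.rep_eq)
      then show "\<exists>y\<in>J. norm (h - y) \<le> \<epsilon>"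
        using norm_cut_down[OF hp] \<epsilon> by (intro bexI[of _ "cut_down h \<epsilon>"]) simp_all
    qed
  qed
  then show "I \<subseteq> closed_ideal hull {p \<in> I. projection p}" unfolding J_def by blast
qed

theorem theorem2p4:
  fixes A :: "'a::cstar_algebra itself"
  shows
    "(ideal_property A \<longleftrightarrow>
        (\<forall>(a :: nat \<Rightarrow> 'a) b.
           (\<forall>i\<in>{1, 2}. positive_element (a i) \<and> positive_element (b i)) \<and>
           (\<forall>i\<in>{1, 2}. \<forall>j\<in>{1, 2}. \<langle>corner (a i)\<rangle> \<le>\<^sub>W \<langle>corner (b j)\<rangle>) \<longrightarrow>
           (\<forall>\<epsilon>>0. \<exists>p m. projection p \<and> 1 \<le> m \<and> sum_of_projections p \<and>
              (\<forall>i\<in>{1, 2}. \<forall>j\<in>{1, 2}.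
                 \<langle>corner (cut_down (a i) \<epsilon>)\<rangle> \<le>\<^sub>W \<langle>p\<rangle> \<and>
                 \<langle>p\<rangle> \<le>\<^sub>W m \<cdot>\<^sub>W \<langle>corner (b j)\<rangle>)))) \<and>
     (ideal_property A \<longleftrightarrow>
        (\<forall>a :: 'a. positive_element a \<longrightarrow>
           (\<forall>\<epsilon>>0. \<exists>p m. projection p \<and> 1 \<le> m \<and> sum_of_projections p \<and>
              \<langle>corner (cut_down a \<epsilon>)\<rangle> \<le>\<^sub>W \<langle>p\<rangle> \<and>
              \<langle>p\<rangle> \<le>\<^sub>W m \<cdot>\<^sub>W \<langle>corner a\<rangle>)))"
    (is "(?i \<longleftrightarrow> ?ii) \<and> (?i \<longleftrightarrow> ?iii)")
proof -
  have A: "ideal_property A = ideal_property TYPE('a)" by (simp add: ideal_property_def)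
  have "?ii" if "?i"
    using that unfolding A by (intro allI impI ideal_property_imp_interpolation) auto
  moreover have "?iii" if ii: "?ii"
  proof (intro allI impI)
    fix a :: 'a and \<epsilon> :: real assume a: "positive_element a" and \<epsilon>: "0 < \<epsilon>"
    \<comment> \<open>The constant families a_i = b_j = a satisfy the hypothesis of (ii) by
      reflexivity.\<close>
    have "corner a \<in> \<langle>corner a\<rangle>" by (rule diag_in_cuntz_class) (use a in simp)
    then have "\<langle>corner a\<rangle> \<le>\<^sub>W \<langle>corner a\<rangle>"
      unfolding cuntz_le_def using cuntz_class_below(1) by blast
    with a have "(\<forall>i\<in>{1, 2::nat}. positive_element a \<and> positive_element a) \<and>
        (\<forall>i\<in>{1, 2::nat}. \<forall>j\<in>{1, 2::nat}. \<langle>corner a\<rangle> \<le>\<^sub>W \<langle>corner a\<rangle>)"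
      by blast
    from ii[THEN spec, of "\<lambda>_. a", THEN spec, of "\<lambda>_. a", THEN mp, OF this, THEN spec, THEN mp, OF \<epsilon>]
    obtain p m where p: "projection p" "1 \<le> m" "sum_of_projections p"
      and all: "\<forall>i\<in>{1, 2::nat}. \<forall>j\<in>{1, 2::nat}.
        \<langle>corner (cut_down a \<epsilon>)\<rangle> \<le>\<^sub>W \<langle>p\<rangle> \<and> \<langle>p\<rangle> \<le>\<^sub>W m \<cdot>\<^sub>W \<langle>corner a\<rangle>"
      by (elim exE conjE) (rule that)
    have "\<langle>corner (cut_down a \<epsilon>)\<rangle> \<le>\<^sub>W \<langle>p\<rangle> \<and> \<langle>p\<rangle> \<le>\<^sub>W m \<cdot>\<^sub>W \<langle>corner a\<rangle>"
      by (rule all[THEN bspec, of 1, THEN bspec, of 1]) simp_all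
    with p have "projection p \<and> 1 \<le> m \<and> sum_of_projections p \<and>
        \<langle>corner (cut_down a \<epsilon>)\<rangle> \<le>\<^sub>W \<langle>p\<rangle> \<and> \<langle>p\<rangle> \<le>\<^sub>W m \<cdot>\<^sub>W \<langle>corner a\<rangle>"
      by (intro conjI) (assumption | erule conjunct1 | erule conjunct2)+
    then show "\<exists>p m. projection p \<and> 1 \<le> m \<and> sum_of_projections p \<and>
        \<langle>corner (cut_down a \<epsilon>)\<rangle> \<le>\<^sub>W \<langle>p\<rangle> \<and> \<langle>p\<rangle> \<le>\<^sub>W m \<cdot>\<^sub>W \<langle>corner a\<rangle>"
      by (intro exI)
  qed
  moreover have "?i" if "?iii"
    unfolding A by (rule ideal_property_of_cut_down) (use that in blast)
  ultimately show ?thesis by blast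
qed

end
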